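(* Let $X$ be a non-normal locally irreducible complex space of pure dimension. Then the Grauert-Riemenschneider canonical sheaf $\mathscr{K}_X$ of $X$ is not locally free.
   Context: Complex spaces are reduced. For a locally irreducible complex space $X$ of pure dimension $n$, the Grauert-Riemenschneider canonical sheaf is $\mathscr{K}_X:=\pi_*\Omega^n_M$, where $\pi:M\to X$ is a resolution of singularities and $\Omega^n_M$ is the sheaf of holomorphic $n$-forms on $M$; it is independent of the resolution. *)

theory Defs
  imports "HOL-Analysis.Analysis" "HOL-Algebra.Module"
begin

section \<open>Several complex variables\<close>

text \<open>
  Since the number of variables has to vary inside statements, the space \<open>C^N\<close> is the set of
  complex sequences vanishing from position \<open>N\<close> on, with the topology induced by the product
  topology (the convention of the library for \<open>Euclidean_space\<close>).
\<close>

definition coord_space :: "nat \<Rightarrow> (nat \<Rightarrow> complex) set" where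
  "coord_space N = {z. \<forall>i\<ge>N. z i = 0}"

definition coord_top :: "nat \<Rightarrow> (nat \<Rightarrow> complex) topology" where
  "coord_top N = subtopology euclidean (coord_space N)"

text \<open>Holomorphic means continuous and holomorphic in each variable separately.\<close>

definition several_holomorphic ::
    "nat \<Rightarrow> (nat \<Rightarrow> complex) set \<Rightarrow> ((nat \<Rightarrow> complex) \<Rightarrow> complex) \<Rightarrow> bool" where
  "several_holomorphic N D f \<longleftrightarrow>
     openin (coord_top N) D \<and> continuous_on D f \<and>
     (\<forall>z\<in>D. \<forall>i<N. (\<lambda>t. f (z(i := t))) holomorphic_on {t. z(i := t) \<in> D})"

text \<open>The value at \<open>v\<close> of the differential at \<open>z\<close> of a map \<open>F\<close> between open sets of \<open>C^n\<close>.\<close>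

definition differential ::
    "nat \<Rightarrow> ((nat \<Rightarrow> complex) \<Rightarrow> (nat \<Rightarrow> complex)) \<Rightarrow> (nat \<Rightarrow> complex) \<Rightarrow> (nat \<Rightarrow> complex)
       \<Rightarrow> (nat \<Rightarrow> complex)" where
  "differential n F z v =
     (\<lambda>i. if i < n then \<Sum>l<n. deriv (\<lambda>t. F (z(l := t)) i) (z l) * v l else 0)"


section \<open>Reduced complex spaces\<close>

text \<open>
  The structure sheaf of a reduced complex space is a subsheaf of the sheaf of continuous
  complex-valued functions. So a space is given by a topology together with, for every open set
  \<open>U\<close>, the set \<open>hol X U\<close> of holomorphic functions on \<open>U\<close>; a function on \<open>U\<close> is an element of
  \<open>extensional U\<close>. Only the values of \<open>hol X\<close> on open sets matter.
\<close>

record 'a function_space =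
  topo :: "'a topology"
  hol :: "'a set \<Rightarrow> ('a \<Rightarrow> complex) set"

abbreviation points :: "'a function_space \<Rightarrow> 'a set" where
  "points X \<equiv> topspace (topo X)"

definition function_sheaf :: "'a function_space \<Rightarrow> bool" where
  "function_sheaf X \<longleftrightarrow>
     (\<forall>U. openin (topo X) U \<longrightarrow>
        hol X U \<subseteq> extensional U \<and>
        (\<forall>f\<in>hol X U. \<forall>V. openin (topo X) V \<and> V \<subseteq> U \<longrightarrow> restrict f V \<in> hol X V) \<and>
        (\<forall>f\<in>extensional U.
           (\<forall>x\<in>U. \<exists>V. openin (topo X) V \<and> x \<in> V \<and> V \<subseteq> U \<and> restrict f V \<in> hol X V)
           \<longrightarrow> f \<in> hol X U))"

definition open_subspace :: "'a function_space \<Rightarrow> 'a set \<Rightarrow> 'a function_space" where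
  "open_subspace X U = \<lparr>topo = subtopology (topo X) U, hol = hol X\<rparr>"

definition preimage ::
    "'a function_space \<Rightarrow> ('a \<Rightarrow> 'b) \<Rightarrow> 'b set \<Rightarrow> 'a set" where
  "preimage X f V = {x \<in> points X. f x \<in> V}"

definition holomorphic_map ::
    "'a function_space \<Rightarrow> 'b function_space \<Rightarrow> ('a \<Rightarrow> 'b) \<Rightarrow> bool" where
  "holomorphic_map X Y f \<longleftrightarrow>
     continuous_map (topo X) (topo Y) f \<and>
     (\<forall>V g. openin (topo Y) V \<and> g \<in> hol Y V \<longrightarrow>
        (\<lambda>x\<in>preimage X f V. g (f x)) \<in> hol X (preimage X f V))"

definition biholomorphic ::
    "'a function_space \<Rightarrow> 'b function_space \<Rightarrow> ('a \<Rightarrow> 'b) \<Rightarrow> bool" where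
  "biholomorphic X Y f \<longleftrightarrow>
     holomorphic_map X Y f \<and>
     (\<exists>g. holomorphic_map Y X g \<and>
        (\<forall>x\<in>points X. g (f x) = x) \<and> (\<forall>y\<in>points Y. f (g y) = y))"

text \<open>
  A subset \<open>A\<close> of \<open>C^N\<close> with the functions that are locally restrictions of holomorphic
  functions. For an analytic set \<open>A\<close> in an open set this is the reduced local model; for an
  open set \<open>A\<close> it is \<open>A\<close> with its holomorphic functions.
\<close>

definition local_model :: "nat \<Rightarrow> (nat \<Rightarrow> complex) set \<Rightarrow> (nat \<Rightarrow> complex) function_space" where
  "local_model N A =
     \<lparr>topo = subtopology (coord_top N) A,
      hol = (\<lambda>V. {f \<in> extensional V. \<forall>z\<in>V. \<exists>W h.
                    openin (coord_top N) W \<and> z \<in> W \<and> several_holomorphic N W h \<and>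
                    (\<forall>w\<in>V \<inter> W. f w = h w)})\<rparr>"

definition complex_space :: "'a function_space \<Rightarrow> bool" where
  "complex_space X \<longleftrightarrow>
     Hausdorff_space (topo X) \<and> function_sheaf X \<and>
     (\<forall>x\<in>points X. \<exists>U N D E \<phi>.
        openin (topo X) U \<and> x \<in> U \<and> openin (coord_top N) D \<and>
        finite E \<and> (\<forall>h\<in>E. several_holomorphic N D h) \<and>
        biholomorphic (open_subspace X U) (local_model N {z\<in>D. \<forall>h\<in>E. h z = 0}) \<phi>)"

definition analytic_subset :: "'a function_space \<Rightarrow> 'a set \<Rightarrow> bool" where
  "analytic_subset X A \<longleftrightarrow>
     A \<subseteq> points X \<and>
     (\<forall>x\<in>points X. \<exists>U E. openin (topo X) U \<and> x \<in> U \<and> finite E \<and> E \<subseteq> hol X U \<and>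
        A \<inter> U = {y\<in>U. \<forall>f\<in>E. f y = 0})"

text \<open>The germ of \<open>X\<close> at \<open>x\<close> is not the union of two proper analytic subgerms.\<close>

definition irreducible_at :: "'a function_space \<Rightarrow> 'a \<Rightarrow> bool" where
  "irreducible_at X x \<longleftrightarrow>
     (\<forall>U A B. openin (topo X) U \<and> x \<in> U \<and>
        analytic_subset (open_subspace X U) A \<and> analytic_subset (open_subspace X U) B \<and>
        A \<union> B = U \<longrightarrow>
        (\<exists>W. openin (topo X) W \<and> x \<in> W \<and> (W \<subseteq> A \<or> W \<subseteq> B)))"

definition locally_irreducible :: "'a function_space \<Rightarrow> bool" where
  "locally_irreducible X \<longleftrightarrow> (\<forall>x\<in>points X. irreducible_at X x)"

text \<open>
  The dimension at \<open>x\<close> is the least number of holomorphic functions near \<open>x\<close> for which \<open>x\<close> is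
  an isolated common zero.
\<close>

definition dim_at :: "'a function_space \<Rightarrow> 'a \<Rightarrow> nat" where
  "dim_at X x = (LEAST d. \<exists>U f. openin (topo X) U \<and> x \<in> U \<and> (\<forall>i<d. f i \<in> hol X U) \<and>
     {y\<in>U. \<forall>i<d. f i y = 0} = {x})"

definition pure_dimensional :: "'a function_space \<Rightarrow> nat \<Rightarrow> bool" where
  "pure_dimensional X n \<longleftrightarrow> (\<forall>x\<in>points X. dim_at X x = n)"


section \<open>Stalks and normality\<close>

definition germ :: "'a function_space \<Rightarrow> 'a \<Rightarrow> 'a set \<Rightarrow> ('a \<Rightarrow> complex)
    \<Rightarrow> ('a set \<times> ('a \<Rightarrow> complex)) set" where
  "germ X x U f = {(V, g). openin (topo X) V \<and> x \<in> V \<and> g \<in> hol X V \<and>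
     (\<exists>W. openin (topo X) W \<and> x \<in> W \<and> W \<subseteq> U \<inter> V \<and> (\<forall>y\<in>W. f y = g y))}"

text \<open>
  The sum and the product of germs are taken over all representatives; all the sets in these
  unions coincide.
\<close>

definition stalk :: "'a function_space \<Rightarrow> 'a \<Rightarrow> ('a set \<times> ('a \<Rightarrow> complex)) set ring" where
  "stalk X x =
     \<lparr>carrier = {germ X x U f | U f. openin (topo X) U \<and> x \<in> U \<and> f \<in> hol X U},
      mult = (\<lambda>a b. \<Union>(U, f)\<in>a. \<Union>(V, g)\<in>b. germ X x (U \<inter> V) (\<lambda>y\<in>U \<inter> V. f y * g y)),
      one = germ X x (points X) (\<lambda>y\<in>points X. 1),
      zero = germ X x (points X) (\<lambda>y\<in>points X. 0),
      add = (\<lambda>a b. \<Union>(U, f)\<in>a. \<Union>(V, g)\<in>b. germ X x (U \<inter> V) (\<lambda>y\<in>U \<inter> V. f y + g y))\<rparr>"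

definition non_zero_divisor :: "('r, 'm) ring_scheme \<Rightarrow> 'r \<Rightarrow> bool" where
  "non_zero_divisor R b \<longleftrightarrow>
     b \<in> carrier R \<and> (\<forall>a\<in>carrier R. a \<otimes>\<^bsub>R\<^esub> b = \<zero>\<^bsub>R\<^esub> \<longrightarrow> a = \<zero>\<^bsub>R\<^esub>)"

text \<open>
  A commutative ring \<open>R\<close> is integrally closed in its total ring of fractions: every fraction
  \<open>a/b\<close> (with \<open>b\<close> not a zero divisor) satisfying a monic equation
  \<open>(a/b)^m + c_{m-1} (a/b)^(m-1) + ... + c_0 = 0\<close> over \<open>R\<close> lies in \<open>R\<close>. The equation is
  multiplied by \<open>b^m\<close> so as to be an equation in \<open>R\<close>.
\<close>

definition integrally_closed :: "('r, 'm) ring_scheme \<Rightarrow> bool" where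
  "integrally_closed R \<longleftrightarrow>
     (\<forall>a b (m::nat) c. a \<in> carrier R \<and> non_zero_divisor R b \<and> c \<in> {..<m} \<rightarrow> carrier R \<and>
        a [^]\<^bsub>R\<^esub> m \<oplus>\<^bsub>R\<^esub> (\<Oplus>\<^bsub>R\<^esub>i\<in>{..<m}. c i \<otimes>\<^bsub>R\<^esub> (a [^]\<^bsub>R\<^esub> i \<otimes>\<^bsub>R\<^esub> b [^]\<^bsub>R\<^esub> (m - i))) = \<zero>\<^bsub>R\<^esub> \<longrightarrow>
        (\<exists>q\<in>carrier R. a = q \<otimes>\<^bsub>R\<^esub> b))"

definition normal_complex_space :: "'a function_space \<Rightarrow> bool" where
  "normal_complex_space X \<longleftrightarrow> (\<forall>x\<in>points X. integrally_closed (stalk X x))"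


section \<open>Sheaves of modules\<close>

text \<open>
  The module of sections over each open set, and the restriction map from a first to a second
  open set. The multiplicative ring operations contained in the module record are irrelevant.
\<close>

record ('a, 's) module_sheaf =
  sections :: "'a set \<Rightarrow> ('a \<Rightarrow> complex, 's) module"
  restriction :: "'a set \<Rightarrow> 'a set \<Rightarrow> 's \<Rightarrow> 's"

definition free_sheaf ::
    "'a function_space \<Rightarrow> nat \<Rightarrow> ('a, nat \<Rightarrow> 'a \<Rightarrow> complex) module_sheaf" where
  "free_sheaf X r =
     \<lparr>sections = (\<lambda>U.
        \<lparr>carrier = (\<Pi>\<^sub>E i\<in>{..<r}. hol X U),
         mult = undefined, one = undefined,
         zero = (\<lambda>i\<in>{..<r}. \<lambda>x\<in>U. 0),
         add = (\<lambda>s t. \<lambda>i\<in>{..<r}. \<lambda>x\<in>U. s i x + t i x),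
         smult = (\<lambda>f s. \<lambda>i\<in>{..<r}. \<lambda>x\<in>U. f x * s i x)\<rparr>),
      restriction = (\<lambda>U V s. \<lambda>i\<in>{..<r}. restrict (s i) V)\<rparr>"

text \<open>\<open>\<Phi>\<close> is an isomorphism over the open set \<open>U\<close> of sheaves of modules over the structure sheaf.\<close>

definition sheaf_iso_on ::
    "'a function_space \<Rightarrow> 'a set \<Rightarrow> ('a, 's) module_sheaf \<Rightarrow> ('a, 't) module_sheaf
       \<Rightarrow> ('a set \<Rightarrow> 's \<Rightarrow> 't) \<Rightarrow> bool" where
  "sheaf_iso_on X U F G \<Phi> \<longleftrightarrow>
     (\<forall>V. openin (topo X) V \<and> V \<subseteq> U \<longrightarrow>
        bij_betw (\<Phi> V) (carrier (sections F V)) (carrier (sections G V)) \<and>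
        (\<forall>s\<in>carrier (sections F V). \<forall>t\<in>carrier (sections F V).
           \<Phi> V (s \<oplus>\<^bsub>sections F V\<^esub> t) = \<Phi> V s \<oplus>\<^bsub>sections G V\<^esub> \<Phi> V t) \<and>
        (\<forall>f\<in>hol X V. \<forall>s\<in>carrier (sections F V).
           \<Phi> V (f \<odot>\<^bsub>sections F V\<^esub> s) = f \<odot>\<^bsub>sections G V\<^esub> \<Phi> V s) \<and>
        (\<forall>W. openin (topo X) W \<and> W \<subseteq> V \<longrightarrow>
           (\<forall>s\<in>carrier (sections F V).
              \<Phi> W (restriction F V W s) = restriction G V W (\<Phi> V s))))"

definition locally_free :: "'a function_space \<Rightarrow> ('a, 's) module_sheaf \<Rightarrow> bool" where
  "locally_free X F \<longleftrightarrow>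
     (\<forall>x\<in>points X. \<exists>U r \<Phi>. openin (topo X) U \<and> x \<in> U \<and> sheaf_iso_on X U (free_sheaf X r) F \<Phi>)"

definition pushforward ::
    "'b function_space \<Rightarrow> ('b \<Rightarrow> 'a) \<Rightarrow> ('b, 's) module_sheaf \<Rightarrow> ('a, 's) module_sheaf" where
  "pushforward M \<pi> F =
     \<lparr>sections = (\<lambda>U. let S = sections F (preimage M \<pi> U) in
        \<lparr>carrier = carrier S, mult = mult S, one = one S, zero = zero S, add = add S,
         smult = (\<lambda>f. smult S (\<lambda>p\<in>preimage M \<pi> U. f (\<pi> p)))\<rparr>),
      restriction = (\<lambda>U V. restriction F (preimage M \<pi> U) (preimage M \<pi> V))\<rparr>"


section \<open>Complex manifolds and holomorphic forms\<close>

text \<open>The charts of \<open>M\<close> with values in \<open>C^n\<close> and with domain contained in \<open>U\<close>.\<close>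

definition charts ::
    "nat \<Rightarrow> 'b function_space \<Rightarrow> 'b set \<Rightarrow> ('b set \<times> ('b \<Rightarrow> nat \<Rightarrow> complex)) set" where
  "charts n M U = {(V, \<phi>). openin (topo M) V \<and> V \<subseteq> U \<and> openin (coord_top n) (\<phi> ` V) \<and>
     biholomorphic (open_subspace M V) (local_model n (\<phi> ` V)) \<phi>}"

definition complex_manifold :: "nat \<Rightarrow> 'b function_space \<Rightarrow> bool" where
  "complex_manifold n M \<longleftrightarrow>
     Hausdorff_space (topo M) \<and> function_sheaf M \<and>
     (\<forall>p\<in>points M. \<exists>(V, \<phi>)\<in>charts n M (points M). p \<in> V)"

definition vector_tuples :: "nat \<Rightarrow> nat \<Rightarrow> (nat \<Rightarrow> nat \<Rightarrow> complex) set" where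
  "vector_tuples n k = (\<Pi>\<^sub>E j\<in>{..<k}. coord_space n)"

text \<open>The alternating \<open>k\<close>-linear forms on \<open>C^n\<close>.\<close>

definition alternating_forms :: "nat \<Rightarrow> nat \<Rightarrow> ((nat \<Rightarrow> nat \<Rightarrow> complex) \<Rightarrow> complex) set" where
  "alternating_forms n k = {\<alpha> \<in> extensional (vector_tuples n k).
     (\<forall>v\<in>vector_tuples n k. \<forall>j<k. \<forall>x\<in>coord_space n. \<forall>y\<in>coord_space n. \<forall>a b.
        \<alpha> (v(j := (\<lambda>i. a * x i + b * y i))) = a * \<alpha> (v(j := x)) + b * \<alpha> (v(j := y))) \<and>
     (\<forall>v\<in>vector_tuples n k. \<forall>j<k. \<forall>l<k. j \<noteq> l \<and> v j = v l \<longrightarrow> \<alpha> v = 0)}"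

text \<open>
  A holomorphic \<open>k\<close>-form \<open>\<omega>\<close> on an open set \<open>U\<close> of an \<open>n\<close>-dimensional manifold is given by its
  expressions in the charts \<open>(V, \<phi>)\<close> of \<open>U\<close>: \<open>\<omega> (V, \<phi>) p\<close> is the alternating form on \<open>C^n\<close>
  which corresponds to the value of \<open>\<omega>\<close> at \<open>p \<in> V\<close> under the identification of the tangent
  space at \<open>p\<close> with \<open>C^n\<close> by the differential of \<open>\<phi>\<close>. The expressions in two charts are related
  by pullback along the coordinate change \<open>\<psi> \<circ> \<phi>\<^sup>-\<^sup>1\<close>, and the coefficients are holomorphic.
\<close>

type_synonym 'b form =
  "'b set \<times> ('b \<Rightarrow> nat \<Rightarrow> complex) \<Rightarrow> 'b \<Rightarrow> (nat \<Rightarrow> nat \<Rightarrow> complex) \<Rightarrow> complex"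

definition holomorphic_forms :: "nat \<Rightarrow> nat \<Rightarrow> 'b function_space \<Rightarrow> 'b set \<Rightarrow> 'b form set" where
  "holomorphic_forms n k M U =
     {\<omega> \<in> (\<Pi>\<^sub>E (V, \<phi>)\<in>charts n M U. \<Pi>\<^sub>E p\<in>V. alternating_forms n k).
       (\<forall>(V, \<phi>)\<in>charts n M U. \<forall>(W, \<psi>)\<in>charts n M U. \<forall>p\<in>V \<inter> W. \<forall>v\<in>vector_tuples n k.
          \<omega> (V, \<phi>) p v =
          \<omega> (W, \<psi>) p (\<lambda>j\<in>{..<k}. differential n (\<psi> \<circ> inv_into V \<phi>) (\<phi> p) (v j))) \<and>
       (\<forall>(V, \<phi>)\<in>charts n M U. \<forall>v\<in>vector_tuples n k. (\<lambda>p\<in>V. \<omega> (V, \<phi>) p v) \<in> hol M V)}"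

definition form_sheaf :: "nat \<Rightarrow> nat \<Rightarrow> 'b function_space \<Rightarrow> ('b, 'b form) module_sheaf" where
  "form_sheaf n k M =
     \<lparr>sections = (\<lambda>U.
        \<lparr>carrier = holomorphic_forms n k M U,
         mult = undefined, one = undefined,
         zero = (\<lambda>(V, \<phi>)\<in>charts n M U. \<lambda>p\<in>V. \<lambda>v\<in>vector_tuples n k. 0),
         add = (\<lambda>\<omega> \<eta>. \<lambda>(V, \<phi>)\<in>charts n M U. \<lambda>p\<in>V. \<lambda>v\<in>vector_tuples n k.
                  \<omega> (V, \<phi>) p v + \<eta> (V, \<phi>) p v),
         smult = (\<lambda>f \<omega>. \<lambda>(V, \<phi>)\<in>charts n M U. \<lambda>p\<in>V. \<lambda>v\<in>vector_tuples n k.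
                  f p * \<omega> (V, \<phi>) p v)\<rparr>),
      restriction = (\<lambda>U U' \<omega>. restrict \<omega> (charts n M U'))\<rparr>"


section \<open>Resolutions and the Grauert--Riemenschneider canonical sheaf\<close>

text \<open>
  A proper modification of \<open>X\<close> by an \<open>n\<close>-dimensional complex manifold; the centre \<open>A\<close> is not
  required to be the singular locus.
\<close>

definition resolution ::
    "nat \<Rightarrow> 'a function_space \<Rightarrow> 'b function_space \<Rightarrow> ('b \<Rightarrow> 'a) \<Rightarrow> bool" where
  "resolution n X M \<pi> \<longleftrightarrow>
     complex_manifold n M \<and> holomorphic_map M X \<pi> \<and> proper_map (topo M) (topo X) \<pi> \<and>
     \<pi> ` points M = points X \<and>
     (\<exists>A. analytic_subset X A \<and> topo X interior_of A = {} \<and>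
        topo M interior_of (preimage M \<pi> A) = {} \<and>
        biholomorphic (open_subspace M (points M - preimage M \<pi> A))
          (open_subspace X (points X - A)) \<pi>)"

definition GR_canonical_sheaf ::
    "nat \<Rightarrow> 'b function_space \<Rightarrow> ('b \<Rightarrow> 'a) \<Rightarrow> ('a, 'b form) module_sheaf" where
  "GR_canonical_sheaf n M \<pi> = pushforward M \<pi> (form_sheaf n n M)"

end

theory Submission
  imports Defs "HOL-Complex_Analysis.Complex_Analysis"
begin

text \<open>
  Suppose that \<open>K = \<pi>\<^sub>* \<Omega>\<^sup>n\<close> is locally free; then \<open>X\<close> is normal, for the following reason. Functions on
  \<open>M\<close> act on \<open>K\<close> by multiplication of forms, so \<open>K\<close> is a module over \<open>\<pi>\<^sub>* O\<^sub>M\<close> and not only over \<open>O\<^sub>X\<close>.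
  A function integral over \<open>O\<^sub>X\<close> becomes a holomorphic function on \<open>M\<close>, and through its action on a free
  \<open>K\<close> it can be recovered as a section of \<open>O\<^sub>X\<close>.

  In detail, let \<open>a\<close>, \<open>b\<close> and \<open>c\<^sub>i\<close> be holomorphic near \<open>x \<in> X\<close> with
  \<open>a\<^sup>m + \<Sum> c\<^sub>i a\<^sup>i b\<^bsup>m-i\<^esup> = 0\<close>. The quotient of \<open>a \<circ> \<pi>\<close> by \<open>b \<circ> \<pi>\<close> is a root of a monic
  polynomial with locally bounded coefficients, hence locally bounded. As \<open>M\<close> is a manifold, Riemann's
  extension theorem yields a holomorphic \<open>h\<close> on \<open>M\<close> near the fibre of \<open>x\<close> with
  \<open>a \<circ> \<pi> = (b \<circ> \<pi>) h\<close> (\<open>manifold_integral_quotient\<close>). Let \<open>\<Phi>\<close> be an isomorphism from the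
  free sheaf of rank \<open>r\<close> to \<open>K\<close> near \<open>x\<close>, let \<open>e\<close> be a section of the free sheaf one of whose entries is \<open>1\<close>,
  and write \<open>h \<Phi>(e) = \<Phi>(q)\<close>. Then \<open>\<Phi>(b q) = b h \<Phi>(e) = a \<Phi>(e) = \<Phi>(a e)\<close>, so \<open>b q = a e\<close>, and
  the corresponding entry of \<open>q\<close> is a holomorphic quotient of \<open>a\<close> by \<open>b\<close>
  (\<open>locally_free_GR_stalk_integrally_closed\<close>).

  Such an \<open>e\<close> exists only if \<open>r > 0\<close>, that is, if \<open>K\<close> has nonzero sections over some small open set. Off its
  centre \<open>\<pi>\<close> is biholomorphic, so some open set of \<open>X\<close> is isomorphic to the domain of a chart of \<open>M\<close>, on
  which \<open>dz\<^sub>1 \<and> \<dots> \<and> dz\<^sub>n\<close> is such a section (\<open>nonzero_form_on_chart\<close>, \<open>GR_nonzero_section\<close>).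

  The analysis in several variables behind this consists of the chain rule, which makes the form
  \<open>dz\<^sub>1 \<and> \<dots> \<and> dz\<^sub>n\<close> compatible with changes of charts, and of the extension theorem
  \<open>local_integral_quotient\<close>. Both are derived from Cauchy's formula in a single variable. The algebra of
  stalks enters through \<open>stalk_integrally_closedI\<close>, which replaces identities of germs by identities
  of functions.
\<close>

section \<open>The topology of complex coordinate spaces\<close>

definition polydisc :: "nat \<Rightarrow> (nat \<Rightarrow> complex) \<Rightarrow> real \<Rightarrow> (nat \<Rightarrow> complex) set" where
  "polydisc N z r = {w \<in> coord_space N. \<forall>i<N. dist (w i) (z i) < r}"

lemma topspace_coord_top [simp]: "topspace (coord_top N) = coord_space N"
  by (simp add: coord_top_def)

lemma openin_coord_top_iff: "openin (coord_top N) D \<longleftrightarrow> (\<exists>T. open T \<and> D = coord_space N \<inter> T)"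
  unfolding coord_top_def openin_subtopology by (metis Int_commute open_openin)

lemma openin_coord_subset: "openin (coord_top N) D \<Longrightarrow> D \<subseteq> coord_space N"
  by (metis openin_subset topspace_coord_top)

lemma coord_space_upd: "z \<in> coord_space N \<Longrightarrow> i < N \<Longrightarrow> z(i := t) \<in> coord_space N"
  by (auto simp: coord_space_def)

lemma centre_in_polydisc: "z \<in> coord_space N \<Longrightarrow> 0 < r \<Longrightarrow> z \<in> polydisc N z r"
  by (auto simp: polydisc_def)

lemma polydisc_mono: "r \<le> s \<Longrightarrow> polydisc N z r \<subseteq> polydisc N z s"
  by (auto simp: polydisc_def intro: less_le_trans)

lemma openin_polydisc: "openin (coord_top N) (polydisc N z r)"
proof -
  have "open (\<Inter>i\<in>{..<N}. (\<lambda>w::nat \<Rightarrow> complex. w i) -` ball (z i) r)"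
    by (intro open_INT ballI open_vimage continuous_on_product_coordinates) auto
  moreover have "polydisc N z r = coord_space N \<inter> (\<Inter>i\<in>{..<N}. (\<lambda>w. w i) -` ball (z i) r)"
    by (auto simp: polydisc_def dist_commute)
  ultimately show ?thesis unfolding openin_coord_top_iff by blast
qed

lemma polydisc_in_open:
  assumes "openin (coord_top N) D" "z \<in> D"
  obtains r where "0 < r" "polydisc N z r \<subseteq> D"
proof -
  obtain T where T: "open T" "D = coord_space N \<inter> T"
    using assms(1) openin_coord_top_iff by blast
  have "openin (product_topology (\<lambda>i. euclidean) UNIV) T"
    using T(1) by (simp add: open_fun_def)
  then obtain X where X: "z \<in> (\<Pi>\<^sub>E i\<in>UNIV. X i)" "\<And>i. open (X i)" "(\<Pi>\<^sub>E i\<in>UNIV. X i) \<subseteq> T"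
    using product_topology_open_contains_basis[of "\<lambda>i. euclidean" UNIV T z] assms(2) T(2)
    by auto
  have "\<exists>e>0. ball (z i) e \<subseteq> X i" for i
    using X(1,2) by (metis PiE_mem UNIV_I open_contains_ball)
  then obtain e where e: "\<And>i. e i > 0" "\<And>i. ball (z i) (e i) \<subseteq> X i" by metis
  define r where "r = Min (insert 1 (e ` {..<N}))"
  have "r > 0" using e(1) by (auto simp: r_def)
  moreover have "polydisc N z r \<subseteq> D"
  proof
    fix w assume w: "w \<in> polydisc N z r"
    have "w i \<in> X i" for i
    proof (cases "i < N")
      case True
      then have "r \<le> e i" by (auto simp: r_def)
      moreover have "dist (w i) (z i) < r" using w True by (auto simp: polydisc_def)
      ultimately have "w i \<in> ball (z i) (e i)" by (simp add: dist_commute)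
      then show ?thesis using e(2) by blast
    next
      case False
      then have "w i = z i" using w assms(2) T(2) by (auto simp: polydisc_def coord_space_def)
      then show ?thesis using X(1) by (metis PiE_mem UNIV_I)
    qed
    then have "w \<in> T" using X(3) by (auto simp: PiE_UNIV_domain)
    then show "w \<in> D" using w T(2) by (auto simp: polydisc_def)
  qed
  ultimately show ?thesis using that by blast
qed

lemma continuous_on_upd: "continuous_on S (\<lambda>t. z(i := t))"
  for z :: "nat \<Rightarrow> complex"
proof (rule continuous_on_coordinatewise_then_product)
  show "continuous_on S (\<lambda>t. (z(i := t)) j)" for j
    by (cases "j = i") (auto intro!: continuous_intros)
qed

lemma open_slice:
  assumes "openin (coord_top N) D" "z \<in> coord_space N" "i < N"
  shows "open {t. z(i := t) \<in> D}"
proof -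
  obtain T where T: "open T" "D = coord_space N \<inter> T"
    using assms(1) openin_coord_top_iff by blast
  have "{t. z(i := t) \<in> D} = (\<lambda>t. z(i := t)) -` T"
    using T(2) coord_space_upd[OF assms(2,3)] by auto
  then show ?thesis
    using open_vimage[OF T(1) continuous_on_upd] by simp
qed

section \<open>Holomorphic functions of several variables\<close>

text \<open>
  Testing the partial derivative only at the point itself suffices, because every other point of a
  slice is the centre of the same slice. In this form the condition is visibly local.
\<close>

lemma several_holomorphic_iff:
  "several_holomorphic N D f \<longleftrightarrow>
     openin (coord_top N) D \<and> continuous_on D f \<and>
     (\<forall>z\<in>D. \<forall>i<N. (\<lambda>t. f (z(i := t))) field_differentiable at (z i))" (is "?L \<longleftrightarrow> ?R")
proof
  assume L: ?L
  show ?R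
  proof (intro conjI ballI allI impI)
    fix z i assume zi: "z \<in> D" "i < N"
    have "open {t. z(i := t) \<in> D}"
      using L zi openin_coord_subset
      by (intro open_slice) (auto simp: several_holomorphic_def)
    moreover have "z i \<in> {t. z(i := t) \<in> D}" using zi by simp
    moreover have "(\<lambda>t. f (z(i := t))) holomorphic_on {t. z(i := t) \<in> D}"
      using L zi by (auto simp: several_holomorphic_def)
    ultimately show "(\<lambda>t. f (z(i := t))) field_differentiable at (z i)"
      using holomorphic_on_imp_differentiable_at by blast
  qed (use L in \<open>auto simp: several_holomorphic_def\<close>)
next
  assume R: ?R
  show ?L unfolding several_holomorphic_def
  proof (intro conjI ballI allI impI)
    fix z i assume zi: "z \<in> D" "i < N"
    show "(\<lambda>t. f (z(i := t))) holomorphic_on {t. z(i := t) \<in> D}"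
      unfolding holomorphic_on_def
    proof
      fix t assume t: "t \<in> {t. z(i := t) \<in> D}"
      then have "(\<lambda>s. f ((z(i := t))(i := s))) field_differentiable at ((z(i := t)) i)"
        using R zi by blast
      then show "(\<lambda>t. f (z(i := t))) field_differentiable at t within {t. z(i := t) \<in> D}"
        by (simp add: field_differentiable_at_within)
    qed
  qed (use R in auto)
qed

lemma several_holomorphic_open: "several_holomorphic N D f \<Longrightarrow> openin (coord_top N) D"
  and several_holomorphic_continuous: "several_holomorphic N D f \<Longrightarrow> continuous_on D f"
  by (auto simp: several_holomorphic_def)

lemma several_holomorphic_slice:
  assumes "several_holomorphic N D f" "z \<in> coord_space N" "i < N"
  shows "(\<lambda>t. f (z(i := t))) holomorphic_on {t. z(i := t) \<in> D}"
proof (cases "\<exists>t. z(i := t) \<in> D")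
  case True
  then obtain t where "z(i := t) \<in> D" by blast
  then have "(\<lambda>s. f ((z(i := t))(i := s))) holomorphic_on {s. (z(i := t))(i := s) \<in> D}"
    using assms by (auto simp only: several_holomorphic_def)
  then show ?thesis by simp
next
  case False
  then show ?thesis by (simp add: holomorphic_on_def)
qed

lemma several_holomorphic_partial:
  "several_holomorphic N D f \<Longrightarrow> z \<in> D \<Longrightarrow> i < N \<Longrightarrow>
     (\<lambda>t. f (z(i := t))) field_differentiable at (z i)"
  by (auto simp: several_holomorphic_iff)

lemma continuous_on_coord_local:
  fixes f :: "(nat \<Rightarrow> complex) \<Rightarrow> complex"
  assumes D: "openin (coord_top N) D"
    and loc: "\<And>z. z \<in> D \<Longrightarrow> \<exists>W. openin (coord_top N) W \<and> z \<in> W \<and> continuous_on (D \<inter> W) f"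
  shows "continuous_on D f"
  unfolding continuous_on_eq_continuous_within
proof
  fix z assume z: "z \<in> D"
  obtain W where W: "openin (coord_top N) W" "z \<in> W" "continuous_on (D \<inter> W) f"
    using loc[OF z] by blast
  obtain T where T: "open T" "W = coord_space N \<inter> T" using W(1) openin_coord_top_iff by blast
  have DT: "D \<inter> W = D \<inter> T" using T(2) openin_coord_subset[OF D] by blast
  have "continuous (at z within D \<inter> T) f"
    using z W(2,3) DT by (metis IntI continuous_on_eq_continuous_within)
  then show "continuous (at z within D) f"
    using at_within_nhd[of z T "D \<inter> T" D] T z W(2) by auto
qed

lemma several_holomorphic_local:
  assumes D: "openin (coord_top N) D"
    and loc: "\<And>z. z \<in> D \<Longrightarrow> \<exists>W h. openin (coord_top N) W \<and> z \<in> W \<and> several_holomorphic N W h \<and>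
      (\<forall>w\<in>D \<inter> W. f w = h w)"
  shows "several_holomorphic N D f"
  unfolding several_holomorphic_iff
proof (intro conjI D ballI allI impI)
  show "continuous_on D f"
  proof (rule continuous_on_coord_local[OF D])
    fix z assume z: "z \<in> D"
    obtain W h where W: "openin (coord_top N) W" "z \<in> W" "several_holomorphic N W h"
      "\<forall>w\<in>D \<inter> W. f w = h w" using loc[OF z] by blast
    have "continuous_on (D \<inter> W) h"
      using several_holomorphic_continuous[OF W(3)] continuous_on_subset by blast
    then have "continuous_on (D \<inter> W) f" using W(4) by (metis continuous_on_cong)
    then show "\<exists>W. openin (coord_top N) W \<and> z \<in> W \<and> continuous_on (D \<inter> W) f"
      using W(1,2) by blast
  qed
next
  fix z i assume z: "z \<in> D" and i: "i < N"
  obtain W h where W: "openin (coord_top N) W" "z \<in> W" "several_holomorphic N W h"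
    "\<forall>w\<in>D \<inter> W. f w = h w" using loc[OF z] by blast
  have zN: "z \<in> coord_space N" using D z openin_coord_subset by blast
  have o: "open {t. z(i := t) \<in> D \<inter> W}"
    using open_slice[OF openin_Int[OF D W(1)] zN i] .
  have ev: "eventually (\<lambda>t. t \<in> {t. z(i := t) \<in> D \<inter> W}) (nhds (z i))"
    by (rule eventually_nhds_in_open[OF o]) (use z W(2) in auto)
  obtain d where d: "((\<lambda>t. h (z(i := t))) has_field_derivative d) (at (z i))"
    using several_holomorphic_partial[OF W(3,2) i] unfolding field_differentiable_def by blast
  have "((\<lambda>t. f (z(i := t))) has_field_derivative d) (at (z i))"
    by (rule iffD1[OF DERIV_cong_ev d]) (use ev W(4) in \<open>auto elim!: eventually_mono\<close>)
  then show "(\<lambda>t. f (z(i := t))) field_differentiable at (z i)"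
    unfolding field_differentiable_def by blast
qed

lemma several_holomorphic_subset:
  assumes "several_holomorphic N D f" "openin (coord_top N) E" "E \<subseteq> D"
  shows "several_holomorphic N E f"
  using assms unfolding several_holomorphic_iff by (auto intro: continuous_on_subset)

lemma several_holomorphic_cong:
  assumes "several_holomorphic N D f" "\<And>z. z \<in> D \<Longrightarrow> f z = g z"
  shows "several_holomorphic N D g"
proof (rule several_holomorphic_local)
  show "openin (coord_top N) D" using assms(1) by (rule several_holomorphic_open)
  then show "\<exists>W h. openin (coord_top N) W \<and> z \<in> W \<and> several_holomorphic N W h \<and>
      (\<forall>w\<in>D \<inter> W. g w = h w)" if "z \<in> D" for z
    using assms that by (intro exI[of _ D] exI[of _ f]) auto
qed

lemma several_holomorphic_const: "openin (coord_top N) D \<Longrightarrow> several_holomorphic N D (\<lambda>z. c)"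
  by (simp add: several_holomorphic_def)

lemma several_holomorphic_add:
  "several_holomorphic N D f \<Longrightarrow> several_holomorphic N D g \<Longrightarrow>
     several_holomorphic N D (\<lambda>z. f z + g z)"
  unfolding several_holomorphic_def by (auto intro!: continuous_intros holomorphic_intros)

lemma several_holomorphic_mult:
  "several_holomorphic N D f \<Longrightarrow> several_holomorphic N D g \<Longrightarrow>
     several_holomorphic N D (\<lambda>z. f z * g z)"
  unfolding several_holomorphic_def by (auto intro!: continuous_intros holomorphic_intros)

lemma several_holomorphic_divide:
  "several_holomorphic N D f \<Longrightarrow> several_holomorphic N D g \<Longrightarrow> (\<And>z. z \<in> D \<Longrightarrow> g z \<noteq> 0) \<Longrightarrow>
     several_holomorphic N D (\<lambda>z. f z / g z)"
  unfolding several_holomorphic_def by (auto intro!: continuous_intros holomorphic_intros)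

lemma several_holomorphic_sum:
  assumes "openin (coord_top N) D" "\<And>k. k \<in> K \<Longrightarrow> several_holomorphic N D (f k)"
  shows "several_holomorphic N D (\<lambda>z. \<Sum>k\<in>K. f k z)"
  using assms(2)
proof (induction K rule: infinite_finite_induct)
  case (insert k K)
  then show ?case using several_holomorphic_add[of N D "f k" "\<lambda>z. \<Sum>k\<in>K. f k z"] by simp
qed (simp_all add: several_holomorphic_const[OF assms(1)])

lemma several_holomorphic_prod:
  assumes "openin (coord_top N) D" "\<And>k. k \<in> K \<Longrightarrow> several_holomorphic N D (f k)"
  shows "several_holomorphic N D (\<lambda>z. \<Prod>k\<in>K. f k z)"
  using assms(2)
proof (induction K rule: infinite_finite_induct)
  case (insert k K)
  then show ?case using several_holomorphic_mult[of N D "f k" "\<lambda>z. \<Prod>k\<in>K. f k z"] by simp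
qed (simp_all add: several_holomorphic_const[OF assms(1)])

lemma several_holomorphic_coordinate:
  assumes "openin (coord_top N) D"
  shows "several_holomorphic N D (\<lambda>z. z i)"
  unfolding several_holomorphic_def
proof (intro conjI assms ballI allI impI)
  show "continuous_on D (\<lambda>z. z i)"
    by (rule continuous_on_subset[OF continuous_on_product_coordinates]) auto
  fix z j
  show "(\<lambda>t. (z(j := t)) i) holomorphic_on {t. z(j := t) \<in> D}"
    by (cases "i = j") (auto intro!: holomorphic_intros)
qed


section \<open>Cauchy integrals with parameters\<close>

text \<open>
  Cauchy's formulas as plain integrals over an interval, to which the theorems on integrals that
  depend on a parameter from an arbitrary topological space apply.
\<close>

lemma Cauchy_mean_value:
  assumes "f holomorphic_on cball z r" "0 < r"
  shows "f z = integral {0..2 * pi} (\<lambda>t. f (z + r * cis t)) / (2 * of_real pi)"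
proof -
  have "2 * of_real pi * \<i> * f z = contour_integral (circlepath z r) (\<lambda>u. f u / (u - z))"
    using Cauchy_integral_circlepath_simple[OF assms(1), of z] assms(2)
    by (simp add: contour_integral_unique)
  also have "\<dots> = integral {0..2 * pi} (\<lambda>t. f (z + r * cis t) / (z + r * cis t - z) * r * \<i> * cis t)"
    unfolding circlepath_def by (rule contour_integral_part_circlepath_eq) simp
  also have "\<dots> = integral {0..2 * pi} (\<lambda>t. \<i> * f (z + r * cis t))"
    using assms(2) by (intro integral_cong) (simp add: field_simps)
  also have "\<dots> = \<i> * integral {0..2 * pi} (\<lambda>t. f (z + r * cis t))"
    by (rule integral_mult_right)
  finally show ?thesis by (simp add: field_simps)
qed

lemma Cauchy_deriv_mean_value:
  assumes "f holomorphic_on cball z r" "0 < r"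
  shows "deriv f z = integral {0..2 * pi} (\<lambda>t. f (z + r * cis t) / (r * cis t)) / (2 * of_real pi)"
proof -
  have "2 * of_real pi * \<i> * deriv f z = contour_integral (circlepath z r) (\<lambda>u. f u / (u - z)^2)"
    using Cauchy_contour_integral_circlepath_2[of z r f z] assms
    by (simp add: holomorphic_on_imp_continuous_on holomorphic_on_subset[OF _ ball_subset_cball])
  also have "\<dots> = integral {0..2 * pi} (\<lambda>t. f (z + r * cis t) / (z + r * cis t - z)^2 * r * \<i> * cis t)"
    unfolding circlepath_def by (rule contour_integral_part_circlepath_eq) simp
  also have "\<dots> = integral {0..2 * pi} (\<lambda>t. \<i> * (f (z + r * cis t) / (r * cis t)))"
    using assms(2) by (intro integral_cong) (simp add: field_simps power2_eq_square)
  also have "\<dots> = \<i> * integral {0..2 * pi} (\<lambda>t. f (z + r * cis t) / (r * cis t))"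
    by (rule integral_mult_right)
  finally show ?thesis by (simp add: field_simps)
qed

text \<open>
  Differentiation under the integral sign needs the derivative of the integrand to be continuous in
  both variables. By Cauchy's formula this derivative is itself an integral of \<open>F\<close>, so continuity of
  \<open>F\<close> is enough.
\<close>

lemma holomorphic_on_integral_param:
  fixes F :: "complex \<Rightarrow> real \<Rightarrow> complex"
  assumes U: "open U" and cont: "continuous_on (U \<times> {a..b}) (\<lambda>(z, t). F z t)"
    and hol: "\<And>t. t \<in> {a..b} \<Longrightarrow> (\<lambda>z. F z t) holomorphic_on U"
  shows "(\<lambda>z. integral {a..b} (F z)) holomorphic_on U"
  unfolding holomorphic_on_open[OF U]
proof
  fix z0 assume "z0 \<in> U"
  then obtain e where e: "e > 0" "cball z0 e \<subseteq> U" using U open_contains_cball by blast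
  \<comment> \<open>Half the radius, so that circles of radius \<open>r\<close> around all points near \<open>z0\<close> stay in \<open>U\<close>.\<close>
  define r where "r = e / 2"
  have r: "r > 0" "cball z r \<subseteq> U" if "z \<in> ball z0 r" for z
  proof -
    show "r > 0" using e by (simp add: r_def)
    show "cball z r \<subseteq> U"
    proof
      fix w assume "w \<in> cball z r"
      then have "dist z0 w \<le> e" using that dist_triangle[of z0 w z] by (simp add: r_def)
      then show "w \<in> U" using e by auto
    qed
  qed
  have r0: "r > 0" using e by (simp add: r_def)
  have bU: "ball z0 r \<subseteq> U" using e r0 by (auto simp: r_def)
  define fx where "fx z t = deriv (\<lambda>z. F z t) z" for z t
  have fx: "fx z t = integral {0..2 * pi} (\<lambda>s. F (z + r * cis s) t / (r * cis s)) / (2 * of_real pi)"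
    if "z \<in> ball z0 r" "t \<in> {a..b}" for z t
    unfolding fx_def
    by (rule Cauchy_deriv_mean_value) (use hol[OF that(2)] r that(1) holomorphic_on_subset in auto)
  have cont_circle: "continuous_on ((ball z0 r \<times> {a..b}) \<times> cbox 0 (2 * pi))
      (\<lambda>(p, s). F (fst p + r * cis s) (snd p) / (r * cis s))"
  proof -
    have "continuous_on ((ball z0 r \<times> {a..b}) \<times> cbox 0 (2 * pi))
      (\<lambda>q. (\<lambda>(z, t). F z t) (fst (fst q) + r * cis (snd q), snd (fst q)))"
    proof (rule continuous_on_compose2[OF cont])
      show "(\<lambda>q. (fst (fst q) + complex_of_real r * cis (snd q), snd (fst q))) `
        ((ball z0 r \<times> {a..b}) \<times> cbox 0 (2 * pi)) \<subseteq> U \<times> {a..b}"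
      proof (clarsimp simp del: mem_ball)
        fix z t s assume "z \<in> ball z0 r"
        then have "cball z r \<subseteq> U" by (rule r)
        moreover have "z + r * cis s \<in> cball z r" using r0 by (simp add: dist_norm norm_mult)
        ultimately show "z + r * cis s \<in> U" by blast
      qed
    qed (intro continuous_intros)
    then have "continuous_on ((ball z0 r \<times> {a..b}) \<times> cbox 0 (2 * pi))
      (\<lambda>q. F (fst (fst q) + r * cis (snd q)) (snd (fst q)) / (r * cis (snd q)))"
      using r0 by (intro continuous_on_divide continuous_intros) auto
    then show ?thesis by (simp add: case_prod_unfold)
  qed
  have "continuous_on (ball z0 r \<times> {a..b})
      (\<lambda>p. integral (cbox 0 (2 * pi)) (\<lambda>s. F (fst p + r * cis s) (snd p) / (r * cis s)) / (2 * of_real pi))"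
    by (intro continuous_on_divide continuous_on_const integral_continuous_on_param[OF cont_circle]) auto
  then have cfx: "continuous_on (ball z0 r \<times> cbox a b) (\<lambda>(z, t). fx z t)"
    unfolding cbox_interval by (rule continuous_on_eq) (auto simp: fx)
  have "(\<lambda>z. integral (cbox a b) (F z)) holomorphic_on ball z0 r"
  proof (rule leibniz_rule_holomorphic[OF _ _ cfx convex_ball])
    fix z t assume zt: "z \<in> ball z0 r" "t \<in> cbox a b"
    have "(\<lambda>z. F z t) field_differentiable at z"
      using hol[of t] zt bU U holomorphic_on_imp_differentiable_at by (metis cbox_interval subsetD)
    then show "((\<lambda>z. F z t) has_field_derivative fx z t) (at z within ball z0 r)"
      unfolding fx_def by (simp add: field_differentiable_derivI has_field_derivative_at_within)
  next
    fix z assume z: "z \<in> ball z0 r"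
    have "continuous_on (cbox a b) (\<lambda>t. (\<lambda>(z, t). F z t) (z, t))"
      by (rule continuous_on_compose2[OF cont]) (use z bU in \<open>auto intro!: continuous_intros\<close>)
    then show "F z integrable_on cbox a b" by (simp add: integrable_continuous_interval)
  qed
  then show "\<exists>f'. ((\<lambda>z. integral {a..b} (F z)) has_field_derivative f') (at z0)"
    using r0 unfolding holomorphic_on_open[OF open_ball] by simp
qed

lemma several_holomorphic_integral:
  fixes F :: "(nat \<Rightarrow> complex) \<Rightarrow> real \<Rightarrow> complex"
  assumes P: "openin (coord_top N) P" and cont: "continuous_on (P \<times> {a..b}) (\<lambda>(z, t). F z t)"
    and hol: "\<And>t. t \<in> {a..b} \<Longrightarrow> several_holomorphic N P (\<lambda>z. F z t)"
  shows "several_holomorphic N P (\<lambda>z. integral {a..b} (F z))"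
  unfolding several_holomorphic_def
proof (intro conjI P ballI allI impI)
  show "continuous_on P (\<lambda>z. integral {a..b} (F z))"
    using integral_continuous_on_param[of P a b F] cont by simp
  fix z i assume z: "z \<in> P" and i: "i < N"
  have zN: "z \<in> coord_space N" using z P openin_coord_subset by blast
  show "(\<lambda>t. integral {a..b} (F (z(i := t)))) holomorphic_on {t. z(i := t) \<in> P}"
  proof (rule holomorphic_on_integral_param)
    show "open {t. z(i := t) \<in> P}" by (rule open_slice[OF P zN i])
    have "continuous_on ({t. z(i := t) \<in> P} \<times> {a..b}) (\<lambda>q. (\<lambda>(z, t). F z t) (z(i := fst q), snd q))"
      by (rule continuous_on_compose2[OF cont])
         (auto intro!: continuous_on_Pair continuous_on_compose2[OF continuous_on_upd[of UNIV]]
           continuous_on_fst continuous_on_snd continuous_on_id)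
    then show "continuous_on ({t. z(i := t) \<in> P} \<times> {a..b}) (\<lambda>(s, t). F (z(i := s)) t)"
      by (simp add: case_prod_unfold)
    show "(\<lambda>s. F (z(i := s)) t) holomorphic_on {t. z(i := t) \<in> P}" if "t \<in> {a..b}" for t
      by (rule several_holomorphic_slice[OF hol[OF that] zN i])
  qed
qed

lemma several_holomorphic_translate:
  assumes f: "several_holomorphic N D f" and P: "openin (coord_top N) P"
    and PD: "\<And>w. w \<in> P \<Longrightarrow> (\<lambda>j. w j + v j) \<in> D"
  shows "several_holomorphic N P (\<lambda>w. f (\<lambda>j. w j + v j))"
  unfolding several_holomorphic_iff
proof (intro conjI P ballI allI impI)
  show "continuous_on P (\<lambda>w. f (\<lambda>j. w j + v j))"
  proof (rule continuous_on_compose2[OF several_holomorphic_continuous[OF f]])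
    show "continuous_on P (\<lambda>w j. w j + v j)"
      by (intro continuous_on_coordinatewise_then_product continuous_on_add continuous_on_const
          continuous_on_subset[OF continuous_on_product_coordinates]) auto
  qed (use PD in auto)
  fix w i assume w: "w \<in> P" and i: "i < N"
  have eq: "(\<lambda>j. (w(i := t)) j + v j) = (\<lambda>j. w j + v j)(i := t + v i)" for t by auto
  have "(\<lambda>t. f ((\<lambda>j. w j + v j)(i := t))) field_differentiable at (w i + v i)"
    using several_holomorphic_partial[OF f PD[OF w] i] by simp
  then have "((\<lambda>t. f ((\<lambda>j. w j + v j)(i := t))) \<circ> (\<lambda>t. t + v i)) field_differentiable at (w i)"
    by (intro field_differentiable_compose) (auto intro!: derivative_intros)
  then show "(\<lambda>t. f (\<lambda>j. (w(i := t)) j + v j)) field_differentiable at (w i)"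
    unfolding eq by (simp add: o_def)
qed

definition partial :: "nat \<Rightarrow> ((nat \<Rightarrow> complex) \<Rightarrow> complex) \<Rightarrow> (nat \<Rightarrow> complex) \<Rightarrow> complex" where
  "partial i f z = deriv (\<lambda>t. f (z(i := t))) (z i)"

text \<open>
  Near a given point the partial derivative is a Cauchy integral over circles of a fixed radius in
  direction \<open>i\<close>. Its integrand is a translate of \<open>f\<close>, and so the integral is holomorphic in all
  variables at once.
\<close>

lemma several_holomorphic_partial_derivative:
  assumes f: "several_holomorphic N D f" and i: "i < N"
  shows "several_holomorphic N D (partial i f)"
proof (rule several_holomorphic_local[OF several_holomorphic_open[OF f]])
  fix z assume z: "z \<in> D"
  note D = several_holomorphic_open[OF f]
  obtain e where e: "e > 0" "polydisc N z e \<subseteq> D" using polydisc_in_open[OF D z] by blast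
  define r where "r = e / 2"
  define P where "P = polydisc N z r"
  have r0: "r > 0" using e by (simp add: r_def)
  have P: "openin (coord_top N) P" by (simp add: P_def openin_polydisc)
  have PD: "w(i := t) \<in> D" if "w \<in> P" "dist t (w i) \<le> r" for w t
  proof -
    have "dist t (z i) < e"
      using that i dist_triangle[of t "z i" "w i"] by (auto simp: r_def P_def polydisc_def)
    then have "w(i := t) \<in> polydisc N z e"
      using that e i coord_space_upd[of w N i t] by (auto simp: polydisc_def P_def r_def)
    then show ?thesis using e by blast
  qed
  have on_circle: "w(i := w i + r * cis t) \<in> D" if "w \<in> P" for w t
    by (rule PD[OF that]) (use r0 in \<open>simp add: dist_norm norm_mult\<close>)
  define h where "h w = integral {0..2 * pi} (\<lambda>t. f (w(i := w i + r * cis t)) / (r * cis t)) / (2 * of_real pi)" for w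
  have eq: "partial i f w = h w" if w: "w \<in> P" for w
  proof -
    have wN: "w \<in> coord_space N" using w by (simp add: P_def polydisc_def)
    show ?thesis unfolding partial_def h_def
    proof (rule Cauchy_deriv_mean_value[OF _ r0])
      show "(\<lambda>t. f (w(i := t))) holomorphic_on cball (w i) r"
        by (rule holomorphic_on_subset[OF several_holomorphic_slice[OF f wN i]])
           (use PD[OF w] in \<open>auto simp: dist_commute\<close>)
    qed
  qed
  have "several_holomorphic N P h"
    unfolding h_def
  proof (intro several_holomorphic_divide several_holomorphic_const P several_holomorphic_integral)
    have "continuous_on (P \<times> {0..2 * pi}) (\<lambda>q. f ((fst q)(i := fst q i + r * cis (snd q))))"
    proof (rule continuous_on_compose2[OF several_holomorphic_continuous[OF f]])
      show "continuous_on (P \<times> {0..2 * pi}) (\<lambda>q. (fst q)(i := fst q i + r * cis (snd q)))"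
      proof (rule continuous_on_coordinatewise_then_product)
        fix j
        have "continuous_on (P \<times> {0..2 * pi}) (\<lambda>q. fst q j)" for j
          by (rule continuous_on_product_then_coordinatewise) (intro continuous_intros)
        then show "continuous_on (P \<times> {0..2 * pi}) (\<lambda>q. ((fst q)(i := fst q i + r * cis (snd q))) j)"
          by (cases "j = i") (auto intro!: continuous_intros)
      qed
    qed (use on_circle in auto)
    then have "continuous_on (P \<times> {0..2 * pi})
      (\<lambda>q. f ((fst q)(i := fst q i + r * cis (snd q))) / (r * cis (snd q)))"
      using r0 by (intro continuous_on_divide continuous_intros) auto
    then show "continuous_on (P \<times> {0..2 * pi}) (\<lambda>(w, t). f (w(i := w i + r * cis t)) / (r * cis t))"
      by (simp add: case_prod_unfold)
    fix t
    have e: "w(i := w i + r * cis t) = (\<lambda>j. w j + (if j = i then r * cis t else 0))" for w :: "nat \<Rightarrow> complex"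
      by auto
    show "several_holomorphic N P (\<lambda>w. f (w(i := w i + r * cis t)))"
      unfolding e by (rule several_holomorphic_translate[OF f P]) (use on_circle in \<open>simp add: e[symmetric]\<close>)
    show "complex_of_real r * cis t \<noteq> 0" using r0 by simp
  qed auto
  then show "\<exists>W h. openin (coord_top N) W \<and> z \<in> W \<and> several_holomorphic N W h \<and>
      (\<forall>w\<in>D \<inter> W. partial i f w = h w)"
    using P eq centre_in_polydisc[of z N r] r0 z openin_coord_subset[OF D] by (auto simp: P_def)
qed

section \<open>The chain rule\<close>

lemma openin_coord_preimage:
  fixes g :: "(nat \<Rightarrow> complex) \<Rightarrow> 'b::topological_space"
  assumes "openin (coord_top N) D" "continuous_on D g" "open B"
  shows "openin (coord_top N) {w \<in> D. g w \<in> B}"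
proof -
  have "openin (top_of_set D) (D \<inter> g -` B)"
    by (rule continuous_openin_preimage_gen[OF assms(2,3)])
  then have "openin (coord_top N) (D \<inter> g -` B)"
    using assms(1) unfolding coord_top_def by (rule openin_trans)
  also have "D \<inter> g -` B = {w \<in> D. g w \<in> B}" by auto
  finally show ?thesis .
qed

text \<open>
  Continuity of the partial derivatives makes the linear approximation in one coordinate uniform in
  the base point.
\<close>

lemma partial_increment_bound:
  assumes f: "several_holomorphic N D f" and z: "z \<in> D" and i: "i < N" and e: "0 < e"
  obtains r where "0 < r" "polydisc N z r \<subseteq> D"
    "\<And>w a b. w \<in> polydisc N z r \<Longrightarrow> a \<in> ball (z i) r \<Longrightarrow> b \<in> ball (z i) r \<Longrightarrow>
       norm (f (w(i := b)) - f (w(i := a)) - partial i f z * (b - a)) \<le> e * norm (b - a)"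
proof -
  note D = several_holomorphic_open[OF f]
  have "openin (coord_top N) {w \<in> D. partial i f w \<in> ball (partial i f z) e}"
    by (rule openin_coord_preimage[OF D several_holomorphic_continuous])
       (auto intro: several_holomorphic_partial_derivative[OF f i])
  then obtain r where r: "0 < r" "polydisc N z r \<subseteq> {w \<in> D. partial i f w \<in> ball (partial i f z) e}"
    by (rule polydisc_in_open[of N _ z]) (use z e in auto)
  show thesis
  proof (rule that[OF r(1)])
    show "polydisc N z r \<subseteq> D" using r(2) by auto
    fix w a b assume w: "w \<in> polydisc N z r" and ab: "a \<in> ball (z i) r" "b \<in> ball (z i) r"
    have wt: "w(i := t) \<in> polydisc N z r" if "t \<in> ball (z i) r" for t
      using that w i coord_space_upd[of w N i t] by (auto simp: polydisc_def dist_commute)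
    have "norm ((f (w(i := b)) - partial i f z * b) - (f (w(i := a)) - partial i f z * a))
        \<le> e * norm (b - a)"
    proof (rule field_differentiable_bound[OF convex_ball _ _ ab(2) ab(1)])
      fix t assume t: "t \<in> ball (z i) r"
      have "w(i := t) \<in> D" using wt[OF t] r(2) by auto
      from several_holomorphic_partial[OF f this i]
      have "((\<lambda>s. f (w(i := s))) has_field_derivative partial i f (w(i := t))) (at t)"
        by (simp add: partial_def field_differentiable_derivI)
      then show "((\<lambda>t. f (w(i := t)) - partial i f z * t) has_field_derivative
          (partial i f (w(i := t)) - partial i f z)) (at t within ball (z i) r)"
        by (rule has_field_derivative_at_within[OF DERIV_diff[OF _ DERIV_cmult_Id]])
      show "norm (partial i f (w(i := t)) - partial i f z) \<le> e"
        using wt[OF t] r(2) by (auto simp: dist_norm norm_minus_commute)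
    qed
    then show "norm (f (w(i := b)) - f (w(i := a)) - partial i f z * (b - a)) \<le> e * norm (b - a)"
      by (simp add: algebra_simps)
  qed
qed

text \<open>
  Total differentiability: an increment is a telescoping sum of increments in single coordinates.
\<close>

lemma total_increment_bound:
  assumes f: "several_holomorphic N D f" and z: "z \<in> D" and e: "0 < e"
  obtains r where "0 < r" "polydisc N z r \<subseteq> D"
    "\<And>w. w \<in> polydisc N z r \<Longrightarrow>
       norm (f w - f z - (\<Sum>i<N. partial i f z * (w i - z i))) \<le> e * (\<Sum>i<N. norm (w i - z i))"
proof -
  note D = several_holomorphic_open[OF f]
  have zN: "z \<in> coord_space N" using D z openin_coord_subset by blast
  obtain r0 where r0: "0 < r0" "polydisc N z r0 \<subseteq> D" using polydisc_in_open[OF D z] .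
  have "\<forall>i\<in>{..<N}. \<exists>r>0. \<forall>w a b. w \<in> polydisc N z r \<longrightarrow> a \<in> ball (z i) r \<longrightarrow> b \<in> ball (z i) r \<longrightarrow>
       norm (f (w(i := b)) - f (w(i := a)) - partial i f z * (b - a)) \<le> e * norm (b - a)"
  proof
    fix i assume "i \<in> {..<N}"
    then have "i < N" by simp
    from partial_increment_bound[OF f z this e]
    show "\<exists>r>0. \<forall>w a b. w \<in> polydisc N z r \<longrightarrow> a \<in> ball (z i) r \<longrightarrow> b \<in> ball (z i) r \<longrightarrow>
       norm (f (w(i := b)) - f (w(i := a)) - partial i f z * (b - a)) \<le> e * norm (b - a)"
      by metis
  qed
  then obtain \<rho> where \<rho>: "\<And>i. i < N \<Longrightarrow> \<rho> i > 0"
    "\<And>i w a b. i < N \<Longrightarrow> w \<in> polydisc N z (\<rho> i) \<Longrightarrow> a \<in> ball (z i) (\<rho> i) \<Longrightarrow> b \<in> ball (z i) (\<rho> i) \<Longrightarrow>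
       norm (f (w(i := b)) - f (w(i := a)) - partial i f z * (b - a)) \<le> e * norm (b - a)"
    by (metis lessThan_iff)
  define r where "r = Min (insert r0 (\<rho> ` {..<N}))"
  have r: "r > 0" "r \<le> r0" "\<And>i. i < N \<Longrightarrow> r \<le> \<rho> i"
    using r0 \<rho>(1) by (auto simp: r_def)
  show thesis
  proof (rule that[OF r(1)])
    show "polydisc N z r \<subseteq> D" using polydisc_mono[OF r(2)] r0 by blast
    fix w assume w: "w \<in> polydisc N z r"
    \<comment> \<open>\<open>P k\<close> runs from \<open>z\<close> to \<open>w\<close> through points differing in one coordinate.\<close>
    define P where "P k = (\<lambda>j. if j < k then w j else z j)" for k :: nat
    have PN: "P k \<in> polydisc N z r" for k
      using w zN r(1) by (auto simp: P_def polydisc_def coord_space_def)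
    have bound: "norm (f (P k) - f z - (\<Sum>i<k. partial i f z * (w i - z i)))
        \<le> e * (\<Sum>i<k. norm (w i - z i))" if "k \<le> N" for k using that
    proof (induction k)
      case 0 then show ?case by (simp add: P_def)
    next
      case (Suc k)
      have k: "k < N" using Suc by simp
      have P1: "P (Suc k) = (P k)(k := w k)" and P2: "P k = (P k)(k := z k)"
        by (auto simp: P_def)
      have "norm (f ((P k)(k := w k)) - f ((P k)(k := z k)) - partial k f z * (w k - z k))
          \<le> e * norm (w k - z k)"
      proof (rule \<rho>(2)[OF k])
        show "P k \<in> polydisc N z (\<rho> k)" using PN polydisc_mono[OF r(3)[OF k]] by blast
        show "z k \<in> ball (z k) (\<rho> k)" using \<rho>(1)[OF k] by simp
        have "dist (w k) (z k) < r" using w k by (auto simp: polydisc_def)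
        then show "w k \<in> ball (z k) (\<rho> k)" using r(3)[OF k] by (simp add: dist_commute)
      qed
      then have "norm (f (P (Suc k)) - f (P k) - partial k f z * (w k - z k)) \<le> e * norm (w k - z k)"
        using P1 P2 by simp
      moreover have "norm (f (P k) - f z - (\<Sum>i<k. partial i f z * (w i - z i))) \<le> e * (\<Sum>i<k. norm (w i - z i))"
        using Suc by simp
      moreover have "f (P (Suc k)) - f z - (\<Sum>i<Suc k. partial i f z * (w i - z i)) =
        (f (P (Suc k)) - f (P k) - partial k f z * (w k - z k)) +
        (f (P k) - f z - (\<Sum>i<k. partial i f z * (w i - z i)))" by simp
      ultimately show ?case
        using norm_triangle_mono[of "f (P (Suc k)) - f (P k) - partial k f z * (w k - z k)"
            "e * norm (w k - z k)" "f (P k) - f z - (\<Sum>i<k. partial i f z * (w i - z i))"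
            "e * (\<Sum>i<k. norm (w i - z i))"]
        by (simp add: algebra_simps)
    qed
    have "P N = w"
      using w zN by (auto simp: P_def polydisc_def coord_space_def)
    then show "norm (f w - f z - (\<Sum>i<N. partial i f z * (w i - z i))) \<le> e * (\<Sum>i<N. norm (w i - z i))"
      using bound[of N] by simp
  qed
qed

text \<open>
  The case of a curve. It covers compositions with maps of several variables, since partial
  derivatives are derivatives along coordinate lines, and it shows that restrictions to arbitrary
  complex lines are holomorphic.
\<close>

lemma several_holomorphic_chain_rule:
  assumes f: "several_holomorphic N D f" and z: "\<gamma> t0 \<in> D"
    and \<gamma>: "\<And>i. i < N \<Longrightarrow> ((\<lambda>t. \<gamma> t i) has_field_derivative \<gamma>' i) (at t0)"
    and ev: "eventually (\<lambda>t. \<gamma> t \<in> coord_space N) (at t0)"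
  shows "((\<lambda>t. f (\<gamma> t)) has_field_derivative (\<Sum>i<N. partial i f (\<gamma> t0) * \<gamma>' i)) (at t0)"
proof -
  define S where "S i y = (\<gamma> y i - \<gamma> t0 i) / (y - t0)" for i y
  have S: "(S i \<longlongrightarrow> \<gamma>' i) (at t0)" if "i < N" for i
    using \<gamma>[OF that] unfolding has_field_derivative_iff S_def .
  define L where "L y = (\<Sum>i<N. partial i f (\<gamma> t0) * S i y)" for y
  define E where "E y = (f (\<gamma> y) - f (\<gamma> t0)) / (y - t0) - L y" for y
  have L: "(L \<longlongrightarrow> (\<Sum>i<N. partial i f (\<gamma> t0) * \<gamma>' i)) (at t0)"
    unfolding L_def by (intro tendsto_intros S) auto
  have "(E \<longlongrightarrow> 0) (at t0)"
  proof (rule tendstoI)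
    fix e :: real assume e: "e > 0"
    \<comment> \<open>The difference quotients of \<open>\<gamma>\<close> are eventually bounded by the summands; the last \<open>1\<close> makes \<open>B\<close> positive.\<close>
    define B where "B = (\<Sum>i<N. norm (\<gamma>' i) + 1) + 1"
    have B: "B > 0" by (auto simp: B_def intro!: add_nonneg_pos sum_nonneg)
    obtain r where r: "0 < r" "\<And>w. w \<in> polydisc N (\<gamma> t0) r \<Longrightarrow>
       norm (f w - f (\<gamma> t0) - (\<Sum>i<N. partial i f (\<gamma> t0) * (w i - \<gamma> t0 i)))
         \<le> e / B * (\<Sum>i<N. norm (w i - \<gamma> t0 i))"
      by (rule total_increment_bound[OF f z divide_pos_pos[OF e B]]) iprover
    have ev1: "\<forall>\<^sub>F y in at t0. \<forall>i\<in>{..<N}. norm (S i y) < norm (\<gamma>' i) + 1"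
    proof (rule eventually_ball_finite, simp, rule ballI)
      fix i assume "i \<in> {..<N}"
      then have "((\<lambda>y. norm (S i y)) \<longlongrightarrow> norm (\<gamma>' i)) (at t0)" by (intro tendsto_norm S) auto
      then show "\<forall>\<^sub>F y in at t0. norm (S i y) < norm (\<gamma>' i) + 1"
        by (rule order_tendstoD) simp
    qed
    have ev2: "\<forall>\<^sub>F y in at t0. \<forall>i\<in>{..<N}. dist (\<gamma> y i) (\<gamma> t0 i) < r"
    proof (rule eventually_ball_finite, simp, rule ballI)
      fix i assume "i \<in> {..<N}"
      then have "isCont (\<lambda>t. \<gamma> t i) t0" using \<gamma> DERIV_isCont by blast
      then show "\<forall>\<^sub>F y in at t0. dist (\<gamma> y i) (\<gamma> t0 i) < r"
        unfolding isCont_def using r(1) tendstoD by blast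
    qed
    have ev3: "\<forall>\<^sub>F y in at t0. y \<noteq> t0" by (simp add: eventually_neq_at_within)
    show "\<forall>\<^sub>F y in at t0. dist (E y) 0 < e"
      using ev ev1 ev2 ev3
    proof eventually_elim
      case (elim y)
      have "\<gamma> y \<in> polydisc N (\<gamma> t0) r" using elim by (auto simp: polydisc_def)
      from r(2)[OF this] have est: "norm (f (\<gamma> y) - f (\<gamma> t0) - (\<Sum>i<N. partial i f (\<gamma> t0) * (\<gamma> y i - \<gamma> t0 i)))
         \<le> e / B * (\<Sum>i<N. norm (\<gamma> y i - \<gamma> t0 i))" .
      have "E y = (f (\<gamma> y) - f (\<gamma> t0) - (\<Sum>i<N. partial i f (\<gamma> t0) * (\<gamma> y i - \<gamma> t0 i))) / (y - t0)"
        unfolding E_def L_def S_def by (simp add: diff_divide_distrib[of _ "sum _ _"] sum_divide_distrib)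
      then have "norm (E y) \<le> e / B * (\<Sum>i<N. norm (\<gamma> y i - \<gamma> t0 i)) / norm (y - t0)"
        by (simp only: norm_divide divide_right_mono[OF est norm_ge_zero])
      also have "\<dots> = e / B * (\<Sum>i<N. norm (S i y))"
        by (simp add: S_def norm_divide sum_divide_distrib[symmetric])
      also have "\<dots> \<le> e / B * (\<Sum>i<N. norm (\<gamma>' i) + 1)"
        using e B elim(2) by (intro mult_left_mono sum_mono) (auto simp: less_imp_le)
      also have "\<dots> < e / B * B" using e B by (intro mult_strict_left_mono) (auto simp: B_def)
      also have "\<dots> = e" using B by simp
      finally show ?case by simp
    qed
  qed
  then have "((\<lambda>y. E y + L y) \<longlongrightarrow> 0 + (\<Sum>i<N. partial i f (\<gamma> t0) * \<gamma>' i)) (at t0)"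
    using L by (rule tendsto_add)
  then show ?thesis unfolding has_field_derivative_iff E_def by simp
qed

lemma
  assumes f: "several_holomorphic N D f" and E: "openin (coord_top n) E"
    and GD: "\<And>w. w \<in> E \<Longrightarrow> G w \<in> D"
    and G: "\<And>i. i < N \<Longrightarrow> several_holomorphic n E (\<lambda>w. G w i)"
  shows several_holomorphic_compose: "several_holomorphic n E (\<lambda>w. f (G w))"
    and partial_compose: "w \<in> E \<Longrightarrow> j < n \<Longrightarrow>
      partial j (\<lambda>w. f (G w)) w = (\<Sum>i<N. partial i f (G w) * partial j (\<lambda>w. G w i) w)"
proof -
  note D = several_holomorphic_open[OF f]
  have der: "((\<lambda>t. f (G (w(j := t)))) has_field_derivative
      (\<Sum>i<N. partial i f (G w) * partial j (\<lambda>w. G w i) w)) (at (w j))"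
    if w: "w \<in> E" and j: "j < n" for w j
  proof -
    have "((\<lambda>t. f (G (w(j := t)))) has_field_derivative
      (\<Sum>i<N. partial i f (G (w(j := w j))) * partial j (\<lambda>w. G w i) w)) (at (w j))"
    proof (rule several_holomorphic_chain_rule[OF f])
      show "G (w(j := w j)) \<in> D" using GD[OF w] by simp
      show "((\<lambda>t. G (w(j := t)) i) has_field_derivative partial j (\<lambda>w. G w i) w) (at (w j))"
        if "i < N" for i
        unfolding partial_def
        using several_holomorphic_partial[OF G[OF that] w j] field_differentiable_derivI by blast
      have wn: "w \<in> coord_space n" using w E openin_coord_subset by blast
      have "\<forall>\<^sub>F t in nhds (w j). t \<in> {t. w(j := t) \<in> E}"
        by (rule eventually_nhds_in_open[OF open_slice[OF E wn j]]) (simp add: w)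
      then have "\<forall>\<^sub>F t in at (w j). t \<in> {t. w(j := t) \<in> E}"
        by (simp add: eventually_nhds_conv_at)
      then show "\<forall>\<^sub>F t in at (w j). G (w(j := t)) \<in> coord_space N"
        by eventually_elim (use GD openin_coord_subset[OF D] in auto)
    qed
    then show ?thesis by simp
  qed
  show "w \<in> E \<Longrightarrow> j < n \<Longrightarrow>
      partial j (\<lambda>w. f (G w)) w = (\<Sum>i<N. partial i f (G w) * partial j (\<lambda>w. G w i) w)"
    unfolding partial_def[of j "\<lambda>w. f (G w)"] using der DERIV_imp_deriv by blast
  show "several_holomorphic n E (\<lambda>w. f (G w))"
    unfolding several_holomorphic_iff
  proof (intro conjI E ballI allI impI)
    show "continuous_on E (\<lambda>w. f (G w))"
    proof (rule continuous_on_compose2[OF several_holomorphic_continuous[OF f]])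
      show "continuous_on E G"
      proof (rule continuous_on_coordinatewise_then_product)
        fix i show "continuous_on E (\<lambda>w. G w i)"
        proof (cases "i < N")
          case True
          then show ?thesis using G several_holomorphic_continuous by blast
        next
          case False
          then have "G w i = 0" if "w \<in> E" for w
            using GD[OF that] openin_coord_subset[OF D] by (auto simp: coord_space_def)
          then show ?thesis by (simp cong: continuous_on_cong)
        qed
      qed
    qed (use GD in auto)
    show "(\<lambda>t. f (G (w(j := t)))) field_differentiable at (w j)" if "w \<in> E" "j < n" for w j
      using der[OF that] field_differentiable_def by blast
  qed
qed

lemma holomorphic_on_line:
  assumes f: "several_holomorphic N D f" and T: "open T"
    and TD: "\<And>t. t \<in> T \<Longrightarrow> (\<lambda>j. z j + t * v j) \<in> D"
  shows "(\<lambda>t. f (\<lambda>j. z j + t * v j)) holomorphic_on T"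
  unfolding holomorphic_on_open[OF T]
proof
  fix t assume t: "t \<in> T"
  have "\<forall>\<^sub>F s in nhds t. s \<in> T" using T t by (rule eventually_nhds_in_open)
  then have "\<forall>\<^sub>F s in at t. s \<in> T" by (simp add: eventually_nhds_conv_at)
  then have ev: "\<forall>\<^sub>F s in at t. (\<lambda>j. z j + s * v j) \<in> coord_space N"
    by eventually_elim (use TD openin_coord_subset[OF several_holomorphic_open[OF f]] in auto)
  have "((\<lambda>t. f (\<lambda>j. z j + t * v j)) has_field_derivative
      (\<Sum>i<N. partial i f (\<lambda>j. z j + t * v j) * v i)) (at t)"
    by (rule several_holomorphic_chain_rule[OF f TD[OF t] _ ev]) (auto intro!: derivative_eq_intros)
  then show "\<exists>f'. ((\<lambda>t. f (\<lambda>j. z j + t * v j)) has_field_derivative f') (at t)" by blast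
qed

section \<open>Quotients that are integral over the holomorphic functions\<close>

lemma monic_root_bound:
  fixes y :: complex
  assumes eq: "y ^ m + (\<Sum>i<m. c i * y ^ i) = 0"
  shows "norm y \<le> 1 + (\<Sum>i<m. norm (c i))"
proof (rule ccontr)
  assume "\<not> ?thesis"
  moreover have s: "(\<Sum>i<m. norm (c i)) \<ge> 0" by (simp add: sum_nonneg)
  ultimately have y: "norm y > 1 + (\<Sum>i<m. norm (c i))" "norm y > 1" by linarith+
  have "m > 0" using eq by (cases m) auto
  have "y ^ m = - (\<Sum>i<m. c i * y ^ i)" using eq by (simp add: eq_neg_iff_add_eq_0)
  then have "norm y ^ m = norm (\<Sum>i<m. c i * y ^ i)" by (metis norm_minus_cancel norm_power)
  also have "\<dots> \<le> (\<Sum>i<m. norm (c i * y ^ i))" by (rule norm_sum)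
  also have "\<dots> \<le> (\<Sum>i<m. norm (c i) * norm y ^ (m - 1))"
    using y by (intro sum_mono) (auto simp: norm_mult norm_power intro!: mult_left_mono power_increasing)
  also have "\<dots> = (\<Sum>i<m. norm (c i)) * norm y ^ (m - 1)" by (simp add: sum_distrib_right)
  also have "\<dots> < norm y * norm y ^ (m - 1)"
    using y by (intro mult_strict_right_mono zero_less_power) linarith+
  also have "\<dots> = norm y ^ m" using \<open>m > 0\<close> by (metis power_minus_mult mult.commute)
  finally show False by simp
qed

lemma integral_quotient_bound:
  fixes a b :: complex
  assumes eq: "a ^ m + (\<Sum>i<m. c i * a ^ i * b ^ (m - i)) = 0"
  shows "norm (a / b) \<le> 1 + (\<Sum>i<m. norm (c i))"
proof (cases "b = 0")
  case True
  then show ?thesis by (simp add: sum_nonneg)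
next
  case False
  have "c i * (a / b) ^ i * b ^ m = c i * a ^ i * b ^ (m - i)" if "i < m" for i
    using that False by (simp add: power_divide power_diff field_simps)
  then have "((a / b) ^ m + (\<Sum>i<m. c i * (a / b) ^ i)) * b ^ m =
      a ^ m + (\<Sum>i<m. c i * a ^ i * b ^ (m - i))"
    using False by (simp add: distrib_right sum_distrib_right power_divide)
  then have "(a / b) ^ m + (\<Sum>i<m. c i * (a / b) ^ i) = 0" using eq False by simp
  then show ?thesis by (rule monic_root_bound)
qed

lemma integral_numerator_vanishes:
  fixes a b :: "'a :: idom"
  assumes "a ^ m + (\<Sum>i<m. c i * a ^ i * b ^ (m - i)) = 0" "b = 0"
  shows "a = 0"
proof -
  have "(\<Sum>i<m. c i * a ^ i * b ^ (m - i)) = 0"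
    by (intro sum.neutral) (simp add: assms(2) power_0_left)
  then show ?thesis using assms(1) by simp
qed

text \<open>
  A quotient \<open>\<alpha>/\<beta>\<close> that satisfies a monic equation is locally bounded, so its singularities are
  removable, and the mean value over a circle without zeros of \<open>\<beta>\<close> is the value of the extension at
  the centre. The point of this formula is that the mean value can be formed for a whole family of
  functions at once.
\<close>

lemma holomorphic_integral_quotient:
  fixes \<alpha> \<beta> :: "complex \<Rightarrow> complex"
  assumes \<alpha>: "\<alpha> holomorphic_on ball 0 R" and \<beta>: "\<beta> holomorphic_on ball 0 R"
    and \<rho>: "0 < \<rho>" "\<rho> < R" and nz: "\<And>t. norm t = \<rho> \<Longrightarrow> \<beta> t \<noteq> 0"
    and c: "\<And>i. i < m \<Longrightarrow> continuous_on (ball 0 R) (c i)"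
    and eq: "\<And>t. t \<in> ball 0 R \<Longrightarrow> \<alpha> t ^ m + (\<Sum>i<m. c i t * \<alpha> t ^ i * \<beta> t ^ (m - i)) = 0"
  shows "\<alpha> 0 = \<beta> 0 * (integral {0..2 * pi} (\<lambda>t. \<alpha> (\<rho> * cis t) / \<beta> (\<rho> * cis t)) / (2 * of_real pi))"
proof -
  have sub: "cball 0 \<rho> \<subseteq> ball (0::complex) R" using \<rho> by auto
  define X where "X = {t \<in> cball 0 \<rho>. \<beta> t = 0}"
  have finX: "finite X"
  proof (cases "\<beta> constant_on ball 0 R")
    case True
    have "complex_of_real \<rho> \<in> ball 0 R" "\<beta> (of_real \<rho>) \<noteq> 0" using \<rho> nz by auto
    then have "\<beta> t \<noteq> 0" if "t \<in> ball 0 R" for t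
      using True that by (auto simp: constant_on_def)
    then have "X = {}" using sub by (auto simp: X_def)
    then show ?thesis by simp
  next
    case False
    then show ?thesis unfolding X_def
      by (intro holomorphic_compact_finite_zeros[OF \<beta>]) (use sub in auto)
  qed
  have Xint: "X \<subseteq> interior (cball 0 \<rho>)" using nz by (force simp: X_def)
  have "\<exists>g. g holomorphic_on cball 0 \<rho> \<and> (\<forall>t\<in>cball 0 \<rho> - X. g t = \<alpha> t / \<beta> t)"
  proof (rule removable_singularities[OF finX Xint])
    show "(\<lambda>t. \<alpha> t / \<beta> t) holomorphic_on cball 0 \<rho> - X"
      by (intro holomorphic_on_divide holomorphic_on_subset[OF \<alpha>] holomorphic_on_subset[OF \<beta>])
         (use sub in \<open>auto simp: X_def\<close>)
    fix z assume "z \<in> X"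
    then have z: "z \<in> ball 0 R" using sub by (auto simp: X_def)
    define C where "C t = 1 + (\<Sum>i<m. norm (c i t))" for t
    have "continuous_on (ball 0 R) C"
      unfolding C_def by (intro continuous_intros c) auto
    then have "isCont C z" using z continuous_on_eq_continuous_at by blast
    then have "\<forall>\<^sub>F t in at z. C t < C z + 1"
      unfolding isCont_def by (rule order_tendstoD) simp
    moreover have "\<forall>\<^sub>F t in at z. t \<in> ball 0 R"
      using z by (intro eventually_at_in_open') auto
    ultimately have "\<forall>\<^sub>F t in at z. norm (\<alpha> t / \<beta> t) \<le> (C z + 1) * norm (1 :: complex)"
    proof eventually_elim
      case (elim t)
      then show ?case using integral_quotient_bound[OF eq[OF elim(2)]] by (simp add: C_def)
    qed
    then show "(\<lambda>t. \<alpha> t / \<beta> t) \<in> O[at z](\<lambda>_. 1)" by (rule landau_o.bigI[rotated]) (auto simp: C_def intro!: add_pos_nonneg sum_nonneg)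
  qed
  then obtain g where g: "g holomorphic_on cball 0 \<rho>" "\<And>t. t \<in> cball 0 \<rho> - X \<Longrightarrow> g t = \<alpha> t / \<beta> t"
    by blast
  have "g 0 = integral {0..2 * pi} (\<lambda>t. g (0 + \<rho> * cis t)) / (2 * of_real pi)"
    by (rule Cauchy_mean_value[OF g(1) \<rho>(1)])
  also have "integral {0..2 * pi} (\<lambda>t. g (0 + \<rho> * cis t)) =
      integral {0..2 * pi} (\<lambda>t. \<alpha> (\<rho> * cis t) / \<beta> (\<rho> * cis t))"
    using \<rho> nz by (intro integral_cong) (simp add: g(2) X_def norm_mult)
  finally have g0: "g 0 = integral {0..2 * pi} (\<lambda>t. \<alpha> (\<rho> * cis t) / \<beta> (\<rho> * cis t)) / (2 * of_real pi)" .
  have "\<alpha> 0 = \<beta> 0 * g 0"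
  proof (cases "\<beta> 0 = 0")
    case True
    then show ?thesis using integral_numerator_vanishes[OF eq[of 0]] \<rho> by simp
  next
    case False
    then show ?thesis using g(2)[of 0] \<rho> by (simp add: X_def)
  qed
  then show ?thesis by (simp only: g0)
qed

lemma continuous_on_line: "continuous_on S (\<lambda>t j. z j + t * v j)"
  for z v :: "nat \<Rightarrow> complex"
  by (rule continuous_on_coordinatewise_then_product) (intro continuous_intros)

text \<open>
  Riemann's extension theorem for integral quotients. Unless \<open>B\<close> vanishes identically near \<open>z0\<close>, there is
  a line through \<open>z0\<close> and a circle on it that avoids the zeros of \<open>B\<close>. For all nearby \<open>z\<close> the value at
  \<open>z\<close> of the extension is the mean value of \<open>A/B\<close> over the translate of this circle to \<open>z\<close>, which
  depends holomorphically on \<open>z\<close>.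

  The last clause normalises \<open>h\<close> where the equation \<open>A = B h\<close> says nothing, namely in the interior
  of the zero set of \<open>B\<close>. With it \<open>h\<close> is unique, so that local solutions can be glued.
\<close>

lemma local_integral_quotient:
  assumes A: "several_holomorphic N D A" and B: "several_holomorphic N D B"
    and c: "\<And>i. i < m \<Longrightarrow> several_holomorphic N D (c i)"
    and eq: "\<And>z. z \<in> D \<Longrightarrow> A z ^ m + (\<Sum>i<m. c i z * A z ^ i * B z ^ (m - i)) = 0"
    and z0: "z0 \<in> D"
  shows "\<exists>W h. openin (coord_top N) W \<and> z0 \<in> W \<and> W \<subseteq> D \<and> several_holomorphic N W h \<and>
    (\<forall>w\<in>W. A w = B w * h w) \<and>
    (\<forall>w\<in>W. \<forall>V. openin (coord_top N) V \<and> w \<in> V \<and> (\<forall>y\<in>V \<inter> D. B y = 0) \<longrightarrow> h w = 0)"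
proof (cases "\<exists>V. openin (coord_top N) V \<and> z0 \<in> V \<and> (\<forall>y\<in>V \<inter> D. B y = 0)")
  case True
  then obtain V where V: "openin (coord_top N) V" "z0 \<in> V" "\<And>y. y \<in> V \<inter> D \<Longrightarrow> B y = 0" by blast
  have VD: "openin (coord_top N) (V \<inter> D)"
    using V(1) several_holomorphic_open[OF A] by (rule openin_Int)
  have "A w = B w * 0" if "w \<in> V \<inter> D" for w
    using integral_numerator_vanishes[OF eq[of w] V(3)[OF that]] that by simp
  then show ?thesis
    using VD V(2) z0 several_holomorphic_const[OF VD, of 0]
    by (intro exI[of _ "V \<inter> D"] exI[of _ "\<lambda>_. 0"]) auto
next
  case False
  note D = several_holomorphic_open[OF A]
  have z0N: "z0 \<in> coord_space N" using D z0 openin_coord_subset by blast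
  obtain r where r: "0 < r" "polydisc N z0 r \<subseteq> D" using polydisc_in_open[OF D z0] .
  \<comment> \<open>With \<open>w1\<close> in the polydisc of radius \<open>r / 2\<close>, the line through \<open>z0\<close> and \<open>w1\<close> stays in \<open>D\<close> on a disc of radius 2, in particular around the parameter 1 of \<open>w1\<close>.\<close>
  have "z0 \<in> polydisc N z0 (r / 2)" using z0N r by (simp add: centre_in_polydisc)
  then obtain w1 where w1: "w1 \<in> polydisc N z0 (r / 2)" "B w1 \<noteq> 0"
    using False openin_polydisc[of N z0 "r / 2"] by blast
  define v where "v = (\<lambda>j. w1 j - z0 j)"
  define line where "line z t = (\<lambda>j. z j + t * v j)" for z :: "nat \<Rightarrow> complex" and t :: complex
  have vN: "v j = 0" if "j \<ge> N" for j
    using w1(1) z0N that by (auto simp: v_def polydisc_def coord_space_def)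
  have v: "norm (v j) < r / 2" if "j < N" for j
    using w1(1) that by (auto simp: v_def polydisc_def dist_norm)
  have tv: "norm (t * v j) < r / 2" if "j < N" "norm t \<le> 1" for j t
  proof -
    have "norm t * norm (v j) \<le> 1 * norm (v j)" using that(2) by (rule mult_right_mono) simp
    then show ?thesis using v[OF that(1)] by (simp add: norm_mult)
  qed
  have line_space: "line z t \<in> coord_space N" if "z \<in> coord_space N" for z t
    using that vN by (auto simp: line_def coord_space_def)
  have line_D: "line z t \<in> D" if z: "z \<in> polydisc N z0 (r / 2)" and t: "norm t \<le> 1" for z t
  proof -
    have "dist (line z t j) (z0 j) < r" if j: "j < N" for j
    proof -
      have "dist (line z t j) (z0 j) \<le> dist (z j) (z0 j) + norm (t * v j)"
        unfolding line_def dist_norm using norm_triangle_ineq[of "z j - z0 j" "t * v j"]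
        by (simp add: algebra_simps)
      then show ?thesis using tv[OF j t] z j by (auto simp: polydisc_def)
    qed
    then have "line z t \<in> polydisc N z0 r"
      using z line_space by (auto simp: polydisc_def)
    then show ?thesis using r by blast
  qed
  \<comment> \<open>A radius for which \<open>B\<close> has no zero on the circle around \<open>z0\<close> in the direction of \<open>w1\<close>.\<close>
  have line0_D: "line z0 t \<in> D" if t: "t \<in> ball 0 2" for t
  proof -
    have "norm (t * v j) < r" if j: "j < N" for j
    proof -
      have "norm t * norm (v j) \<le> 2 * norm (v j)" using t by (intro mult_right_mono) auto
      then show ?thesis using v[OF j] by (simp add: norm_mult)
    qed
    then have "line z0 t \<in> polydisc N z0 r"
      using line_space[OF z0N] by (auto simp: polydisc_def line_def dist_norm)
    then show ?thesis using r by blast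
  qed
  have \<beta>0: "(\<lambda>t. B (line z0 t)) holomorphic_on ball 0 2"
    unfolding line_def by (rule holomorphic_on_line[OF B]) (use line0_D in \<open>auto simp: line_def\<close>)
  have B1: "B (line z0 1) \<noteq> 0" using w1 by (simp add: line_def v_def)
  have fin: "finite {t \<in> cball 0 1. B (line z0 t) = 0}"
  proof (cases "(\<lambda>t. B (line z0 t)) constant_on ball 0 2")
    case True
    have one: "(1::complex) \<in> ball 0 2" by simp
    have "B (line z0 t) \<noteq> 0" if "t \<in> cball 0 1" for t
    proof -
      have t: "t \<in> ball 0 2" using that by auto
      then show ?thesis using True one B1 unfolding constant_on_def by metis
    qed
    then have "{t \<in> cball 0 1. B (line z0 t) = 0} = {}" by blast
    then show ?thesis by (simp only: finite.emptyI)
  next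
    case False
    then show ?thesis by (intro holomorphic_compact_finite_zeros[OF \<beta>0]) auto
  qed
  have "infinite ({0<..<1::real} - norm ` {t \<in> cball 0 1. B (line z0 t) = 0})"
    using fin infinite_Ioo[of 0 "1::real"] by (intro Diff_infinite_finite) auto
  then obtain \<rho> where "\<rho> \<in> {0<..<1::real} - norm ` {t \<in> cball 0 1. B (line z0 t) = 0}"
    by (metis equals0I finite.emptyI)
  then have \<rho>: "0 < \<rho>" "\<rho> < 1" and nz0: "\<And>t. norm t = \<rho> \<Longrightarrow> B (line z0 t) \<noteq> 0" by force+
  \<comment> \<open>By compactness the same circle works for all centres near \<open>z0\<close>.\<close>
  let ?Q = "polydisc N z0 (r / 2)"
  have cont_circle: "continuous_on (?Q \<times> UNIV) (\<lambda>q. f (line (fst q) (\<rho> * cis (snd q))))"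
    if f: "several_holomorphic N D f" for f
  proof (rule continuous_on_compose2[OF several_holomorphic_continuous[OF f]])
    show "continuous_on (?Q \<times> UNIV) (\<lambda>q. line (fst q) (\<rho> * cis (snd q)))"
      unfolding line_def
    proof (rule continuous_on_coordinatewise_then_product)
      fix j
      have "continuous_on (?Q \<times> UNIV) (\<lambda>q. fst q j)"
        by (rule continuous_on_product_then_coordinatewise) (intro continuous_intros)
      then show "continuous_on (?Q \<times> UNIV) (\<lambda>q. fst q j + \<rho> * cis (snd q) * v j)"
        by (intro continuous_intros)
    qed
    show "(\<lambda>q. line (fst q) (\<rho> * cis (snd q))) ` (?Q \<times> UNIV) \<subseteq> D"
      using line_D \<rho> by (auto simp: norm_mult)
  qed
  have "openin (top_of_set (?Q \<times> UNIV))
      ((?Q \<times> UNIV) \<inter> (\<lambda>q. B (line (fst q) (\<rho> * cis (snd q)))) -` (- {0}))"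
    by (rule continuous_openin_preimage_gen[OF cont_circle[OF B]]) auto
  then obtain O' where O': "open O'" "(?Q \<times> UNIV) \<inter> (\<lambda>q. B (line (fst q) (\<rho> * cis (snd q)))) -` (- {0})
      = (?Q \<times> UNIV) \<inter> O'" unfolding openin_open by blast
  have "{z0} \<times> {0..2 * pi} \<subseteq> O'"
  proof
    fix q assume q: "q \<in> {z0} \<times> {0..2 * pi}"
    then have "q \<in> (?Q \<times> UNIV) \<inter> (\<lambda>q. B (line (fst q) (\<rho> * cis (snd q)))) -` (- {0})"
      using nz0 \<rho> \<open>z0 \<in> ?Q\<close> by (auto simp: norm_mult)
    then show "q \<in> O'" using O'(2) by blast
  qed
  from Elementary_Topology.tube_lemma[OF compact_Icc O'(1) this]
  obtain X0 where X0: "z0 \<in> X0" "open X0" "X0 \<times> {0..2 * pi} \<subseteq> O'" by blast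
  define P where "P = ?Q \<inter> X0"
  have "P = ?Q \<inter> (coord_space N \<inter> X0)" by (auto simp: P_def polydisc_def)
  moreover have "openin (coord_top N) (coord_space N \<inter> X0)"
    using X0(2) openin_coord_top_iff by blast
  ultimately have P: "openin (coord_top N) P" using openin_polydisc openin_Int by metis
  have z0P: "z0 \<in> P" using X0 \<open>z0 \<in> ?Q\<close> by (simp add: P_def)
  have nz: "B (line z (\<rho> * cis t)) \<noteq> 0" if "z \<in> P" "t \<in> {0..2 * pi}" for z t
  proof -
    have "(z, t) \<in> (?Q \<times> UNIV) \<inter> O'" using that X0 by (auto simp: P_def)
    then have "(z, t) \<in> (?Q \<times> UNIV) \<inter> (\<lambda>q. B (line (fst q) (\<rho> * cis (snd q)))) -` (- {0})"
      using O'(2) by blast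
    then show ?thesis by simp
  qed
  have nz': "B (line z t) \<noteq> 0" if "z \<in> P" "norm t = \<rho>" for z t
  proof -
    have "t = \<rho> * cis (Arg2pi t)"
      using that(2) Arg2pi_eq[of t] by (simp add: cis_conv_exp)
    then show ?thesis using nz[OF that(1), of "Arg2pi t"] Arg2pi_ge_0[of t] Arg2pi_lt_2pi[of t] by simp
  qed
  define h where "h z = integral {0..2 * pi} (\<lambda>t. A (line z (\<rho> * cis t)) / B (line z (\<rho> * cis t))) / (2 * of_real pi)" for z
  have hP: "several_holomorphic N P h"
    unfolding h_def
  proof (intro several_holomorphic_divide several_holomorphic_const P several_holomorphic_integral)
    have "continuous_on (P \<times> {0..2 * pi}) (\<lambda>q. A (line (fst q) (\<rho> * cis (snd q))) / B (line (fst q) (\<rho> * cis (snd q))))"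
      by (intro continuous_on_divide continuous_on_subset[OF cont_circle[OF A]]
          continuous_on_subset[OF cont_circle[OF B]]) (use nz in \<open>auto simp: P_def\<close>)
    then show "continuous_on (P \<times> {0..2 * pi}) (\<lambda>(z, t). A (line z (\<rho> * cis t)) / B (line z (\<rho> * cis t)))"
      by (simp add: case_prod_unfold)
    fix t
    have tr: "several_holomorphic N P (\<lambda>z. f (line z (\<rho> * cis t)))"
      if f: "several_holomorphic N D f" for f
      unfolding line_def
      by (rule several_holomorphic_translate[OF f P])
         (use line_D[of _ "\<rho> * cis t"] \<rho> in \<open>auto simp: line_def P_def norm_mult\<close>)
    show "several_holomorphic N P (\<lambda>z. A (line z (\<rho> * cis t)))" by (rule tr[OF A])
    show "several_holomorphic N P (\<lambda>z. B (line z (\<rho> * cis t)))" by (rule tr[OF B])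
    show "B (line z (\<rho> * cis t)) \<noteq> 0" if "t \<in> {0..2 * pi}" "z \<in> P" for z using nz that by blast
  qed auto
  have hol_line: "(\<lambda>t. f (line z t)) holomorphic_on ball 0 1"
    if "z \<in> P" "several_holomorphic N D f" for z f
    unfolding line_def
    by (rule holomorphic_on_line[OF that(2)]) (use line_D that(1) in \<open>auto simp: P_def line_def\<close>)
  have quot: "A z = B z * h z" if z: "z \<in> P" for z
  proof -
    have "A (line z 0) = B (line z 0) *
       (integral {0..2 * pi} (\<lambda>t. A (line z (\<rho> * cis t)) / B (line z (\<rho> * cis t))) / (2 * of_real pi))"
    proof (rule holomorphic_integral_quotient[OF hol_line[OF z A] hol_line[OF z B] \<rho>])
      show "B (line z t) \<noteq> 0" if "norm t = \<rho>" for t using nz'[OF z that] .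
      show "continuous_on (ball 0 1) (\<lambda>t. c i (line z t))" if "i < m" for i
        by (rule holomorphic_on_imp_continuous_on[OF hol_line[OF z c[OF that]]])
      show "A (line z t) ^ m + (\<Sum>i<m. c i (line z t) * A (line z t) ^ i * B (line z t) ^ (m - i)) = 0"
        if "t \<in> ball 0 1" for t
        by (rule eq, rule line_D) (use z that in \<open>auto simp: P_def\<close>)
    qed
    then show ?thesis by (simp add: h_def line_def)
  qed
  \<comment> \<open>A zero of \<open>B\<close> on an open set would by continuation along the line reach the circle.\<close>
  have nint: "\<not> (openin (coord_top N) V \<and> z \<in> V \<and> (\<forall>y\<in>V \<inter> D. B y = 0))" if z: "z \<in> P" for z V
  proof
    assume V: "openin (coord_top N) V \<and> z \<in> V \<and> (\<forall>y\<in>V \<inter> D. B y = 0)"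
    obtain T where T: "open T" "V = coord_space N \<inter> T"
      using V openin_coord_top_iff by blast
    define S where "S = ball 0 1 \<inter> line z -` T"
    have zN: "z \<in> coord_space N" using z by (auto simp: P_def polydisc_def)
    have "open S" unfolding S_def line_def
      by (intro open_Int open_ball open_vimage[OF T(1) continuous_on_line])
    moreover have "0 \<in> S" using V T by (auto simp: S_def line_def)
    ultimately have S: "open S" "S \<noteq> {}" by auto
    have "B (line z t) = 0" if "t \<in> S" for t
      using that V T line_space[OF zN] line_D[of z t] z by (auto simp: S_def P_def)
    then have "B (line z \<rho>) = 0"
      using analytic_continuation_open[OF S(1) open_ball S(2) connected_ball _ hol_line[OF z B]
          holomorphic_on_const[of 0], of "of_real \<rho>"] \<rho> by (auto simp: S_def)
    then show False using nz'[OF z, of "of_real \<rho>"] \<rho> by simp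
  qed
  have "P \<subseteq> D" using line_D[of _ 0] by (auto simp: P_def line_def)
  then show ?thesis
    using P z0P hP quot nint by (intro exI[of _ P] exI[of _ h]) blast
qed

section \<open>Holomorphic functions on complex spaces\<close>

text \<open>
  Complex spaces are modelled on analytic sets and complex manifolds on open sets; the calculus of
  holomorphic functions is the same for both.
\<close>

definition locally_modelled :: "'a function_space \<Rightarrow> bool" where
  "locally_modelled X \<longleftrightarrow> function_sheaf X \<and>
     (\<forall>x\<in>points X. \<exists>U N A \<phi>. openin (topo X) U \<and> x \<in> U \<and>
        biholomorphic (open_subspace X U) (local_model N A) \<phi>)"

lemma complex_space_locally_modelled:
  assumes "complex_space X" shows "locally_modelled X"
  unfolding locally_modelled_def
proof (intro conjI ballI)
  show "function_sheaf X" using assms by (simp add: complex_space_def)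
  fix x assume x: "x \<in> points X"
  have "\<forall>x\<in>points X. \<exists>U N D E \<phi>.
        openin (topo X) U \<and> x \<in> U \<and> openin (coord_top N) D \<and>
        finite E \<and> (\<forall>h\<in>E. several_holomorphic N D h) \<and>
        biholomorphic (open_subspace X U) (local_model N {z\<in>D. \<forall>h\<in>E. h z = 0}) \<phi>"
    by (rule conjunct2[OF conjunct2[OF assms[unfolded complex_space_def]]])
  from bspec[OF this x] show "\<exists>U N A \<phi>. openin (topo X) U \<and> x \<in> U \<and>
        biholomorphic (open_subspace X U) (local_model N A) \<phi>"
    by (elim exE conjE) (intro exI conjI)
qed

lemma complex_manifold_locally_modelled:
  assumes "complex_manifold n M" shows "locally_modelled M"
  unfolding locally_modelled_def
proof (intro conjI ballI)
  show "function_sheaf M" using assms by (simp add: complex_manifold_def)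
  fix p assume "p \<in> points M"
  then obtain V \<phi> where "(V, \<phi>) \<in> charts n M (points M)" "p \<in> V"
    using assms unfolding complex_manifold_def by blast
  then have "openin (topo M) V \<and> p \<in> V \<and> biholomorphic (open_subspace M V) (local_model n (\<phi> ` V)) \<phi>"
    by (auto simp: charts_def)
  then show "\<exists>U N A \<phi>. openin (topo M) U \<and> p \<in> U \<and>
        biholomorphic (open_subspace M U) (local_model N A) \<phi>" by blast
qed

lemma locally_modelled_sheaf: "locally_modelled X \<Longrightarrow> function_sheaf X"
  by (simp add: locally_modelled_def)

lemma hol_extensional: "function_sheaf X \<Longrightarrow> openin (topo X) U \<Longrightarrow> f \<in> hol X U \<Longrightarrow> f \<in> extensional U"
  unfolding function_sheaf_def by blast

lemma hol_restrict:
  "function_sheaf X \<Longrightarrow> openin (topo X) U \<Longrightarrow> f \<in> hol X U \<Longrightarrow> openin (topo X) V \<Longrightarrow> V \<subseteq> U \<Longrightarrow>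
     restrict f V \<in> hol X V"
  unfolding function_sheaf_def by blast

lemma hol_glue:
  "function_sheaf X \<Longrightarrow> openin (topo X) U \<Longrightarrow> f \<in> extensional U \<Longrightarrow>
     (\<And>x. x \<in> U \<Longrightarrow> \<exists>V. openin (topo X) V \<and> x \<in> V \<and> V \<subseteq> U \<and> restrict f V \<in> hol X V) \<Longrightarrow> f \<in> hol X U"
  unfolding function_sheaf_def by blast

lemma holomorphic_map_pullback:
  "holomorphic_map X Y f \<Longrightarrow> openin (topo Y) V \<Longrightarrow> g \<in> hol Y V \<Longrightarrow>
     (\<lambda>x\<in>preimage X f V. g (f x)) \<in> hol X (preimage X f V)"
  by (simp add: holomorphic_map_def)

lemma points_open_subspace: "openin (topo X) U \<Longrightarrow> points (open_subspace X U) = U"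
  using openin_subset by (fastforce simp: open_subspace_def)

lemma hol_open_subspace [simp]: "hol (open_subspace X U) = hol X"
  by (simp add: open_subspace_def)

lemma openin_open_subspace:
  "openin (topo X) U \<Longrightarrow> openin (topo (open_subspace X U)) V \<longleftrightarrow> openin (topo X) V \<and> V \<subseteq> U"
  by (simp add: open_subspace_def openin_open_subtopology)

lemma points_local_model: "points (local_model N A) = coord_space N \<inter> A"
  by (simp add: local_model_def)

lemma hol_local_modelD:
  "f \<in> hol (local_model N A) V \<Longrightarrow> z \<in> V \<Longrightarrow>
     \<exists>W h. openin (coord_top N) W \<and> z \<in> W \<and> several_holomorphic N W h \<and> (\<forall>w\<in>V \<inter> W. f w = h w)"
  by (simp add: local_model_def)

lemma chart_preimage_open:
  assumes "openin (topo X) U" "holomorphic_map (open_subspace X U) (local_model N A) \<phi>"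
    "openin (coord_top N) W"
  shows "openin (topo X) {y \<in> U. \<phi> y \<in> W}"
proof -
  have cont: "continuous_map (topo (open_subspace X U)) (topo (local_model N A)) \<phi>"
    using assms(2) by (simp add: holomorphic_map_def)
  have "openin (topo (local_model N A)) (W \<inter> A)"
    using assms(3) by (auto simp: local_model_def openin_subtopology)
  then have "openin (topo (open_subspace X U)) {y \<in> points (open_subspace X U). \<phi> y \<in> W \<inter> A}"
    by (rule openin_continuous_map_preimage[OF cont])
  moreover have "{y \<in> points (open_subspace X U). \<phi> y \<in> W \<inter> A} = {y \<in> U. \<phi> y \<in> W}"
    using continuous_map_image_subset_topspace[OF cont] points_open_subspace[OF assms(1)]
    by (auto simp: points_local_model)
  ultimately show ?thesis using openin_open_subspace[OF assms(1)] by metis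
qed

text \<open>
  Together with the next lemma: a function is holomorphic if and only if locally in charts it is the
  restriction of a holomorphic function of the coordinates.
\<close>

lemma hol_local_expression:
  assumes X: "function_sheaf X" and U0: "openin (topo X) U0"
    and bi: "biholomorphic (open_subspace X U0) (local_model N A) \<phi>"
    and U: "openin (topo X) U" and f: "f \<in> hol X U" and x: "x \<in> U \<inter> U0"
  obtains W h where "openin (coord_top N) W" "\<phi> x \<in> W" "several_holomorphic N W h"
    "\<forall>y\<in>U \<inter> U0. \<phi> y \<in> W \<longrightarrow> f y = h (\<phi> y)"
proof -
  obtain g where g: "holomorphic_map (local_model N A) (open_subspace X U0) g"
    "\<And>y. y \<in> U0 \<Longrightarrow> g (\<phi> y) = y"
    using bi points_open_subspace[OF U0] unfolding biholomorphic_def by metis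
  have "continuous_map (topo (open_subspace X U0)) (topo (local_model N A)) \<phi>"
    using bi by (simp add: biholomorphic_def holomorphic_map_def)
  then have \<phi>: "\<phi> y \<in> points (local_model N A)" if "y \<in> U0" for y
    using that points_open_subspace[OF U0] continuous_map_image_subset_topspace by fastforce
  define V where "V = U \<inter> U0"
  define V' where "V' = preimage (local_model N A) g V"
  have V: "openin (topo X) V" using U U0 by (auto simp: V_def)
  have "restrict f V \<in> hol X V" using hol_restrict[OF X U f V] by (simp add: V_def)
  moreover have "openin (topo (open_subspace X U0)) V"
    using V openin_open_subspace[OF U0] by (simp add: V_def)
  ultimately have pulled: "(\<lambda>z\<in>V'. restrict f V (g z)) \<in> hol (local_model N A) V'"
    unfolding V'_def by (intro holomorphic_map_pullback[OF g(1)]) (simp_all only: hol_open_subspace)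
  have inV': "\<phi> y \<in> V'" if "y \<in> V" for y
    using that \<phi> g(2) by (auto simp: V'_def preimage_def V_def)
  have "x \<in> V" using x by (simp add: V_def)
  from hol_local_modelD[OF pulled inV'[OF this]]
  obtain W h where W: "openin (coord_top N) W" "\<phi> x \<in> W" "several_holomorphic N W h"
    "\<forall>w\<in>V' \<inter> W. (\<lambda>z\<in>V'. restrict f V (g z)) w = h w"
    by (elim exE conjE)
  show thesis
  proof (rule that[OF W(1-3)], intro ballI impI)
    fix y assume y: "y \<in> U \<inter> U0" "\<phi> y \<in> W"
    then have "y \<in> V" by (simp add: V_def)
    then show "f y = h (\<phi> y)" using bspec[OF W(4), of "\<phi> y"] inV' y g(2)[of y] by (simp add: V_def)
  qed
qed

lemma hol_of_local_expressions:
  assumes X: "function_sheaf X" and U: "openin (topo X) U" and f: "f \<in> extensional U"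
    and loc: "\<And>x. x \<in> U \<Longrightarrow> \<exists>U0 N A \<phi> W h. openin (topo X) U0 \<and> x \<in> U0 \<and>
       holomorphic_map (open_subspace X U0) (local_model N A) \<phi> \<and>
       openin (coord_top N) W \<and> \<phi> x \<in> W \<and> several_holomorphic N W h \<and>
       (\<forall>y\<in>U \<inter> U0. \<phi> y \<in> W \<longrightarrow> f y = h (\<phi> y))"
  shows "f \<in> hol X U"
proof (rule hol_glue[OF X U f])
  fix x assume x: "x \<in> U"
  obtain U0 N A \<phi> W h where U0: "openin (topo X) U0" "x \<in> U0"
    and \<phi>: "holomorphic_map (open_subspace X U0) (local_model N A) \<phi>"
    and W: "openin (coord_top N) W" "\<phi> x \<in> W" "several_holomorphic N W h"
    and h: "\<And>y. y \<in> U \<inter> U0 \<Longrightarrow> \<phi> y \<in> W \<Longrightarrow> f y = h (\<phi> y)"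
    using loc[OF x] by blast
  define W' where "W' = W \<inter> A"
  define V1 where "V1 = {y \<in> U0. \<phi> y \<in> W}"
  have V1: "openin (topo X) V1" unfolding V1_def by (rule chart_preimage_open[OF U0(1) \<phi> W(1)])
  have W': "openin (topo (local_model N A)) W'"
    using W(1) by (auto simp: local_model_def openin_subtopology W'_def)
  have hW': "restrict h W' \<in> hol (local_model N A) W'"
    using W by (auto simp: local_model_def W'_def)
  have "(\<lambda>y\<in>preimage (open_subspace X U0) \<phi> W'. restrict h W' (\<phi> y))
      \<in> hol X (preimage (open_subspace X U0) \<phi> W')"
    using holomorphic_map_pullback[OF \<phi> W' hW'] by (simp only: hol_open_subspace)
  moreover have "continuous_map (topo (open_subspace X U0)) (topo (local_model N A)) \<phi>"
    using \<phi> by (simp add: holomorphic_map_def)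
  then have \<phi>A: "\<phi> y \<in> A" if "y \<in> U0" for y
    using that points_open_subspace[OF U0(1)] continuous_map_image_subset_topspace
    by (fastforce simp: points_local_model)
  have "preimage (open_subspace X U0) \<phi> W' = V1"
    using \<phi>A points_open_subspace[OF U0(1)] by (auto simp: preimage_def W'_def V1_def)
  ultimately have "(\<lambda>y\<in>V1. restrict h W' (\<phi> y)) \<in> hol X V1" by simp
  moreover have V: "openin (topo X) (U \<inter> V1)" using U V1 by blast
  ultimately have "restrict (\<lambda>y\<in>V1. restrict h W' (\<phi> y)) (U \<inter> V1) \<in> hol X (U \<inter> V1)"
    using hol_restrict[OF X V1] by blast
  moreover have "restrict (\<lambda>y\<in>V1. restrict h W' (\<phi> y)) (U \<inter> V1) = restrict f (U \<inter> V1)"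
    using h \<phi>A by (auto simp: fun_eq_iff restrict_def V1_def W'_def)
  ultimately show "\<exists>V. openin (topo X) V \<and> x \<in> V \<and> V \<subseteq> U \<and> restrict f V \<in> hol X V"
    using V x U0(2) W(2) by (intro exI[of _ "U \<inter> V1"]) (auto simp: V1_def)
qed

text \<open>
  Addition and multiplication are treated at once, by working with the expressions of both functions
  in a common chart.
\<close>

lemma hol_binary_operation:
  assumes X: "locally_modelled X" and U: "openin (topo X) U"
    and f: "f \<in> hol X U" and g: "g \<in> hol X U"
    and op: "\<And>N W h k. several_holomorphic N W h \<Longrightarrow> several_holomorphic N W k \<Longrightarrow>
      several_holomorphic N W (\<lambda>w. p (h w) (k w))"
  shows "(\<lambda>y\<in>U. p (f y) (g y)) \<in> hol X U"
proof (rule hol_of_local_expressions[OF locally_modelled_sheaf[OF X] U])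
  fix x assume x: "x \<in> U"
  then have "x \<in> points X" using U openin_subset by blast
  then obtain U0 N A \<phi> where U0: "openin (topo X) U0" "x \<in> U0"
    "biholomorphic (open_subspace X U0) (local_model N A) \<phi>"
    using X unfolding locally_modelled_def by blast
  have xU: "x \<in> U \<inter> U0" using x U0 by simp
  obtain W h where W: "openin (coord_top N) W" "\<phi> x \<in> W" "several_holomorphic N W h"
    "\<forall>y\<in>U \<inter> U0. \<phi> y \<in> W \<longrightarrow> f y = h (\<phi> y)"
    by (rule hol_local_expression[OF locally_modelled_sheaf[OF X] U0(1,3) U f xU])
  obtain W' k where W': "openin (coord_top N) W'" "\<phi> x \<in> W'" "several_holomorphic N W' k"
    "\<forall>y\<in>U \<inter> U0. \<phi> y \<in> W' \<longrightarrow> g y = k (\<phi> y)"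
    by (rule hol_local_expression[OF locally_modelled_sheaf[OF X] U0(1,3) U g xU])
  have WW: "openin (coord_top N) (W \<inter> W')" using W(1) W'(1) by (rule openin_Int)
  have "several_holomorphic N (W \<inter> W') (\<lambda>w. p (h w) (k w))"
    by (rule op) (rule several_holomorphic_subset[OF W(3) WW] several_holomorphic_subset[OF W'(3) WW]; blast)+
  then show "\<exists>U0 N A \<phi> W h. openin (topo X) U0 \<and> x \<in> U0 \<and>
       holomorphic_map (open_subspace X U0) (local_model N A) \<phi> \<and>
       openin (coord_top N) W \<and> \<phi> x \<in> W \<and> several_holomorphic N W h \<and>
       (\<forall>y\<in>U \<inter> U0. \<phi> y \<in> W \<longrightarrow> (\<lambda>y\<in>U. p (f y) (g y)) y = h (\<phi> y))"
    using U0 WW W W'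
    by (intro exI[of _ U0] exI[of _ N] exI[of _ A] exI[of _ \<phi>] exI[of _ "W \<inter> W'"]
        exI[of _ "\<lambda>w. p (h w) (k w)"]) (auto simp: biholomorphic_def)
qed simp

lemma hol_add:
  "locally_modelled X \<Longrightarrow> openin (topo X) U \<Longrightarrow> f \<in> hol X U \<Longrightarrow> g \<in> hol X U \<Longrightarrow>
     (\<lambda>y\<in>U. f y + g y) \<in> hol X U"
  by (rule hol_binary_operation) (auto intro: several_holomorphic_add)

lemma hol_mult:
  "locally_modelled X \<Longrightarrow> openin (topo X) U \<Longrightarrow> f \<in> hol X U \<Longrightarrow> g \<in> hol X U \<Longrightarrow>
     (\<lambda>y\<in>U. f y * g y) \<in> hol X U"
  by (rule hol_binary_operation) (auto intro: several_holomorphic_mult)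

lemma hol_const:
  assumes X: "locally_modelled X" and U: "openin (topo X) U"
  shows "(\<lambda>y\<in>U. c) \<in> hol X U"
proof (rule hol_of_local_expressions[OF locally_modelled_sheaf[OF X] U])
  fix x assume x: "x \<in> U"
  then have "x \<in> points X" using U openin_subset by blast
  then obtain U0 N A \<phi> where U0: "openin (topo X) U0" "x \<in> U0"
    "biholomorphic (open_subspace X U0) (local_model N A) \<phi>"
    using X unfolding locally_modelled_def by blast
  have "continuous_map (topo (open_subspace X U0)) (topo (local_model N A)) \<phi>"
    using U0 by (simp add: biholomorphic_def holomorphic_map_def)
  then have "\<phi> x \<in> coord_space N"
    using U0 points_open_subspace[OF U0(1)] continuous_map_image_subset_topspace
    by (fastforce simp: points_local_model)
  moreover have "openin (coord_top N) (coord_space N)"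
    by (metis openin_topspace topspace_coord_top)
  ultimately show "\<exists>U0 N A \<phi> W h. openin (topo X) U0 \<and> x \<in> U0 \<and>
       holomorphic_map (open_subspace X U0) (local_model N A) \<phi> \<and>
       openin (coord_top N) W \<and> \<phi> x \<in> W \<and> several_holomorphic N W h \<and>
       (\<forall>y\<in>U \<inter> U0. \<phi> y \<in> W \<longrightarrow> (\<lambda>y\<in>U. c) y = h (\<phi> y))"
    using U0 several_holomorphic_const[of N "coord_space N" c]
    by (intro exI[of _ U0] exI[of _ N] exI[of _ A] exI[of _ \<phi>] exI[of _ "coord_space N"]
        exI[of _ "\<lambda>w. c"]) (auto simp: biholomorphic_def)
qed simp

lemma hol_nonzero_open:
  assumes X: "locally_modelled X" and U: "openin (topo X) U" and f: "f \<in> hol X U"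
  shows "openin (topo X) {y \<in> U. f y \<noteq> 0}"
proof (subst openin_subopen, safe)
  fix x assume x: "x \<in> U" "f x \<noteq> 0"
  then have "x \<in> points X" using U openin_subset by blast
  then obtain U0 N A \<phi> where U0: "openin (topo X) U0" "x \<in> U0"
    "biholomorphic (open_subspace X U0) (local_model N A) \<phi>"
    using X unfolding locally_modelled_def by blast
  have xU: "x \<in> U \<inter> U0" using x U0 by simp
  obtain W h where W: "openin (coord_top N) W" "\<phi> x \<in> W" "several_holomorphic N W h"
    "\<forall>y\<in>U \<inter> U0. \<phi> y \<in> W \<longrightarrow> f y = h (\<phi> y)"
    by (rule hol_local_expression[OF locally_modelled_sheaf[OF X] U0(1,3) U f xU])
  have "openin (coord_top N) {w \<in> W. h w \<in> - {0}}"
    by (rule openin_coord_preimage[OF W(1) several_holomorphic_continuous[OF W(3)]]) auto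
  then have "openin (topo X) {y \<in> U0. \<phi> y \<in> {w \<in> W. h w \<in> - {0}}}"
    by (rule chart_preimage_open[OF U0(1) U0(3)[unfolded biholomorphic_def, THEN conjunct1]])
  then have "openin (topo X) (U \<inter> {y \<in> U0. \<phi> y \<in> {w \<in> W. h w \<in> - {0}}})"
    using U by blast
  moreover have "x \<in> U \<inter> {y \<in> U0. \<phi> y \<in> {w \<in> W. h w \<in> - {0}}}"
    using xU x W by auto
  moreover have "U \<inter> {y \<in> U0. \<phi> y \<in> {w \<in> W. h w \<in> - {0}}} \<subseteq> {y \<in> U. f y \<noteq> 0}"
    using W(4) by auto
  ultimately show "\<exists>T. openin (topo X) T \<and> x \<in> T \<and> T \<subseteq> {y \<in> U. f y \<noteq> 0}" by blast
qed

text \<open>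
  Analytic subsets are closed because holomorphic functions are continuous; it follows that the
  complement of the centre of a resolution is open.
\<close>

lemma analytic_subset_closed:
  assumes X: "locally_modelled X" and A: "analytic_subset X A"
  shows "closedin (topo X) A"
proof -
  have "openin (topo X) (points X - A)"
  proof (subst openin_subopen, rule ballI)
    fix x assume x: "x \<in> points X - A"
    then obtain U E where U: "openin (topo X) U" "x \<in> U" "E \<subseteq> hol X U"
      "A \<inter> U = {y\<in>U. \<forall>f\<in>E. f y = 0}"
      using A unfolding analytic_subset_def by blast
    then obtain f where f: "f \<in> E" "f x \<noteq> 0" using x by blast
    then have "openin (topo X) {y \<in> U. f y \<noteq> 0}"
      using U hol_nonzero_open[OF X U(1)] by blast
    moreover have "{y \<in> U. f y \<noteq> 0} \<subseteq> points X - A"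
      using U f openin_subset by fastforce
    ultimately show "\<exists>T. openin (topo X) T \<and> x \<in> T \<and> T \<subseteq> points X - A"
      using U f by blast
  qed
  then show ?thesis using A by (simp add: closedin_def analytic_subset_def)
qed

section \<open>Stalks\<close>

lemma germ_memE:
  assumes "(V, g) \<in> germ X x U f"
  obtains W where "openin (topo X) W" "x \<in> W" "W \<subseteq> U \<inter> V" "\<forall>y\<in>W. f y = g y"
proof -
  have "\<exists>W. openin (topo X) W \<and> x \<in> W \<and> W \<subseteq> U \<inter> V \<and> (\<forall>y\<in>W. f y = g y)"
    using assms by (simp add: germ_def)
  then show thesis using that by blast
qed

lemma germ_eqI:
  assumes "openin (topo X) W" "x \<in> W" "W \<subseteq> U \<inter> V" "\<And>y. y \<in> W \<Longrightarrow> f y = g y"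
  shows "germ X x U f = germ X x V g"
proof -
  have *: "germ X x U f \<subseteq> germ X x V g"
    if W: "openin (topo X) W" "x \<in> W" "W \<subseteq> U \<inter> V" "\<And>y. y \<in> W \<Longrightarrow> f y = g y" for U V f g
  proof (clarsimp simp: germ_def)
    fix V' g' W' assume h: "openin (topo X) V'" "x \<in> V'" "g' \<in> hol X V'"
      "openin (topo X) W'" "x \<in> W'" "W' \<subseteq> U" "W' \<subseteq> V'" "\<forall>y\<in>W'. f y = g' y"
    have "openin (topo X) (W \<inter> W')" using W h by blast
    then show "\<exists>W. openin (topo X) W \<and> x \<in> W \<and> W \<subseteq> V \<and> W \<subseteq> V' \<and> (\<forall>y\<in>W. g y = g' y)"
      using W h by (intro exI[of _ "W \<inter> W'"]) auto
  qed
  show ?thesis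
    by (rule equalityI; rule *[OF assms(1,2)]) (use assms(3,4) in auto)
qed

lemma germ_self:
  "openin (topo X) U \<Longrightarrow> x \<in> U \<Longrightarrow> f \<in> hol X U \<Longrightarrow> (U, f) \<in> germ X x U f"
  by (auto simp: germ_def)

lemma germ_eqD:
  assumes "germ X x U f = germ X x V g" "openin (topo X) V" "x \<in> V" "g \<in> hol X V"
  obtains W where "openin (topo X) W" "x \<in> W" "W \<subseteq> U \<inter> V" "\<forall>y\<in>W. f y = g y"
proof -
  have "(V, g) \<in> germ X x U f" using germ_self[OF assms(2-4)] assms(1) by simp
  from germ_memE[OF this] show thesis by (metis that)
qed

lemma germ_restrict:
  "openin (topo X) V \<Longrightarrow> x \<in> V \<Longrightarrow> V \<subseteq> U \<Longrightarrow> germ X x V (restrict f V) = germ X x U f"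
  by (rule germ_eqI[of X V]) auto

lemma stalk_carrierE:
  assumes "a \<in> carrier (stalk X x)"
  obtains U f where "openin (topo X) U" "x \<in> U" "f \<in> hol X U" "a = germ X x U f"
  using assms by (auto simp: stalk_def)

lemma germ_in_stalk:
  "openin (topo X) U \<Longrightarrow> x \<in> U \<Longrightarrow> f \<in> hol X U \<Longrightarrow> germ X x U f \<in> carrier (stalk X x)"
  by (auto simp: stalk_def)

lemma Union_germ_operation:
  assumes f: "openin (topo X) U" "x \<in> U" "f \<in> hol X U"
    and g: "openin (topo X) V" "x \<in> V" "g \<in> hol X V"
  shows "(\<Union>(U', f')\<in>germ X x U f. \<Union>(V', g')\<in>germ X x V g.
      germ X x (U' \<inter> V') (\<lambda>y\<in>U' \<inter> V'. p (f' y) (g' y))) =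
    germ X x (U \<inter> V) (\<lambda>y\<in>U \<inter> V. p (f y) (g y))"
proof -
  have eq: "germ X x (U' \<inter> V') (\<lambda>y\<in>U' \<inter> V'. p (f' y) (g' y)) =
      germ X x (U \<inter> V) (\<lambda>y\<in>U \<inter> V. p (f y) (g y))"
    if m: "(U', f') \<in> germ X x U f" "(V', g') \<in> germ X x V g" for U' f' V' g'
  proof -
    obtain W where W: "openin (topo X) W" "x \<in> W" "W \<subseteq> U \<inter> U'" "\<forall>y\<in>W. f y = f' y"
      by (rule germ_memE[OF m(1)])
    obtain W' where W': "openin (topo X) W'" "x \<in> W'" "W' \<subseteq> V \<inter> V'" "\<forall>y\<in>W'. g y = g' y"
      by (rule germ_memE[OF m(2)])
    have WW: "openin (topo X) (W \<inter> W')" using W(1) W'(1) by (rule openin_Int)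
    show ?thesis by (rule germ_eqI[OF WW]) (use W W' in auto)
  qed
  show ?thesis
  proof (rule equalityI)
    show "germ X x (U \<inter> V) (\<lambda>y\<in>U \<inter> V. p (f y) (g y)) \<subseteq>
      (\<Union>(U', f')\<in>germ X x U f. \<Union>(V', g')\<in>germ X x V g.
        germ X x (U' \<inter> V') (\<lambda>y\<in>U' \<inter> V'. p (f' y) (g' y)))"
      using germ_self[OF f] germ_self[OF g] by blast
  qed (use eq in blast)
qed

lemma stalk_mult:
  assumes "openin (topo X) U" "x \<in> U" "f \<in> hol X U" "openin (topo X) V" "x \<in> V" "g \<in> hol X V"
  shows "germ X x U f \<otimes>\<^bsub>stalk X x\<^esub> germ X x V g = germ X x (U \<inter> V) (\<lambda>y\<in>U \<inter> V. f y * g y)"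
  using Union_germ_operation[OF assms, of "(*)"] by (simp add: stalk_def)

lemma stalk_add:
  assumes "openin (topo X) U" "x \<in> U" "f \<in> hol X U" "openin (topo X) V" "x \<in> V" "g \<in> hol X V"
  shows "germ X x U f \<oplus>\<^bsub>stalk X x\<^esub> germ X x V g = germ X x (U \<inter> V) (\<lambda>y\<in>U \<inter> V. f y + g y)"
  using Union_germ_operation[OF assms, of "(+)"] by (simp add: stalk_def)

lemma stalk_zero:
  assumes U: "openin (topo X) U" "x \<in> U"
  shows "\<zero>\<^bsub>stalk X x\<^esub> = germ X x U (\<lambda>y\<in>U. 0)"
proof -
  have "germ X x (points X) (\<lambda>y\<in>points X. 0) = germ X x U (\<lambda>y\<in>U. 0)"
    by (rule germ_eqI[OF U]) (use openin_subset[OF U(1)] in auto)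
  then show ?thesis by (simp add: stalk_def)
qed

lemma stalk_one:
  assumes U: "openin (topo X) U" "x \<in> U"
  shows "\<one>\<^bsub>stalk X x\<^esub> = germ X x U (\<lambda>y\<in>U. 1)"
proof -
  have "germ X x (points X) (\<lambda>y\<in>points X. 1) = germ X x U (\<lambda>y\<in>U. 1)"
    by (rule germ_eqI[OF U]) (use openin_subset[OF U(1)] in auto)
  then show ?thesis by (simp add: stalk_def)
qed

lemma hol_shrink:
  assumes "function_sheaf X" "openin (topo X) U" "f \<in> hol X U" "openin (topo X) V" "x \<in> V" "V \<subseteq> U"
  shows "restrict f V \<in> hol X V \<and> germ X x U f = germ X x V (restrict f V)"
  using assms hol_restrict germ_restrict by metis

text \<open>
  The axioms of an abelian monoid give the recursion for finite sums in the stalk. Products and powers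
  are computed directly on representatives.
\<close>

lemma stalk_abelian_monoid:
  assumes X: "locally_modelled X" and x: "x \<in> points X"
  shows "abelian_monoid (stalk X x)"
proof (rule abelian_monoidI)
  have P: "openin (topo X) (points X)" by simp
  show "\<zero>\<^bsub>stalk X x\<^esub> \<in> carrier (stalk X x)"
    using germ_in_stalk[OF P x hol_const[OF X P, of 0]] stalk_zero[OF P x] by simp
  fix a b assume "a \<in> carrier (stalk X x)" "b \<in> carrier (stalk X x)"
  then obtain U f V g where f: "openin (topo X) U" "x \<in> U" "f \<in> hol X U" "a = germ X x U f"
    and g: "openin (topo X) V" "x \<in> V" "g \<in> hol X V" "b = germ X x V g"
    by (meson stalk_carrierE)
  have UV: "openin (topo X) (U \<inter> V)" "x \<in> U \<inter> V" using f g by auto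
  have ab: "a \<oplus>\<^bsub>stalk X x\<^esub> b = germ X x (U \<inter> V) (\<lambda>y\<in>U \<inter> V. f y + g y)"
    using stalk_add[OF f(1-3) g(1-3)] f(4) g(4) by simp
  have sum_hol: "(\<lambda>y\<in>U \<inter> V. f y + g y) \<in> hol X (U \<inter> V)"
  proof -
    have "(\<lambda>y\<in>U \<inter> V. restrict f (U \<inter> V) y + restrict g (U \<inter> V) y) \<in> hol X (U \<inter> V)"
      by (intro hol_add[OF X UV(1)] hol_restrict[OF locally_modelled_sheaf[OF X] f(1,3) UV(1)]
          hol_restrict[OF locally_modelled_sheaf[OF X] g(1,3) UV(1)]) auto
    then show ?thesis by (simp cong: restrict_cong)
  qed
  show "a \<oplus>\<^bsub>stalk X x\<^esub> b \<in> carrier (stalk X x)"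
    unfolding ab by (rule germ_in_stalk[OF UV sum_hol])
  have ba: "b \<oplus>\<^bsub>stalk X x\<^esub> a = germ X x (V \<inter> U) (\<lambda>y\<in>V \<inter> U. g y + f y)"
    using stalk_add[OF g(1-3) f(1-3)] f(4) g(4) by simp
  show "a \<oplus>\<^bsub>stalk X x\<^esub> b = b \<oplus>\<^bsub>stalk X x\<^esub> a"
    unfolding ab ba by (rule germ_eqI[OF UV]) auto
  show "\<zero>\<^bsub>stalk X x\<^esub> \<oplus>\<^bsub>stalk X x\<^esub> a = a"
    using stalk_zero[OF f(1,2)] stalk_add[OF f(1,2) hol_const[OF X f(1), of 0] f(1-3)] f(4)
    by (auto intro!: germ_eqI[OF f(1,2)])
  fix c assume "c \<in> carrier (stalk X x)"
  then obtain W h where h: "openin (topo X) W" "x \<in> W" "h \<in> hol X W" "c = germ X x W h"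
    by (rule stalk_carrierE)
  have VW: "openin (topo X) (V \<inter> W)" "x \<in> V \<inter> W" using h g by auto
  have sum_hol': "(\<lambda>y\<in>V \<inter> W. g y + h y) \<in> hol X (V \<inter> W)"
  proof -
    have "(\<lambda>y\<in>V \<inter> W. restrict g (V \<inter> W) y + restrict h (V \<inter> W) y) \<in> hol X (V \<inter> W)"
      by (intro hol_add[OF X VW(1)] hol_restrict[OF locally_modelled_sheaf[OF X] g(1,3) VW(1)]
          hol_restrict[OF locally_modelled_sheaf[OF X] h(1,3) VW(1)]) auto
    then show ?thesis by (simp cong: restrict_cong)
  qed
  have bc: "b \<oplus>\<^bsub>stalk X x\<^esub> c = germ X x (V \<inter> W) (\<lambda>y\<in>V \<inter> W. g y + h y)"
    using stalk_add[OF g(1-3) h(1-3)] h(4) g(4) by simp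
  have UVW: "openin (topo X) (U \<inter> V \<inter> W)" "x \<in> U \<inter> V \<inter> W"
    using openin_Int[OF UV(1) h(1)] UV(2) h(2) by auto
  show "a \<oplus>\<^bsub>stalk X x\<^esub> b \<oplus>\<^bsub>stalk X x\<^esub> c = a \<oplus>\<^bsub>stalk X x\<^esub> (b \<oplus>\<^bsub>stalk X x\<^esub> c)"
  proof -
    have "a \<oplus>\<^bsub>stalk X x\<^esub> b \<oplus>\<^bsub>stalk X x\<^esub> c =
        germ X x (U \<inter> V \<inter> W) (\<lambda>y\<in>U \<inter> V \<inter> W. (\<lambda>y\<in>U \<inter> V. f y + g y) y + h y)"
      unfolding ab h(4) by (rule stalk_add[OF UV sum_hol h(1-3)])
    also have "\<dots> = germ X x (U \<inter> (V \<inter> W)) (\<lambda>y\<in>U \<inter> (V \<inter> W). f y + (\<lambda>y\<in>V \<inter> W. g y + h y) y)"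
      by (rule germ_eqI[OF UVW]) auto
    also have "\<dots> = a \<oplus>\<^bsub>stalk X x\<^esub> (b \<oplus>\<^bsub>stalk X x\<^esub> c)"
      unfolding bc f(4) by (rule stalk_add[OF f(1-3) VW sum_hol', symmetric])
    finally show ?thesis .
  qed
qed

lemma stalk_power:
  assumes X: "locally_modelled X" and U: "openin (topo X) U" "x \<in> U" and f: "f \<in> hol X U"
  shows "(\<lambda>y\<in>U. f y ^ k) \<in> hol X U \<and> germ X x U f [^]\<^bsub>stalk X x\<^esub> (k::nat) = germ X x U (\<lambda>y\<in>U. f y ^ k)"
proof (induction k)
  case 0
  show ?case using hol_const[OF X U(1), of 1] stalk_one[OF U] by (simp only: power_0 nat_pow_0)
next
  case (Suc k)
  have eq: "(\<lambda>y\<in>U. (\<lambda>y\<in>U. f y ^ k) y * f y) = (\<lambda>y\<in>U. f y ^ Suc k)"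
    by (auto simp: fun_eq_iff)
  have "(\<lambda>y\<in>U. (\<lambda>y\<in>U. f y ^ k) y * f y) \<in> hol X U"
    using hol_mult[OF X U(1) conjunct1[OF Suc] f] .
  moreover have "germ X x U (\<lambda>y\<in>U. f y ^ k) \<otimes>\<^bsub>stalk X x\<^esub> germ X x U f =
      germ X x U (\<lambda>y\<in>U. (\<lambda>y\<in>U. f y ^ k) y * f y)"
    using stalk_mult[OF U conjunct1[OF Suc] U f] by (simp only: Int_absorb)
  ultimately show ?case using Suc unfolding eq by (simp only: nat_pow_Suc)
qed

lemma stalk_finsum:
  assumes X: "locally_modelled X" and U: "openin (topo X) U" "x \<in> U"
    and I: "finite I" and F: "\<And>i. i \<in> I \<Longrightarrow> F i \<in> hol X U"
  shows "(\<lambda>y\<in>U. \<Sum>i\<in>I. F i y) \<in> hol X U \<and>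
    (\<Oplus>\<^bsub>stalk X x\<^esub>i\<in>I. germ X x U (F i)) = germ X x U (\<lambda>y\<in>U. \<Sum>i\<in>I. F i y)"
  using I F
proof (induction I rule: finite_induct)
  interpret abelian_monoid "stalk X x"
    using stalk_abelian_monoid[OF X] U openin_subset by blast
  case empty
  show ?case using hol_const[OF X U(1), of 0] stalk_zero[OF U] by (simp only: sum.empty finsum_empty)
next
  interpret abelian_monoid "stalk X x"
    using stalk_abelian_monoid[OF X] U openin_subset by blast
  case (insert j I)
  have IH: "(\<lambda>y\<in>U. \<Sum>i\<in>I. F i y) \<in> hol X U"
    "(\<Oplus>\<^bsub>stalk X x\<^esub>i\<in>I. germ X x U (F i)) = germ X x U (\<lambda>y\<in>U. \<Sum>i\<in>I. F i y)"
    using insert.IH[OF insert.prems[OF insertI2]] by iprover+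
  have Fj: "F j \<in> hol X U" using insert by simp
  have eq: "(\<lambda>y\<in>U. F j y + (\<lambda>y\<in>U. \<Sum>i\<in>I. F i y) y) = (\<lambda>y\<in>U. \<Sum>i\<in>insert j I. F i y)"
    using insert by (auto simp: fun_eq_iff)
  have "(\<Oplus>\<^bsub>stalk X x\<^esub>i\<in>insert j I. germ X x U (F i)) =
      germ X x U (F j) \<oplus>\<^bsub>stalk X x\<^esub> (\<Oplus>\<^bsub>stalk X x\<^esub>i\<in>I. germ X x U (F i))"
    using insert germ_in_stalk[OF U] by (intro finsum_insert) auto
  also have "\<dots> = germ X x U (\<lambda>y\<in>U. F j y + (\<lambda>y\<in>U. \<Sum>i\<in>I. F i y) y)"
    using stalk_add[OF U Fj U IH(1)] IH(2) by simp
  finally show ?case using hol_add[OF X U(1) Fj IH(1)] unfolding eq by blast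
qed

text \<open>
  Finitely many germs have representatives on a common neighbourhood, and after shrinking it an
  equation between germs holds for the functions.
\<close>

lemma stalk_integrally_closedI:
  assumes X: "locally_modelled X" and x: "x \<in> points X"
    and key: "\<And>U a b m c. openin (topo X) U \<Longrightarrow> x \<in> U \<Longrightarrow> a \<in> hol X U \<Longrightarrow> b \<in> hol X U \<Longrightarrow>
      (\<And>i. i < m \<Longrightarrow> c i \<in> hol X U) \<Longrightarrow>
      (\<And>y. y \<in> U \<Longrightarrow> a y ^ m + (\<Sum>i<m. c i y * a y ^ i * b y ^ (m - i)) = 0) \<Longrightarrow>
      \<exists>W q. openin (topo X) W \<and> x \<in> W \<and> W \<subseteq> U \<and> q \<in> hol X W \<and> (\<forall>y\<in>W. a y = q y * b y)"
  shows "integrally_closed (stalk X x)"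
  unfolding integrally_closed_def
proof (intro allI impI, elim conjE)
  fix a b and m :: nat and c
  assume a: "a \<in> carrier (stalk X x)" and b: "non_zero_divisor (stalk X x) b"
    and c: "c \<in> {..<m} \<rightarrow> carrier (stalk X x)"
    and eq: "a [^]\<^bsub>stalk X x\<^esub> m \<oplus>\<^bsub>stalk X x\<^esub> (\<Oplus>\<^bsub>stalk X x\<^esub>i\<in>{..<m}. c i \<otimes>\<^bsub>stalk X x\<^esub>
        (a [^]\<^bsub>stalk X x\<^esub> i \<otimes>\<^bsub>stalk X x\<^esub> b [^]\<^bsub>stalk X x\<^esub> (m - i))) = \<zero>\<^bsub>stalk X x\<^esub>"
  note S = locally_modelled_sheaf[OF X]
  obtain Ua fa where fa: "openin (topo X) Ua" "x \<in> Ua" "fa \<in> hol X Ua" "a = germ X x Ua fa"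
    using a by (rule stalk_carrierE)
  obtain Ub fb where fb: "openin (topo X) Ub" "x \<in> Ub" "fb \<in> hol X Ub" "b = germ X x Ub fb"
    using b unfolding non_zero_divisor_def by (metis stalk_carrierE)
  have "\<forall>i\<in>{..<m}. \<exists>U f. openin (topo X) U \<and> x \<in> U \<and> f \<in> hol X U \<and> c i = germ X x U f"
    using c stalk_carrierE by (metis PiE)
  then obtain Uc fc where fc: "\<And>i. i < m \<Longrightarrow> openin (topo X) (Uc i) \<and> x \<in> Uc i \<and> fc i \<in> hol X (Uc i) \<and>
      c i = germ X x (Uc i) (fc i)" by (metis lessThan_iff)
  define U where "U = Ua \<inter> Ub \<inter> ((\<Inter>i\<in>{..<m}. Uc i) \<inter> points X)"
  have "openin (topo X) ((\<Inter>i\<in>{..<m}. Uc i) \<inter> points X)"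
    using fc by (intro openin_INT) auto
  then have U: "openin (topo X) U" "x \<in> U" using fa fb fc x by (auto simp: U_def)
  have sub: "U \<subseteq> Ua" "U \<subseteq> Ub" "\<And>i. i < m \<Longrightarrow> U \<subseteq> Uc i" by (auto simp: U_def)
  define A where "A = restrict fa U"
  define B where "B = restrict fb U"
  define C where "C i = restrict (fc i) U" for i
  have A: "A \<in> hol X U" "a = germ X x U A"
    using hol_shrink[OF S fa(1,3) U sub(1)] fa(4) by (auto simp: A_def)
  have B: "B \<in> hol X U" "b = germ X x U B"
    using hol_shrink[OF S fb(1,3) U sub(2)] fb(4) by (auto simp: B_def)
  have C: "C i \<in> hol X U" "c i = germ X x U (C i)" if "i < m" for i
    using hol_shrink[OF S _ _ U sub(3)[OF that]] fc[OF that] unfolding C_def by blast+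
  define T where "T i = (\<lambda>y\<in>U. C i y * (A y ^ i * B y ^ (m - i)))" for i
  have T: "T i \<in> hol X U \<and> c i \<otimes>\<^bsub>stalk X x\<^esub> (a [^]\<^bsub>stalk X x\<^esub> i \<otimes>\<^bsub>stalk X x\<^esub> b [^]\<^bsub>stalk X x\<^esub> (m - i)) =
      germ X x U (T i)" if i: "i < m" for i
  proof -
    note pA = stalk_power[OF X U A(1), of i] and pB = stalk_power[OF X U B(1), of "m - i"]
    have e1: "(\<lambda>y\<in>U. (\<lambda>y\<in>U. A y ^ i) y * (\<lambda>y\<in>U. B y ^ (m - i)) y) = (\<lambda>y\<in>U. A y ^ i * B y ^ (m - i))"
      by (auto simp: fun_eq_iff)
    have AB: "(\<lambda>y\<in>U. A y ^ i * B y ^ (m - i)) \<in> hol X U"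
      using hol_mult[OF X U(1) conjunct1[OF pA] conjunct1[OF pB]] unfolding e1 .
    have "a [^]\<^bsub>stalk X x\<^esub> i \<otimes>\<^bsub>stalk X x\<^esub> b [^]\<^bsub>stalk X x\<^esub> (m - i) = germ X x U (\<lambda>y\<in>U. A y ^ i * B y ^ (m - i))"
      using stalk_mult[OF U conjunct1[OF pA] U conjunct1[OF pB]] pA pB
      unfolding e1 A(2) B(2) Int_absorb by (simp only:)
    moreover have e2: "(\<lambda>y\<in>U. C i y * (\<lambda>y\<in>U. A y ^ i * B y ^ (m - i)) y) = T i"
      by (auto simp: T_def fun_eq_iff)
    ultimately show ?thesis
      using stalk_mult[OF U C(1)[OF i] U AB] C(2)[OF i] hol_mult[OF X U(1) C(1)[OF i] AB]
      unfolding e2 Int_absorb by (simp only:)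
  qed
  interpret abelian_monoid "stalk X x" using stalk_abelian_monoid[OF X x] .
  have "(\<Oplus>\<^bsub>stalk X x\<^esub>i\<in>{..<m}. c i \<otimes>\<^bsub>stalk X x\<^esub> (a [^]\<^bsub>stalk X x\<^esub> i \<otimes>\<^bsub>stalk X x\<^esub> b [^]\<^bsub>stalk X x\<^esub> (m - i))) =
      (\<Oplus>\<^bsub>stalk X x\<^esub>i\<in>{..<m}. germ X x U (T i))"
    using T germ_in_stalk[OF U] by (intro finsum_cong') auto
  also have "\<dots> = germ X x U (\<lambda>y\<in>U. \<Sum>i<m. T i y)"
    using stalk_finsum[OF X U, of "{..<m}" T] T by auto
  finally have sum: "(\<Oplus>\<^bsub>stalk X x\<^esub>i\<in>{..<m}. c i \<otimes>\<^bsub>stalk X x\<^esub> (a [^]\<^bsub>stalk X x\<^esub> i \<otimes>\<^bsub>stalk X x\<^esub> b [^]\<^bsub>stalk X x\<^esub> (m - i))) =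
      germ X x U (\<lambda>y\<in>U. \<Sum>i<m. T i y)" .
  have sumT: "(\<lambda>y\<in>U. \<Sum>i<m. T i y) \<in> hol X U" using stalk_finsum[OF X U, of "{..<m}" T] T by auto
  note pm = stalk_power[OF X U A(1), of m]
  have vanish: "germ X x U (\<lambda>y\<in>U. (\<lambda>y\<in>U. A y ^ m) y + (\<lambda>y\<in>U. \<Sum>i<m. T i y) y) = germ X x U (\<lambda>y\<in>U. 0)"
    using eq stalk_add[OF U conjunct1[OF pm] U sumT] pm
    unfolding A(2) sum[unfolded A(2)] stalk_zero[OF U] Int_absorb by (simp only:)
  obtain W where W': "openin (topo X) W" "x \<in> W" "W \<subseteq> U \<inter> U"
    and W0: "\<forall>y\<in>W. (\<lambda>y\<in>U. (\<lambda>y\<in>U. A y ^ m) y + (\<lambda>y\<in>U. \<Sum>i<m. T i y) y) y = (\<lambda>y\<in>U. 0) y"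
    by (rule germ_eqD[OF vanish U hol_const[OF X U(1)]])
  then have W: "openin (topo X) W" "x \<in> W" "W \<subseteq> U" by auto
  have "\<exists>W' q. openin (topo X) W' \<and> x \<in> W' \<and> W' \<subseteq> W \<and> q \<in> hol X W' \<and>
      (\<forall>y\<in>W'. restrict A W y = q y * restrict B W y)"
  proof (rule key[OF W(1,2), where c = "\<lambda>i. restrict (C i) W"])
    show "restrict A W \<in> hol X W" "restrict B W \<in> hol X W" "\<And>i. i < m \<Longrightarrow> restrict (C i) W \<in> hol X W"
      using hol_restrict[OF S U(1) _ W(1,3)] A(1) B(1) C(1) by auto
    show "restrict A W y ^ m + (\<Sum>i<m. restrict (C i) W y * restrict A W y ^ i * restrict B W y ^ (m - i)) = 0"
      if "y \<in> W" for y
    proof -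
      have "y \<in> U" using that W by blast
      then show ?thesis using bspec[OF W0 that] that by (simp add: T_def mult.assoc)
    qed
  qed
  then obtain W' q where q: "openin (topo X) W'" "x \<in> W'" "W' \<subseteq> W" "q \<in> hol X W'"
    "\<And>y. y \<in> W' \<Longrightarrow> restrict A W y = q y * restrict B W y" by blast
  have "germ X x W' q \<otimes>\<^bsub>stalk X x\<^esub> b = germ X x (W' \<inter> U) (\<lambda>y\<in>W' \<inter> U. q y * B y)"
    using stalk_mult[OF q(1,2,4) U B(1)] B(2) by simp
  also have "\<dots> = germ X x U A"
    by (rule germ_eqI[OF q(1,2)]) (use q W in \<open>force+\<close>)
  finally have "a = germ X x W' q \<otimes>\<^bsub>stalk X x\<^esub> b" using A(2) by simp
  then show "\<exists>q\<in>carrier (stalk X x). a = q \<otimes>\<^bsub>stalk X x\<^esub> b"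
    using germ_in_stalk[OF q(1,2,4)] by blast
qed

section \<open>Charts of manifolds\<close>

lemma chartsD:
  assumes "(V, \<phi>) \<in> charts n M U"
  shows "openin (topo M) V" "V \<subseteq> U" "openin (coord_top n) (\<phi> ` V)"
    "biholomorphic (open_subspace M V) (local_model n (\<phi> ` V)) \<phi>"
  using assms by (auto simp: charts_def)

lemma points_local_model_open:
  "openin (coord_top n) D \<Longrightarrow> points (local_model n D) = D"
  using openin_coord_subset by (auto simp: points_local_model)

lemma chart_inverse:
  assumes "(V, \<phi>) \<in> charts n M U"
  obtains g where "holomorphic_map (local_model n (\<phi> ` V)) (open_subspace M V) g"
    "\<And>p. p \<in> V \<Longrightarrow> g (\<phi> p) = p"
proof -
  note V = chartsD[OF assms]
  obtain g where "holomorphic_map (local_model n (\<phi> ` V)) (open_subspace M V) g"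
    "\<forall>p\<in>points (open_subspace M V). g (\<phi> p) = p"
    using V(4) unfolding biholomorphic_def by (elim exE conjE)
  then show thesis using that points_open_subspace[OF V(1)] by simp
qed

lemma chart_inj: assumes "(V, \<phi>) \<in> charts n M U" shows "inj_on \<phi> V"
proof -
  obtain g where "\<And>p. p \<in> V \<Longrightarrow> g (\<phi> p) = p" using chart_inverse[OF assms] by metis
  then show ?thesis by (metis inj_onI)
qed

lemma chart_image_open:
  assumes c: "(V, \<phi>) \<in> charts n M S" and U: "openin (topo M) U" "U \<subseteq> V"
  shows "openin (coord_top n) (\<phi> ` U)"
proof -
  note V = chartsD[OF c]
  obtain g where g: "holomorphic_map (local_model n (\<phi> ` V)) (open_subspace M V) g"
    "\<And>p. p \<in> V \<Longrightarrow> g (\<phi> p) = p" using chart_inverse[OF c] by metis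
  have "continuous_map (topo (local_model n (\<phi> ` V))) (topo (open_subspace M V)) g"
    using g(1) by (simp add: holomorphic_map_def)
  moreover have "openin (topo (open_subspace M V)) U"
    using U openin_open_subspace[OF V(1)] by blast
  ultimately have "openin (topo (local_model n (\<phi> ` V))) {z \<in> points (local_model n (\<phi> ` V)). g z \<in> U}"
    by (rule openin_continuous_map_preimage)
  moreover have "{z \<in> points (local_model n (\<phi> ` V)). g z \<in> U} = \<phi> ` U"
    using g(2) U(2) points_local_model_open[OF V(3)] by auto
  ultimately show ?thesis
    using V(3) by (simp add: local_model_def openin_open_subtopology)
qed

lemma hol_in_chart:
  assumes M: "function_sheaf M" and c: "(V, \<phi>) \<in> charts n M S"
    and U: "openin (topo M) U" "U \<subseteq> V" and f: "f \<in> hol M U"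
  shows "several_holomorphic n (\<phi> ` U) (\<lambda>z. f (inv_into V \<phi> z))"
proof (rule several_holomorphic_local[OF chart_image_open[OF c U]])
  fix z assume "z \<in> \<phi> ` U"
  then obtain p where p: "p \<in> U" "z = \<phi> p" by blast
  note V = chartsD[OF c]
  have pU: "p \<in> U \<inter> V" using p U by blast
  obtain W h where W: "openin (coord_top n) W" "\<phi> p \<in> W" "several_holomorphic n W h"
    "\<forall>y\<in>U \<inter> V. \<phi> y \<in> W \<longrightarrow> f y = h (\<phi> y)"
    by (rule hol_local_expression[OF M V(1,4) U(1) f pU])
  have "f (inv_into V \<phi> w) = h w" if "w \<in> \<phi> ` U \<inter> W" for w
  proof -
    obtain y where y: "y \<in> U" "w = \<phi> y" using \<open>w \<in> \<phi> ` U \<inter> W\<close> by blast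
    then have "inv_into V \<phi> w = y" using chart_inj[OF c] U(2) by (simp add: inv_into_f_f subset_iff)
    then show ?thesis using bspec[OF W(4), of y] y U(2) that by auto
  qed
  then show "\<exists>W h. openin (coord_top n) W \<and> z \<in> W \<and> several_holomorphic n W h \<and>
      (\<forall>w\<in>\<phi> ` U \<inter> W. f (inv_into V \<phi> w) = h w)"
    using W p by (intro exI[of _ W] exI[of _ h]) simp
qed

lemma hol_of_chart:
  assumes M: "function_sheaf M" and c: "(V, \<phi>) \<in> charts n M S"
    and U: "openin (topo M) U" "U \<subseteq> V" and h: "several_holomorphic n W h" "\<phi> ` U \<subseteq> W"
  shows "(\<lambda>p\<in>U. h (\<phi> p)) \<in> hol M U"
proof (rule hol_of_local_expressions[OF M U(1)])
  fix p assume p: "p \<in> U"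
  note V = chartsD[OF c]
  show "\<exists>U0 N A \<phi>' W h'. openin (topo M) U0 \<and> p \<in> U0 \<and>
       holomorphic_map (open_subspace M U0) (local_model N A) \<phi>' \<and>
       openin (coord_top N) W \<and> \<phi>' p \<in> W \<and> several_holomorphic N W h' \<and>
       (\<forall>y\<in>U \<inter> U0. \<phi>' y \<in> W \<longrightarrow> (\<lambda>p\<in>U. h (\<phi> p)) y = h' (\<phi>' y))"
    using p U V h several_holomorphic_open[OF h(1)]
    by (intro exI[of _ V] exI[of _ n] exI[of _ "\<phi> ` V"] exI[of _ \<phi>] exI[of _ W] exI[of _ h])
       (auto simp: biholomorphic_def)
qed simp

lemma hol_local_model_independent: "hol (local_model n A) = hol (local_model n B)"
  by (simp add: local_model_def)

lemma charts_restrict: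
  assumes c: "(V, \<phi>) \<in> charts n M S" and U: "openin (topo M) U" "U \<subseteq> V" "U \<subseteq> T"
  shows "(U, \<phi>) \<in> charts n M T"
proof -
  note V = chartsD[OF c]
  note oU = chart_image_open[OF c U(1,2)]
  obtain g where g: "holomorphic_map (local_model n (\<phi> ` V)) (open_subspace M V) g"
    "\<And>p. p \<in> V \<Longrightarrow> g (\<phi> p) = p" using chart_inverse[OF c] by metis
  have \<phi>: "holomorphic_map (open_subspace M V) (local_model n (\<phi> ` V)) \<phi>"
    using V(4) by (simp add: biholomorphic_def)
  have cont\<phi>: "continuous_map (subtopology (topo M) V) (subtopology (coord_top n) (\<phi> ` V)) \<phi>"
    using \<phi> by (simp add: holomorphic_map_def open_subspace_def local_model_def)
  have contg: "continuous_map (subtopology (coord_top n) (\<phi> ` V)) (subtopology (topo M) V) g"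
    using g(1) by (simp add: holomorphic_map_def open_subspace_def local_model_def)
  have "holomorphic_map (open_subspace M U) (local_model n (\<phi> ` U)) \<phi>"
    unfolding holomorphic_map_def
  proof (intro conjI allI impI)
    have "continuous_map (subtopology (topo M) U) (coord_top n) \<phi>"
      using cont\<phi> U(2) continuous_map_from_subtopology_mono continuous_map_in_subtopology by blast
    then show "continuous_map (topo (open_subspace M U)) (topo (local_model n (\<phi> ` U))) \<phi>"
      by (auto simp: open_subspace_def local_model_def continuous_map_in_subtopology)
    fix W f assume W: "openin (topo (local_model n (\<phi> ` U))) W \<and> f \<in> hol (local_model n (\<phi> ` U)) W"
    then have W': "openin (coord_top n) W" "W \<subseteq> \<phi> ` U"
      using oU by (simp_all add: local_model_def openin_open_subtopology)
    then have WV: "openin (topo (local_model n (\<phi> ` V))) W"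
      using V(3) U(2) by (auto simp: local_model_def openin_open_subtopology)
    have eq: "preimage (open_subspace M U) \<phi> W = preimage (open_subspace M V) \<phi> W"
      using W'(2) U(2) chart_inj[OF c]
      by (auto simp: preimage_def points_open_subspace[OF V(1)] points_open_subspace[OF U(1)] dest: inj_onD)
    show "(\<lambda>x\<in>preimage (open_subspace M U) \<phi> W. f (\<phi> x)) \<in> hol (open_subspace M U) (preimage (open_subspace M U) \<phi> W)"
      using holomorphic_map_pullback[OF \<phi> WV] W
      unfolding eq hol_open_subspace hol_local_model_independent[of n "\<phi> ` U" "\<phi> ` V"] by blast
  qed
  moreover have "holomorphic_map (local_model n (\<phi> ` U)) (open_subspace M U) g"
    unfolding holomorphic_map_def
  proof (intro conjI allI impI)
    have "continuous_map (subtopology (coord_top n) (\<phi> ` U)) (topo M) g"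
      using contg U(2) by (meson continuous_map_from_subtopology_mono continuous_map_in_subtopology image_mono)
    then show "continuous_map (topo (local_model n (\<phi> ` U))) (topo (open_subspace M U)) g"
      using g(2) U(2) by (auto simp: open_subspace_def local_model_def continuous_map_in_subtopology)
    fix W f assume W: "openin (topo (open_subspace M U)) W \<and> f \<in> hol (open_subspace M U) W"
    then have W': "openin (topo M) W" "W \<subseteq> U"
      using openin_open_subspace[OF U(1)] by blast+
    then have WV: "openin (topo (open_subspace M V)) W"
      using openin_open_subspace[OF V(1)] U(2) by blast
    have eq: "preimage (local_model n (\<phi> ` U)) g W = preimage (local_model n (\<phi> ` V)) g W"
      using W'(2) U(2) g(2) by (auto simp: preimage_def points_local_model_open[OF V(3)] points_local_model_open[OF oU])
    show "(\<lambda>x\<in>preimage (local_model n (\<phi> ` U)) g W. f (g x)) \<in> hol (local_model n (\<phi> ` U)) (preimage (local_model n (\<phi> ` U)) g W)"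
      using holomorphic_map_pullback[OF g(1) WV] W
      unfolding eq hol_open_subspace hol_local_model_independent[of n "\<phi> ` U" "\<phi> ` V"] by blast
  qed
  moreover have "g (\<phi> p) = p" if "p \<in> points (open_subspace M U)" for p
    using g(2) that U by (auto simp: points_open_subspace)
  moreover have "\<phi> (g z) = z" if "z \<in> points (local_model n (\<phi> ` U))" for z
    using g(2) that U oU by (auto simp: points_local_model_open)
  ultimately have "biholomorphic (open_subspace M U) (local_model n (\<phi> ` U)) \<phi>"
    unfolding biholomorphic_def by blast
  then show ?thesis using U oU by (simp add: charts_def)
qed

lemma chart_at:
  assumes M: "complex_manifold n M" and U: "openin (topo M) U" and p: "p \<in> U"
  obtains V \<phi> where "(V, \<phi>) \<in> charts n M U" "p \<in> V"
proof -
  have "p \<in> points M" using U p openin_subset by blast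
  then obtain V \<phi> where V: "(V, \<phi>) \<in> charts n M (points M)" "p \<in> V"
    using M unfolding complex_manifold_def by blast
  have "openin (topo M) (V \<inter> U)" using chartsD(1)[OF V(1)] U by (rule openin_Int)
  then have "(V \<inter> U, \<phi>) \<in> charts n M U" by (rule charts_restrict[OF V(1)]) auto
  then show thesis using that V(2) p by blast
qed

section \<open>Integral quotients on manifolds\<close>

lemma manifold_integral_quotient_near:
  assumes M: "complex_manifold n M" and U: "openin (topo M) U"
    and a: "a \<in> hol M U" and b: "b \<in> hol M U" and c: "\<And>i. i < m \<Longrightarrow> c i \<in> hol M U"
    and eq: "\<And>p. p \<in> U \<Longrightarrow> a p ^ m + (\<Sum>i<m. c i p * a p ^ i * b p ^ (m - i)) = 0"
    and p: "p \<in> U"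
  shows "\<exists>W h. openin (topo M) W \<and> p \<in> W \<and> W \<subseteq> U \<and> h \<in> hol M W \<and> (\<forall>q\<in>W. a q = b q * h q) \<and>
    (\<forall>q\<in>W. \<forall>V. openin (topo M) V \<and> q \<in> V \<and> (\<forall>y\<in>V \<inter> U. b y = 0) \<longrightarrow> h q = 0)"
proof -
  have sh: "function_sheaf M" using M by (simp add: complex_manifold_def)
  obtain V \<phi> where V: "(V, \<phi>) \<in> charts n M U" "p \<in> V" using chart_at[OF M U p] by metis
  note VD = chartsD[OF V(1)]
  have tr: "several_holomorphic n (\<phi> ` V) (\<lambda>z. f (inv_into V \<phi> z))" if f: "f \<in> hol M U" for f
  proof (rule several_holomorphic_cong[OF hol_in_chart[OF sh V(1) VD(1) order_refl hol_restrict[OF sh U f VD(1,2)]]])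
    show "restrict f V (inv_into V \<phi> z) = f (inv_into V \<phi> z)" if "z \<in> \<phi> ` V" for z
      using inv_into_into[OF that] by simp
  qed
  have eq': "a (inv_into V \<phi> z) ^ m +
      (\<Sum>i<m. c i (inv_into V \<phi> z) * a (inv_into V \<phi> z) ^ i * b (inv_into V \<phi> z) ^ (m - i)) = 0"
    if "z \<in> \<phi> ` V" for z
    using inv_into_into[OF that] VD(2) by (intro eq) blast
  have pV: "\<phi> p \<in> \<phi> ` V" using V(2) by blast
  have "\<exists>W h. openin (coord_top n) W \<and> \<phi> p \<in> W \<and> W \<subseteq> \<phi> ` V \<and> several_holomorphic n W h \<and>
    (\<forall>w\<in>W. a (inv_into V \<phi> w) = b (inv_into V \<phi> w) * h w) \<and>
    (\<forall>w\<in>W. \<forall>T. openin (coord_top n) T \<and> w \<in> T \<and> (\<forall>y\<in>T \<inter> \<phi> ` V. b (inv_into V \<phi> y) = 0) \<longrightarrow> h w = 0)"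
    by (rule local_integral_quotient[OF tr[OF a] tr[OF b] tr[OF c] eq' pV])
  then obtain W h where W: "openin (coord_top n) W" "\<phi> p \<in> W" "W \<subseteq> \<phi> ` V" "several_holomorphic n W h"
    and Wq: "\<forall>w\<in>W. a (inv_into V \<phi> w) = b (inv_into V \<phi> w) * h w"
    and Wz: "\<forall>w\<in>W. \<forall>T. openin (coord_top n) T \<and> w \<in> T \<and> (\<forall>y\<in>T \<inter> \<phi> ` V. b (inv_into V \<phi> y) = 0) \<longrightarrow> h w = 0"
    by (elim exE conjE)
  have inv: "inv_into V \<phi> (\<phi> q) = q" if "q \<in> V" for q
    using chart_inj[OF V(1)] that by (rule inv_into_f_f)
  define W0 where "W0 = {q \<in> V. \<phi> q \<in> W}"
  have W0: "openin (topo M) W0" unfolding W0_def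
    by (rule chart_preimage_open[OF VD(1) VD(4)[unfolded biholomorphic_def, THEN conjunct1] W(1)])
  have W0V: "W0 \<subseteq> V" by (auto simp: W0_def)
  define k where "k = (\<lambda>q\<in>W0. h (\<phi> q))"
  have "k \<in> hol M W0"
    unfolding k_def by (rule hol_of_chart[OF sh V(1) W0 W0V W(4)]) (auto simp: W0_def)
  moreover have "a q = b q * k q" if "q \<in> W0" for q
    using bspec[OF Wq, of "\<phi> q"] that inv[of q] by (simp add: k_def W0_def)
  moreover have "k q = 0" if q: "q \<in> W0" and T: "openin (topo M) T" "q \<in> T" "\<forall>y\<in>T \<inter> U. b y = 0" for q T
  proof -
    have "openin (coord_top n) (\<phi> ` (T \<inter> V))"
      by (rule chart_image_open[OF V(1) openin_Int[OF T(1) VD(1)]]) simp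
    moreover have "\<phi> q \<in> \<phi> ` (T \<inter> V)" using q T(2) by (auto simp: W0_def)
    moreover have "\<forall>y\<in>\<phi> ` (T \<inter> V) \<inter> \<phi> ` V. b (inv_into V \<phi> y) = 0"
    proof
      fix y assume "y \<in> \<phi> ` (T \<inter> V) \<inter> \<phi> ` V"
      then obtain x where "x \<in> T" "x \<in> V" "y = \<phi> x" by blast
      then show "b (inv_into V \<phi> y) = 0" using T(3) inv[of x] VD(2) by auto
    qed
    moreover have "\<phi> q \<in> W" using q by (simp add: W0_def)
    ultimately have "h (\<phi> q) = 0" using Wz by blast
    then show ?thesis using q by (simp add: k_def)
  qed
  moreover have "p \<in> W0" using V(2) W(2) by (simp add: W0_def)
  moreover have "W0 \<subseteq> U" using W0V VD(2) by blast
  ultimately show ?thesis using W0 by (intro exI[of _ W0] exI[of _ k]) blast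
qed

text \<open>
  The normalised local quotients agree on overlaps: where two of them differ, \<open>b\<close> vanishes on an open
  set, and there both are zero.
\<close>

lemma manifold_integral_quotient:
  assumes M: "complex_manifold n M" and U: "openin (topo M) U"
    and a: "a \<in> hol M U" and b: "b \<in> hol M U" and c: "\<And>i. i < m \<Longrightarrow> c i \<in> hol M U"
    and eq: "\<And>p. p \<in> U \<Longrightarrow> a p ^ m + (\<Sum>i<m. c i p * a p ^ i * b p ^ (m - i)) = 0"
  shows "\<exists>h\<in>hol M U. \<forall>p\<in>U. a p = b p * h p"
proof -
  have lm: "locally_modelled M" using M by (rule complex_manifold_locally_modelled)
  note sh = locally_modelled_sheaf[OF lm]
  define Q where "Q W h \<longleftrightarrow> openin (topo M) W \<and> W \<subseteq> U \<and> h \<in> hol M W \<and> (\<forall>q\<in>W. a q = b q * h q) \<and>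
    (\<forall>q\<in>W. \<forall>V. openin (topo M) V \<and> q \<in> V \<and> (\<forall>y\<in>V \<inter> U. b y = 0) \<longrightarrow> h q = 0)" for W h
  have QD: "openin (topo M) W" "W \<subseteq> U" "h \<in> hol M W" if "Q W h" for W h
    using that by (simp_all add: Q_def)
  have Q_quotient: "a q = b q * h q" if "Q W h" "q \<in> W" for W h q
    using that by (simp add: Q_def)
  have Q_zero: "h q = 0"
    if "Q W h" "q \<in> W" "openin (topo M) V" "q \<in> V" "\<forall>y\<in>V \<inter> U. b y = 0" for W h q V
    using that unfolding Q_def by blast
  have "\<forall>p\<in>U. \<exists>W h. p \<in> W \<and> Q W h"
  proof
    fix p assume p: "p \<in> U"
    have "\<exists>W h. openin (topo M) W \<and> p \<in> W \<and> W \<subseteq> U \<and> h \<in> hol M W \<and> (\<forall>q\<in>W. a q = b q * h q) \<and>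
      (\<forall>q\<in>W. \<forall>V. openin (topo M) V \<and> q \<in> V \<and> (\<forall>y\<in>V \<inter> U. b y = 0) \<longrightarrow> h q = 0)"
      by (rule manifold_integral_quotient_near[OF M U a b c eq p])
    then show "\<exists>W h. p \<in> W \<and> Q W h" unfolding Q_def by (elim exE conjE) (intro exI conjI)
  qed
  then obtain W k where Wk: "\<And>p. p \<in> U \<Longrightarrow> p \<in> W p \<and> Q (W p) (k p)" by metis
  have unique: "h p = h' p" if Q: "Q V h" "Q V' h'" and p: "p \<in> V" "p \<in> V'" for V V' h h' p
  proof (rule ccontr)
    assume neq: "h p \<noteq> h' p"
    have V: "openin (topo M) (V \<inter> V')" using QD(1)[OF Q(1)] QD(1)[OF Q(2)] by (rule openin_Int)
    have hV: "restrict h (V \<inter> V') \<in> hol M (V \<inter> V')" "restrict h' (V \<inter> V') \<in> hol M (V \<inter> V')"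
      using hol_restrict[OF sh QD(1)[OF Q(1)] QD(3)[OF Q(1)] V]
        hol_restrict[OF sh QD(1)[OF Q(2)] QD(3)[OF Q(2)] V] by auto
    define d where "d = (\<lambda>y\<in>V \<inter> V'. restrict h (V \<inter> V') y + (\<lambda>y\<in>V \<inter> V'. (\<lambda>y\<in>V \<inter> V'. -1) y * restrict h' (V \<inter> V') y) y)"
    have "d \<in> hol M (V \<inter> V')"
      unfolding d_def by (intro hol_add[OF lm V] hol_mult[OF lm V] hol_const[OF lm V] hV)
    from hol_nonzero_open[OF lm V this]
    have S: "openin (topo M) {y \<in> V \<inter> V'. d y \<noteq> 0}" .
    have d: "d y = h y - h' y" if "y \<in> V \<inter> V'" for y using that by (simp add: d_def)
    have pS: "p \<in> {y \<in> V \<inter> V'. d y \<noteq> 0}" using p neq by (simp add: d)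
    have bz: "\<forall>y\<in>{y \<in> V \<inter> V'. d y \<noteq> 0} \<inter> U. b y = 0"
    proof
      fix y assume "y \<in> {y \<in> V \<inter> V'. d y \<noteq> 0} \<inter> U"
      then have y: "y \<in> V" "y \<in> V'" "h y \<noteq> h' y" using d[of y] by auto
      then have "b y * h y = b y * h' y"
        using Q_quotient[OF Q(1) y(1)] Q_quotient[OF Q(2) y(2)] by simp
      then show "b y = 0" using y(3) by simp
    qed
    have "h p = 0" "h' p = 0"
      using Q_zero[OF Q(1) p(1) S pS bz] Q_zero[OF Q(2) p(2) S pS bz] by auto
    then show False using neq by simp
  qed
  define h where "h = (\<lambda>p\<in>U. k p p)"
  have hW: "restrict h (W p) = k p" if p: "p \<in> U" for p
  proof
    fix y
    note Qp = conjunct2[OF Wk[OF p]]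
    show "restrict h (W p) y = k p y"
    proof (cases "y \<in> W p")
      case True
      then have yU: "y \<in> U" using QD(2)[OF Qp] by blast
      have "k y y = k p y" using unique[OF _ Qp _ True] Wk[OF yU] by blast
      then show ?thesis using True yU by (simp add: h_def)
    next
      case False
      have "k p \<in> extensional (W p)" using hol_extensional[OF sh QD(1,3)[OF Qp]] .
      then show ?thesis using False by (simp add: extensional_def)
    qed
  qed
  have "h \<in> hol M U"
  proof (rule hol_glue[OF sh U])
    show "h \<in> extensional U" by (simp add: h_def)
    fix p assume p: "p \<in> U"
    show "\<exists>V. openin (topo M) V \<and> p \<in> V \<and> V \<subseteq> U \<and> restrict h V \<in> hol M V"
      using Wk[OF p] QD[OF conjunct2[OF Wk[OF p]]] by (intro exI[of _ "W p"]) (simp only: hW[OF p])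
  qed
  moreover have "a p = b p * h p" if p: "p \<in> U" for p
    using Q_quotient[OF conjunct2[OF Wk[OF p]] conjunct1[OF Wk[OF p]]] p by (simp add: h_def)
  ultimately show ?thesis by blast
qed

section \<open>Modules of holomorphic forms\<close>

lemma vector_tuples_update:
  "v \<in> vector_tuples n k \<Longrightarrow> j < k \<Longrightarrow> x \<in> coord_space n \<Longrightarrow> v(j := x) \<in> vector_tuples n k"
  unfolding vector_tuples_def by (auto simp: PiE_iff extensional_def)

lemma coord_space_combination:
  "x \<in> coord_space n \<Longrightarrow> y \<in> coord_space n \<Longrightarrow> (\<lambda>i. a * x i + b * y i) \<in> coord_space n"
  by (auto simp: coord_space_def)

lemma alternating_forms_scale:
  assumes "\<alpha> \<in> alternating_forms n k"
  shows "(\<lambda>v\<in>vector_tuples n k. c * \<alpha> v) \<in> alternating_forms n k"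
  using assms unfolding alternating_forms_def
  by (auto simp: vector_tuples_update coord_space_combination distrib_left mult.left_commute)

lemma differential_in_coord_space: "differential n F z v \<in> coord_space n"
  by (auto simp: differential_def coord_space_def)

lemma holomorphic_formsI:
  assumes "\<And>V \<phi> p. (V, \<phi>) \<in> charts n M U \<Longrightarrow> p \<in> V \<Longrightarrow> \<omega> (V, \<phi>) p \<in> alternating_forms n k"
    and "\<And>V \<phi>. (V, \<phi>) \<in> charts n M U \<Longrightarrow> \<omega> (V, \<phi>) \<in> extensional V"
    and "\<omega> \<in> extensional (charts n M U)"
    and "\<And>V \<phi> W \<psi> p v. (V, \<phi>) \<in> charts n M U \<Longrightarrow> (W, \<psi>) \<in> charts n M U \<Longrightarrow> p \<in> V \<inter> W \<Longrightarrow>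
      v \<in> vector_tuples n k \<Longrightarrow>
      \<omega> (V, \<phi>) p v = \<omega> (W, \<psi>) p (\<lambda>j\<in>{..<k}. differential n (\<psi> \<circ> inv_into V \<phi>) (\<phi> p) (v j))"
    and "\<And>V \<phi> v. (V, \<phi>) \<in> charts n M U \<Longrightarrow> v \<in> vector_tuples n k \<Longrightarrow>
      (\<lambda>p\<in>V. \<omega> (V, \<phi>) p v) \<in> hol M V"
  shows "\<omega> \<in> holomorphic_forms n k M U"
proof -
  have "\<omega> \<in> (\<Pi>\<^sub>E (V, \<phi>)\<in>charts n M U. \<Pi>\<^sub>E p\<in>V. alternating_forms n k)"
    using assms(1-3) by (auto simp: PiE_def)
  then show ?thesis
    unfolding holomorphic_forms_def
  proof (intro CollectI conjI)
    show "\<forall>(V, \<phi>)\<in>charts n M U. \<forall>(W, \<psi>)\<in>charts n M U. \<forall>p\<in>V \<inter> W. \<forall>v\<in>vector_tuples n k.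
        \<omega> (V, \<phi>) p v =
        \<omega> (W, \<psi>) p (\<lambda>j\<in>{..<k}. differential n (\<psi> \<circ> inv_into V \<phi>) (\<phi> p) (v j))"
      by (clarify, rule assms(4)) auto
    show "\<forall>(V, \<phi>)\<in>charts n M U. \<forall>v\<in>vector_tuples n k. (\<lambda>p\<in>V. \<omega> (V, \<phi>) p v) \<in> hol M V"
      by (clarify, rule assms(5))
  qed
qed

lemma holomorphic_formsD:
  assumes "\<omega> \<in> holomorphic_forms n k M U" "(V, \<phi>) \<in> charts n M U"
  shows "p \<in> V \<Longrightarrow> \<omega> (V, \<phi>) p \<in> alternating_forms n k"
    and "(W, \<psi>) \<in> charts n M U \<Longrightarrow> p \<in> V \<inter> W \<Longrightarrow> v \<in> vector_tuples n k \<Longrightarrow>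
      \<omega> (V, \<phi>) p v = \<omega> (W, \<psi>) p (\<lambda>j\<in>{..<k}. differential n (\<psi> \<circ> inv_into V \<phi>) (\<phi> p) (v j))"
    and "v \<in> vector_tuples n k \<Longrightarrow> (\<lambda>p\<in>V. \<omega> (V, \<phi>) p v) \<in> hol M V"
proof -
  note \<omega> = assms(1)[unfolded holomorphic_forms_def mem_Collect_eq]
  note 1 = conjunct1[OF \<omega>] and 2 = conjunct1[OF conjunct2[OF \<omega>]] and 3 = conjunct2[OF conjunct2[OF \<omega>]]
  show "\<omega> (V, \<phi>) p \<in> alternating_forms n k" if "p \<in> V"
    using PiE_mem[OF 1 assms(2)] that by (simp add: PiE_iff)
  show "\<omega> (V, \<phi>) p v = \<omega> (W, \<psi>) p (\<lambda>j\<in>{..<k}. differential n (\<psi> \<circ> inv_into V \<phi>) (\<phi> p) (v j))"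
    if "(W, \<psi>) \<in> charts n M U" "p \<in> V \<inter> W" "v \<in> vector_tuples n k"
    using bspec[OF 2 assms(2)] that by fast
  show "(\<lambda>p\<in>V. \<omega> (V, \<phi>) p v) \<in> hol M V" if "v \<in> vector_tuples n k"
    using bspec[OF 3 assms(2)] that by fast
qed

text \<open>
  The forms on \<open>U\<close> are a module over all holomorphic functions on \<open>U\<close>. For \<open>U\<close> the preimage of an open
  set of \<open>X\<close> this is the action on the canonical sheaf of functions that do not come from \<open>X\<close>.
\<close>

lemma holomorphic_forms_smult:
  assumes M: "locally_modelled M" and U: "openin (topo M) U"
    and h: "h \<in> hol M U" and \<omega>: "\<omega> \<in> holomorphic_forms n k M U"
  shows "h \<odot>\<^bsub>sections (form_sheaf n k M) U\<^esub> \<omega> \<in> holomorphic_forms n k M U"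
proof -
  define \<eta> where "\<eta> = h \<odot>\<^bsub>sections (form_sheaf n k M) U\<^esub> \<omega>"
  have \<eta>: "\<eta> (V, \<phi>) p = (\<lambda>v\<in>vector_tuples n k. h p * \<omega> (V, \<phi>) p v)"
    if "(V, \<phi>) \<in> charts n M U" "p \<in> V" for V \<phi> p
    using that by (simp add: \<eta>_def form_sheaf_def)
  have "\<eta> \<in> holomorphic_forms n k M U"
  proof (rule holomorphic_formsI)
    show "\<eta> (V, \<phi>) p \<in> alternating_forms n k" if c: "(V, \<phi>) \<in> charts n M U" "p \<in> V" for V \<phi> p
      unfolding \<eta>[OF c] by (rule alternating_forms_scale[OF holomorphic_formsD(1)[OF \<omega> c]])
    show "\<eta> (V, \<phi>) \<in> extensional V" if c: "(V, \<phi>) \<in> charts n M U" for V \<phi>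
      using that by (simp add: \<eta>_def form_sheaf_def)
    show "\<eta> \<in> extensional (charts n M U)" by (simp add: \<eta>_def form_sheaf_def)
    show "\<eta> (V, \<phi>) p v =
        \<eta> (W, \<psi>) p (\<lambda>j\<in>{..<k}. differential n (\<psi> \<circ> inv_into V \<phi>) (\<phi> p) (v j))"
      if c: "(V, \<phi>) \<in> charts n M U" "(W, \<psi>) \<in> charts n M U" and p: "p \<in> V \<inter> W"
        and v: "v \<in> vector_tuples n k" for V \<phi> W \<psi> p v
    proof -
      have "(\<lambda>j\<in>{..<k}. differential n (\<psi> \<circ> inv_into V \<phi>) (\<phi> p) (v j)) \<in> vector_tuples n k"
        by (simp add: vector_tuples_def differential_in_coord_space)
      then show ?thesis
        using holomorphic_formsD(2)[OF \<omega> c p v] \<eta>[OF c(1)] \<eta>[OF c(2)] p v by simp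
    qed
    show "(\<lambda>p\<in>V. \<eta> (V, \<phi>) p v) \<in> hol M V"
      if c: "(V, \<phi>) \<in> charts n M U" and v: "v \<in> vector_tuples n k" for V \<phi> v
    proof -
      note V = chartsD[OF c]
      have "(\<lambda>p\<in>V. restrict h V p * (\<lambda>p\<in>V. \<omega> (V, \<phi>) p v) p) \<in> hol M V"
        by (intro hol_mult[OF M V(1)] hol_restrict[OF locally_modelled_sheaf[OF M] U h V(1,2)]
            holomorphic_formsD(3)[OF \<omega> c v])
      moreover have "(\<lambda>p\<in>V. restrict h V p * (\<lambda>p\<in>V. \<omega> (V, \<phi>) p v) p) = (\<lambda>p\<in>V. \<eta> (V, \<phi>) p v)"
        using v by (intro restrict_ext) (simp add: \<eta>[OF c])
      ultimately show ?thesis by (simp only:)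
    qed
  qed
  then show ?thesis by (simp only: \<eta>_def)
qed

lemma form_smult_smult:
  fixes M :: "'a function_space"
  shows "f \<odot>\<^bsub>sections (form_sheaf n k M) U\<^esub> (g \<odot>\<^bsub>sections (form_sheaf n k M) U\<^esub> \<omega>) =
    (\<lambda>p\<in>U. f p * g p) \<odot>\<^bsub>sections (form_sheaf n k M) U\<^esub> \<omega>"
proof
  fix c :: "'a set \<times> ('a \<Rightarrow> nat \<Rightarrow> complex)"
  obtain V \<phi> where c: "c = (V, \<phi>)" by fastforce
  show "(f \<odot>\<^bsub>sections (form_sheaf n k M) U\<^esub> (g \<odot>\<^bsub>sections (form_sheaf n k M) U\<^esub> \<omega>)) c =
    ((\<lambda>p\<in>U. f p * g p) \<odot>\<^bsub>sections (form_sheaf n k M) U\<^esub> \<omega>) c"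
  proof (cases "(V, \<phi>) \<in> charts n M U")
    case True
    then have "V \<subseteq> U" by (rule chartsD)
    then show ?thesis using True unfolding c
      by (auto simp: form_sheaf_def fun_eq_iff mult.assoc)
  qed (simp add: c form_sheaf_def)
qed

section \<open>A nonzero form of top degree\<close>

definition determinant_form :: "nat \<Rightarrow> (nat \<Rightarrow> nat \<Rightarrow> complex) \<Rightarrow> complex" where
  "determinant_form n = (\<lambda>v\<in>vector_tuples n n.
     \<Sum>p | p permutes {..<n}. of_int (sign p) * (\<Prod>j<n. v j (p j)))"

lemma determinant_form_alternating: "determinant_form n \<in> alternating_forms n n"
proof -
  define D where "D v = (\<Sum>p | p permutes {..<n}. of_int (sign p) * (\<Prod>j<n. v j (p j)))"
    for v :: "nat \<Rightarrow> nat \<Rightarrow> complex"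
  have upd: "(\<Prod>i<n. (v(j := w)) i (p i)) = w (p j) * (\<Prod>i\<in>{..<n} - {j}. v i (p i))"
    if "j < n" for v :: "nat \<Rightarrow> nat \<Rightarrow> complex" and j w p
  proof -
    have "(\<Prod>i<n. (v(j := w)) i (p i)) = (v(j := w)) j (p j) * (\<Prod>i\<in>{..<n} - {j}. (v(j := w)) i (p i))"
      using that by (intro prod.remove) auto
    also have "(\<Prod>i\<in>{..<n} - {j}. (v(j := w)) i (p i)) = (\<Prod>i\<in>{..<n} - {j}. v i (p i))"
      by (intro prod.cong) auto
    finally show ?thesis by simp
  qed
  have linear: "D (v(j := (\<lambda>i. a * x i + b * y i))) = a * D (v(j := x)) + b * D (v(j := y))"
    if "j < n" for v j x y a b
    unfolding D_def upd[OF that] sum_distrib_left sum.distrib[symmetric]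
    by (intro sum.cong) (simp_all add: algebra_simps)
  have alt: "D v = 0" if jl: "j < n" "l < n" "j \<noteq> l" "v j = v l" for v j l
  proof -
    \<comment> \<open>Composition with the transposition of \<open>j\<close> and \<open>l\<close> changes the sign of each summand.\<close>
    let ?\<tau> = "Transposition.transpose j l"
    have \<tau>: "?\<tau> permutes {..<n}" using jl by (simp add: permutes_swap_id)
    have swap: "of_int (sign (p \<circ> ?\<tau>)) * (\<Prod>i<n. v i ((p \<circ> ?\<tau>) i)) =
        - (of_int (sign p) * (\<Prod>i<n. v i (p i)))" if p: "p permutes {..<n}" for p
    proof -
      have "sign (p \<circ> ?\<tau>) = sign p * sign ?\<tau>"
        using p \<tau> permutes_imp_permutation by (intro sign_compose) auto
      then have s: "sign (p \<circ> ?\<tau>) = - sign p" using jl by (simp add: sign_swap_id)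
      have "(\<Prod>i<n. v i (p i)) = (\<Prod>i<n. v (?\<tau> i) (p (?\<tau> i)))"
        using prod.permute[OF \<tau>, of "\<lambda>i. v i (p i)"] by (simp add: o_def)
      also have "\<dots> = (\<Prod>i<n. v i ((p \<circ> ?\<tau>) i))"
        using jl(4) by (intro prod.cong) (auto simp: Transposition.transpose_def)
      finally show ?thesis using s by simp
    qed
    have "D v = (\<Sum>p | p permutes {..<n}. of_int (sign (p \<circ> ?\<tau>)) * (\<Prod>i<n. v i ((p \<circ> ?\<tau>) i)))"
      unfolding D_def by (rule sum_permutations_compose_right[OF \<tau>])
    also have "\<dots> = (\<Sum>p | p permutes {..<n}. - (of_int (sign p) * (\<Prod>i<n. v i (p i))))"
      by (intro sum.cong swap) auto
    also have "\<dots> = - D v" by (simp add: D_def sum_negf)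
    finally show "D v = 0" by simp
  qed
  have D: "determinant_form n = restrict D (vector_tuples n n)"
    by (simp add: determinant_form_def D_def[abs_def])
  show ?thesis
    unfolding alternating_forms_def D
    using linear alt by (auto simp: vector_tuples_update coord_space_combination)
qed

definition standard_basis :: "nat \<Rightarrow> nat \<Rightarrow> nat \<Rightarrow> complex" where
  "standard_basis n = (\<lambda>j\<in>{..<n}. \<lambda>i. if i = j then 1 else 0)"

lemma standard_basis_in_vector_tuples: "standard_basis n \<in> vector_tuples n n"
  by (auto simp: standard_basis_def vector_tuples_def coord_space_def)

lemma determinant_form_standard_basis: "determinant_form n (standard_basis n) = 1"
proof -
  have prod: "(\<Prod>j<n. standard_basis n j (p j)) = (if p = id then 1 else 0)"
    if p: "p permutes {..<n}" for p
  proof (cases "p = id")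
    case False
    then obtain j where "p j \<noteq> j" by (auto simp: fun_eq_iff)
    then have "j \<in> {..<n}" using p unfolding permutes_def by blast
    then have "(\<Prod>j<n. standard_basis n j (p j)) = 0"
      using \<open>p j \<noteq> j\<close> by (intro prod_zero) (auto simp: standard_basis_def)
    then show ?thesis using False by simp
  qed (simp add: standard_basis_def)
  have "determinant_form n (standard_basis n) =
      (\<Sum>p | p permutes {..<n}. of_int (sign p) * (\<Prod>j<n. standard_basis n j (p j)))"
    by (simp add: determinant_form_def standard_basis_in_vector_tuples)
  also have "\<dots> = (\<Sum>p | p permutes {..<n}. if p = id then 1 else 0)"
    by (intro sum.cong) (auto simp: prod)
  also have "\<dots> = 1"
    by (simp add: finite_permutations permutes_id)
  finally show ?thesis .
qed

lemma differential_eq_partial: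
  "differential n F z v = (\<lambda>i. if i < n then \<Sum>l<n. partial l (\<lambda>w. F w i) z * v l else 0)"
  unfolding differential_def partial_def ..

lemma partial_cong:
  assumes E: "openin (coord_top n) E" and z: "z \<in> E" and l: "l < n"
    and eq: "\<And>w. w \<in> E \<Longrightarrow> f w = g w"
  shows "partial l f z = partial l g z"
  unfolding partial_def
proof (rule deriv_cong_ev[OF _ refl])
  have zn: "z \<in> coord_space n" using z E openin_coord_subset by blast
  have "\<forall>\<^sub>F t in nhds (z l). t \<in> {t. z(l := t) \<in> E}"
    by (rule eventually_nhds_in_open[OF open_slice[OF E zn l]]) (simp add: z)
  then show "\<forall>\<^sub>F t in nhds (z l). f (z(l := t)) = g (z(l := t))"
    by eventually_elim (use eq in auto)
qed

lemma partial_coordinate: "partial l (\<lambda>w. w i) z = (if l = i then 1 else 0)"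
  by (auto simp: partial_def)

lemma differential_cong:
  assumes "openin (coord_top n) E" "z \<in> E" "\<And>w. w \<in> E \<Longrightarrow> F w = G w"
  shows "differential n F z v = differential n G z v"
proof -
  have "partial l (\<lambda>w. F w i) z = partial l (\<lambda>w. G w i) z" if "l < n" for l i
    by (rule partial_cong[OF assms(1,2) that]) (simp add: assms(3))
  then have "(\<Sum>l<n. partial l (\<lambda>w. F w i) z * v l) = (\<Sum>l<n. partial l (\<lambda>w. G w i) z * v l)" for i
    by simp
  then show ?thesis unfolding differential_eq_partial by (intro ext if_cong refl)
qed

lemma differential_identity:
  assumes "openin (coord_top n) E" "z \<in> E" "\<And>w. w \<in> E \<Longrightarrow> F w = w" "v \<in> coord_space n"
  shows "differential n F z v = v"
proof -
  have "differential n F z v = differential n (\<lambda>w. w) z v"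
    by (rule differential_cong[OF assms(1-3)])
  also have "\<dots> = v"
    using assms(4) by (auto simp: differential_eq_partial partial_coordinate coord_space_def
        if_distrib[of "\<lambda>x. x * _"] fun_eq_iff cong: if_cong)
  finally show ?thesis .
qed

lemma differential_compose:
  assumes F: "\<And>i. i < n \<Longrightarrow> several_holomorphic n D (\<lambda>w. F w i)"
    and G: "\<And>i. i < n \<Longrightarrow> several_holomorphic n E (\<lambda>w. G w i)"
    and E: "openin (coord_top n) E" "z \<in> E" and GD: "\<And>w. w \<in> E \<Longrightarrow> G w \<in> D"
  shows "differential n (\<lambda>w. F (G w)) z v = differential n F (G z) (differential n G z v)"
proof
  fix i
  show "differential n (\<lambda>w. F (G w)) z v i = differential n F (G z) (differential n G z v) i"
  proof (cases "i < n")
    case i: True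
    have "partial l (\<lambda>w. F (G w) i) z = (\<Sum>k<n. partial k (\<lambda>w. F w i) (G z) * partial l (\<lambda>w. G w k) z)"
      if "l < n" for l
      by (rule partial_compose[OF F[OF i] E(1) GD G E(2) that])
    then have "(\<Sum>l<n. partial l (\<lambda>w. F (G w) i) z * v l) =
        (\<Sum>l<n. \<Sum>k<n. partial k (\<lambda>w. F w i) (G z) * partial l (\<lambda>w. G w k) z * v l)"
      by (simp add: sum_distrib_right)
    also have "\<dots> = (\<Sum>k<n. \<Sum>l<n. partial k (\<lambda>w. F w i) (G z) * partial l (\<lambda>w. G w k) z * v l)"
      by (rule sum.swap)
    also have "\<dots> = (\<Sum>k<n. partial k (\<lambda>w. F w i) (G z) * (\<Sum>l<n. partial l (\<lambda>w. G w k) z * v l))"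
      by (simp add: sum_distrib_left mult.assoc)
    finally show ?thesis using i by (simp add: differential_eq_partial)
  qed (simp add: differential_eq_partial)
qed

lemma transition_map_holomorphic:
  assumes M: "function_sheaf M" and c: "(V, \<phi>) \<in> charts n M S" "(W, \<psi>) \<in> charts n M T"
  shows "several_holomorphic n (\<phi> ` (V \<inter> W)) (\<lambda>z. (\<psi> \<circ> inv_into V \<phi>) z i)"
proof -
  note V = chartsD[OF c(1)] and W = chartsD[OF c(2)]
  have VW: "openin (topo M) (V \<inter> W)" using V(1) W(1) by (rule openin_Int)
  have "(\<lambda>p\<in>V \<inter> W. \<psi> p i) \<in> hol M (V \<inter> W)"
    by (rule hol_of_chart[OF M c(2) VW _ several_holomorphic_coordinate[OF W(3)]]) auto
  from hol_in_chart[OF M c(1) VW _ this]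
  have "several_holomorphic n (\<phi> ` (V \<inter> W)) (\<lambda>z. (\<lambda>p\<in>V \<inter> W. \<psi> p i) (inv_into V \<phi> z))" by simp
  then show ?thesis
  proof (rule several_holomorphic_cong)
    fix z assume "z \<in> \<phi> ` (V \<inter> W)"
    then obtain p where "p \<in> V \<inter> W" "z = \<phi> p" by blast
    then show "(\<lambda>p\<in>V \<inter> W. \<psi> p i) (inv_into V \<phi> z) = (\<psi> \<circ> inv_into V \<phi>) z i"
      using chart_inj[OF c(1)] by (simp add: inv_into_f_f)
  qed
qed

text \<open>
  The form \<open>dz\<^sub>1 \<and> \<dots> \<and> dz\<^sub>n\<close> of the chart \<open>\<kappa>\<close>. Its expression in another chart \<open>\<phi>\<close> is the determinant
  composed with the differential of \<open>\<kappa> \<circ> \<phi>\<^bsup>-1\<^esup>\<close>; the chain rule makes these expressions compatible,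
  and their coefficients are polynomials in partial derivatives, hence holomorphic.
\<close>

lemma nonzero_form_on_chart:
  assumes M: "locally_modelled M" and c0: "(U, \<kappa>) \<in> charts n M U" and p0: "p0 \<in> U"
  obtains \<omega> where "\<omega> \<in> holomorphic_forms n n M U" "\<omega> (U, \<kappa>) p0 (standard_basis n) = 1"
proof -
  note sh = locally_modelled_sheaf[OF M]
  note U = chartsD[OF c0]
  define J where "J V \<phi> p v = (\<lambda>j\<in>{..<n}. differential n (\<kappa> \<circ> inv_into V \<phi>) (\<phi> p) (v j))"
    for V and \<phi> :: "'a \<Rightarrow> nat \<Rightarrow> complex" and p and v :: "nat \<Rightarrow> nat \<Rightarrow> complex"
  have J: "J V \<phi> p v \<in> vector_tuples n n" for V \<phi> p v
    by (simp add: J_def vector_tuples_def differential_in_coord_space)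
  define \<omega> where "\<omega> = (\<lambda>(V, \<phi>)\<in>charts n M U. \<lambda>p\<in>V. \<lambda>v\<in>vector_tuples n n. determinant_form n (J V \<phi> p v))"
  have \<omega>: "\<omega> (V, \<phi>) p = (\<lambda>v\<in>vector_tuples n n. determinant_form n (J V \<phi> p v))"
    if "(V, \<phi>) \<in> charts n M U" "p \<in> V" for V \<phi> p
    using that by (simp add: \<omega>_def)
  have dlin: "differential n F z (\<lambda>i. a * x i + b * y i) =
      (\<lambda>i. a * differential n F z x i + b * differential n F z y i)" for F z a x b y
    by (auto simp: differential_def fun_eq_iff algebra_simps sum.distrib sum_distrib_left)
  have Jupd: "J V \<phi> p (v(j := x)) = (J V \<phi> p v)(j := differential n (\<kappa> \<circ> inv_into V \<phi>) (\<phi> p) x)"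
    if "j < n" for V \<phi> p v j x
    using that by (auto simp: J_def fun_eq_iff)
  have det: "determinant_form n \<in> extensional (vector_tuples n n)"
    and det_lin: "\<And>v j x y a b. v \<in> vector_tuples n n \<Longrightarrow> j < n \<Longrightarrow> x \<in> coord_space n \<Longrightarrow> y \<in> coord_space n \<Longrightarrow>
      determinant_form n (v(j := (\<lambda>i. a * x i + b * y i))) =
      a * determinant_form n (v(j := x)) + b * determinant_form n (v(j := y))"
    and det_alt: "\<And>v j l. v \<in> vector_tuples n n \<Longrightarrow> j < n \<Longrightarrow> l < n \<Longrightarrow> j \<noteq> l \<Longrightarrow> v j = v l \<Longrightarrow> determinant_form n v = 0"
    using determinant_form_alternating[of n] unfolding alternating_forms_def by blast+
  have alt: "\<omega> (V, \<phi>) p \<in> alternating_forms n n" if c: "(V, \<phi>) \<in> charts n M U" "p \<in> V" for V \<phi> p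
    unfolding alternating_forms_def \<omega>[OF c]
  proof (intro CollectI conjI ballI allI impI)
    fix v j x y a b
    assume "v \<in> vector_tuples n n" "j < n" "x \<in> coord_space n" "y \<in> coord_space n"
    then show "(\<lambda>v\<in>vector_tuples n n. determinant_form n (J V \<phi> p v)) (v(j := (\<lambda>i. a * x i + b * y i))) =
        a * (\<lambda>v\<in>vector_tuples n n. determinant_form n (J V \<phi> p v)) (v(j := x)) +
        b * (\<lambda>v\<in>vector_tuples n n. determinant_form n (J V \<phi> p v)) (v(j := y))"
      by (simp add: vector_tuples_update coord_space_combination Jupd dlin det_lin[OF J]
          differential_in_coord_space)
  next
    fix v j l assume "v \<in> vector_tuples n n" "j < n" "l < n" "j \<noteq> l \<and> v j = v l"
    then show "(\<lambda>v\<in>vector_tuples n n. determinant_form n (J V \<phi> p v)) v = 0"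
      using det_alt[OF J, of j l] by (simp add: J_def)
  qed simp
  have compatible: "\<omega> (V, \<phi>) p v =
      \<omega> (W, \<psi>) p (\<lambda>j\<in>{..<n}. differential n (\<psi> \<circ> inv_into V \<phi>) (\<phi> p) (v j))"
    if c: "(V, \<phi>) \<in> charts n M U" "(W, \<psi>) \<in> charts n M U" and p: "p \<in> V \<inter> W"
      and v: "v \<in> vector_tuples n n" for V \<phi> W \<psi> p v
  proof -
    note V = chartsD[OF c(1)] and W = chartsD[OF c(2)]
    have E: "openin (coord_top n) (\<phi> ` (V \<inter> W))"
      by (rule chart_image_open[OF c(1) openin_Int[OF V(1) W(1)]]) simp
    have zE: "\<phi> p \<in> \<phi> ` (V \<inter> W)" using p by blast
    have inv: "inv_into V \<phi> (\<phi> q) = q" if "q \<in> V" for q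
      using chart_inj[OF c(1)] that by (rule inv_into_f_f)
    have inv': "inv_into W \<psi> (\<psi> q) = q" if "q \<in> W" for q
      using chart_inj[OF c(2)] that by (rule inv_into_f_f)
    have WU: "W \<inter> U = W" using W(2) by blast
    have chain: "differential n (\<kappa> \<circ> inv_into V \<phi>) (\<phi> p) u =
        differential n (\<kappa> \<circ> inv_into W \<psi>) (\<psi> p) (differential n (\<psi> \<circ> inv_into V \<phi>) (\<phi> p) u)" for u
    proof -
      have "differential n (\<kappa> \<circ> inv_into V \<phi>) (\<phi> p) u =
          differential n (\<lambda>w. (\<kappa> \<circ> inv_into W \<psi>) ((\<psi> \<circ> inv_into V \<phi>) w)) (\<phi> p) u"
        by (rule differential_cong[OF E zE]) (auto simp: inv inv')
      also have "\<dots> = differential n (\<kappa> \<circ> inv_into W \<psi>) ((\<psi> \<circ> inv_into V \<phi>) (\<phi> p))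
          (differential n (\<psi> \<circ> inv_into V \<phi>) (\<phi> p) u)"
      proof (rule differential_compose[OF _ _ E zE])
        show "several_holomorphic n (\<psi> ` W) (\<lambda>w. (\<kappa> \<circ> inv_into W \<psi>) w i)" for i
          using transition_map_holomorphic[OF sh c(2) c0, of i] WU by simp
        show "several_holomorphic n (\<phi> ` (V \<inter> W)) (\<lambda>w. (\<psi> \<circ> inv_into V \<phi>) w i)" for i
          by (rule transition_map_holomorphic[OF sh c])
        show "(\<psi> \<circ> inv_into V \<phi>) w \<in> \<psi> ` W" if "w \<in> \<phi> ` (V \<inter> W)" for w
          using that by (auto simp: inv)
      qed
      finally show ?thesis using p by (simp add: inv)
    qed
    let ?w = "\<lambda>j\<in>{..<n}. differential n (\<psi> \<circ> inv_into V \<phi>) (\<phi> p) (v j)"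
    have "?w \<in> vector_tuples n n" by (simp add: vector_tuples_def differential_in_coord_space)
    moreover have "J V \<phi> p v = J W \<psi> p ?w"
      unfolding J_def by (rule restrict_ext) (simp add: chain)
    ultimately show ?thesis using \<omega>[OF c(1)] \<omega>[OF c(2)] p v by simp
  qed
  have holomorphic: "(\<lambda>p\<in>V. \<omega> (V, \<phi>) p v) \<in> hol M V"
    if c: "(V, \<phi>) \<in> charts n M U" and v: "v \<in> vector_tuples n n" for V \<phi> v
  proof -
    note V = chartsD[OF c]
    have VU: "V \<inter> U = V" using V(2) by blast
    define H where "H z = (\<Sum>p | p permutes {..<n}. of_int (sign p) *
      (\<Prod>j<n. \<Sum>l<n. partial l (\<lambda>w. (\<kappa> \<circ> inv_into V \<phi>) w (p j)) z * v j l))" for z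
    have tr: "several_holomorphic n (\<phi> ` V) (\<lambda>w. (\<kappa> \<circ> inv_into V \<phi>) w i)" for i
      using transition_map_holomorphic[OF sh c c0, of i] VU by simp
    have "several_holomorphic n (\<phi> ` V) H"
      unfolding H_def
      by (intro several_holomorphic_sum several_holomorphic_prod several_holomorphic_mult
          several_holomorphic_const V(3) several_holomorphic_partial_derivative tr) auto
    from hol_of_chart[OF sh c V(1) order_refl this order_refl]
    have "(\<lambda>p\<in>V. H (\<phi> p)) \<in> hol M V" .
    moreover have "\<omega> (V, \<phi>) p v = H (\<phi> p)" if p: "p \<in> V" for p
    proof -
      have "\<omega> (V, \<phi>) p v = (\<Sum>q | q permutes {..<n}. of_int (sign q) * (\<Prod>j<n. J V \<phi> p v j (q j)))"
        using \<omega>[OF c p] v J by (simp add: determinant_form_def)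
      also have "\<dots> = H (\<phi> p)"
        unfolding H_def
      proof (intro sum.cong refl arg_cong2[where f = "(*)"] prod.cong)
        fix q j assume "q \<in> {q. q permutes {..<n}}" "j \<in> {..<n}"
        then have "q j < n" "j < n" using permutes_in_image[of q "{..<n}" j] by auto
        then show "J V \<phi> p v j (q j) = (\<Sum>l<n. partial l (\<lambda>w. (\<kappa> \<circ> inv_into V \<phi>) w (q j)) (\<phi> p) * v j l)"
          by (simp add: J_def differential_eq_partial)
      qed
      finally show ?thesis .
    qed
    then have "(\<lambda>p\<in>V. \<omega> (V, \<phi>) p v) = (\<lambda>p\<in>V. H (\<phi> p))" by (intro restrict_ext)
    ultimately show ?thesis by (simp only:)
  qed
  have "\<omega> \<in> holomorphic_forms n n M U"
    by (rule holomorphic_formsI[OF alt _ _ compatible holomorphic]) (simp_all add: \<omega>_def extensional_def)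
  moreover have "\<omega> (U, \<kappa>) p0 (standard_basis n) = 1"
  proof -
    have inv: "inv_into U \<kappa> (\<kappa> q) = q" if "q \<in> U" for q
      using chart_inj[OF c0] that by (rule inv_into_f_f)
    have "differential n (\<kappa> \<circ> inv_into U \<kappa>) (\<kappa> p0) u = u" if "u \<in> coord_space n" for u
      by (rule differential_identity[OF U(3) _ _ that]) (use p0 in \<open>auto simp: inv\<close>)
    then have "J U \<kappa> p0 (standard_basis n) = standard_basis n"
      by (auto simp: J_def standard_basis_def coord_space_def fun_eq_iff)
    then show ?thesis
      using \<omega>[OF c0 p0] standard_basis_in_vector_tuples determinant_form_standard_basis by simp
  qed
  ultimately show thesis by (rule that)
qed

section \<open>The canonical sheaf\<close>

lemma sections_GR:
  "carrier (sections (GR_canonical_sheaf n M \<pi>) U) = holomorphic_forms n n M (preimage M \<pi> U)"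
  "f \<odot>\<^bsub>sections (GR_canonical_sheaf n M \<pi>) U\<^esub> \<omega> =
    (\<lambda>p\<in>preimage M \<pi> U. f (\<pi> p)) \<odot>\<^bsub>sections (form_sheaf n n M) (preimage M \<pi> U)\<^esub> \<omega>"
  by (simp_all add: GR_canonical_sheaf_def pushforward_def Let_def form_sheaf_def)

lemma sections_free_sheaf:
  "carrier (sections (free_sheaf X r) U) = (\<Pi>\<^sub>E i\<in>{..<r}. hol X U)"
  "f \<odot>\<^bsub>sections (free_sheaf X r) U\<^esub> s = (\<lambda>i\<in>{..<r}. \<lambda>x\<in>U. f x * s i x)"
  by (simp_all add: free_sheaf_def)

lemma preimage_open:
  assumes "continuous_map (topo M) (topo X) \<pi>" "openin (topo X) U"
  shows "openin (topo M) (preimage M \<pi> U)"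
  unfolding preimage_def using assms by (rule openin_continuous_map_preimage)

text \<open>
  The preimage of \<open>U\<close> is a nonempty open set and so is not contained in the preimage of the centre, which
  has empty interior. Around a point outside, a chart domain \<open>C\<close> maps isomorphically to an open set
  \<open>V\<close> of \<open>X\<close> with preimage \<open>C\<close>. The second section is the zero form, obtained as a multiple of
  the first.
\<close>

lemma GR_nonzero_section:
  assumes X: "locally_modelled X" and res: "resolution n X M \<pi>"
    and U: "openin (topo X) U" "U \<noteq> {}"
  obtains V \<omega> \<eta> where "openin (topo X) V" "V \<subseteq> U"
    "\<omega> \<in> holomorphic_forms n n M (preimage M \<pi> V)" "\<eta> \<in> holomorphic_forms n n M (preimage M \<pi> V)" "\<omega> \<noteq> \<eta>"
proof -
  have M: "complex_manifold n M" and cont: "continuous_map (topo M) (topo X) \<pi>"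
    and surj: "\<pi> ` points M = points X"
    using res by (simp_all add: resolution_def holomorphic_map_def)
  have lm: "locally_modelled M" using M by (rule complex_manifold_locally_modelled)
  obtain A where A: "analytic_subset X A" "topo M interior_of (preimage M \<pi> A) = {}"
    "biholomorphic (open_subspace M (points M - preimage M \<pi> A)) (open_subspace X (points X - A)) \<pi>"
    using res unfolding resolution_def by (elim exE conjE)
  define M' where "M' = points M - preimage M \<pi> A"
  define X' where "X' = points X - A"
  have Acl: "closedin (topo X) A" by (rule analytic_subset_closed[OF X A(1)])
  then have X': "openin (topo X) X'" by (simp add: X'_def closedin_def)
  have "M' = preimage M \<pi> X'"
    using continuous_map_image_subset_topspace[OF cont] by (auto simp: M'_def X'_def preimage_def)
  then have M': "openin (topo M) M'" using preimage_open[OF cont X'] by simp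
  obtain g where g: "holomorphic_map (open_subspace X X') (open_subspace M M') g"
    "\<And>p. p \<in> M' \<Longrightarrow> g (\<pi> p) = p" "\<And>x. x \<in> X' \<Longrightarrow> \<pi> (g x) = x"
    using A(3) points_open_subspace[OF X'] points_open_subspace[OF M']
    unfolding biholomorphic_def M'_def[symmetric] X'_def[symmetric] by metis
  have contg: "continuous_map (topo (open_subspace X X')) (topo (open_subspace M M')) g"
    using g(1) by (simp add: holomorphic_map_def)
  have PU: "openin (topo M) (preimage M \<pi> U)" by (rule preimage_open[OF cont U(1)])
  have "preimage M \<pi> U \<noteq> {}"
  proof -
    obtain x where "x \<in> U" using U(2) by blast
    then have "x \<in> \<pi> ` points M" using openin_subset[OF U(1)] surj by blast
    then show ?thesis using \<open>x \<in> U\<close> by (auto simp: preimage_def)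
  qed
  then have "\<not> preimage M \<pi> U \<subseteq> preimage M \<pi> A"
    using A(2) interior_of_maximal[OF _ PU] by blast
  then obtain p where "p \<in> preimage M \<pi> U" "p \<notin> preimage M \<pi> A" by blast
  then have p: "p \<in> preimage M \<pi> U \<inter> M'" by (auto simp: M'_def preimage_def)
  obtain C \<kappa> where C: "(C, \<kappa>) \<in> charts n M (preimage M \<pi> U \<inter> M')" "p \<in> C"
    by (rule chart_at[OF M openin_Int[OF PU M'] p])
  note CD = chartsD[OF C(1)]
  define V where "V = {x \<in> X'. g x \<in> C}"
  have "openin (topo (open_subspace M M')) C"
    using CD(1,2) openin_open_subspace[OF M'] by blast
  from openin_continuous_map_preimage[OF contg this]
  have V: "openin (topo X) V"
    using openin_open_subspace[OF X'] points_open_subspace[OF X'] by (simp add: V_def)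
  have inX': "\<pi> q \<in> X'" if "q \<in> M'" for q
    using that \<open>M' = preimage M \<pi> X'\<close> by (simp add: preimage_def)
  have PV: "preimage M \<pi> V = C"
  proof (intro equalityI subsetI)
    fix q assume "q \<in> preimage M \<pi> V"
    then have q: "q \<in> points M" "\<pi> q \<in> X'" "g (\<pi> q) \<in> C" by (auto simp: preimage_def V_def)
    then have "q \<in> M'" using \<open>M' = preimage M \<pi> X'\<close> by (simp add: preimage_def)
    then show "q \<in> C" using g(2) q(3) by simp
  next
    fix q assume q: "q \<in> C"
    then have "q \<in> M'" using CD(2) by blast
    then show "q \<in> preimage M \<pi> V"
      using q inX' g(2) by (simp add: preimage_def V_def) (simp add: M'_def)
  qed
  have "V \<subseteq> U"
  proof
    fix x assume "x \<in> V"
    then have x: "x \<in> X'" "g x \<in> C" by (auto simp: V_def)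
    then have "g x \<in> preimage M \<pi> U" using CD(2) by blast
    then show "x \<in> U" using g(3)[OF x(1)] by (simp add: preimage_def)
  qed
  have c0: "(C, \<kappa>) \<in> charts n M C"
    by (rule charts_restrict[OF C(1) CD(1)]) auto
  obtain \<omega> where \<omega>: "\<omega> \<in> holomorphic_forms n n M C" "\<omega> (C, \<kappa>) p (standard_basis n) = 1"
    by (rule nonzero_form_on_chart[OF lm c0 C(2)])
  define \<eta> where "\<eta> = (\<lambda>q\<in>C. 0) \<odot>\<^bsub>sections (form_sheaf n n M) C\<^esub> \<omega>"
  have "\<eta> \<in> holomorphic_forms n n M C"
    unfolding \<eta>_def by (rule holomorphic_forms_smult[OF lm CD(1) hol_const[OF lm CD(1)] \<omega>(1)])
  moreover have "\<eta> (C, \<kappa>) p (standard_basis n) = 0"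
    using c0 C(2) standard_basis_in_vector_tuples by (simp add: \<eta>_def form_sheaf_def)
  then have "\<omega> \<noteq> \<eta>" using \<omega>(2) by auto
  ultimately show thesis
    using that[of V \<omega> \<eta>] V \<open>V \<subseteq> U\<close> \<omega>(1) unfolding PV by blast
qed

lemma GR_locally_free_rank_pos:
  assumes X: "locally_modelled X" and res: "resolution n X M \<pi>"
    and U: "openin (topo X) U" "U \<noteq> {}"
    and iso: "sheaf_iso_on X U (free_sheaf X r) (GR_canonical_sheaf n M \<pi>) \<Phi>"
  shows "0 < r"
proof (rule ccontr)
  assume "\<not> 0 < r"
  then have r: "r = 0" by simp
  obtain V \<omega> \<eta> where V: "openin (topo X) V" "V \<subseteq> U"
    and forms: "\<omega> \<in> holomorphic_forms n n M (preimage M \<pi> V)" "\<eta> \<in> holomorphic_forms n n M (preimage M \<pi> V)"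
    and neq: "\<omega> \<noteq> \<eta>"
    by (rule GR_nonzero_section[OF X res U])
  have "bij_betw (\<Phi> V) (carrier (sections (free_sheaf X r) V)) (carrier (sections (GR_canonical_sheaf n M \<pi>) V))"
    using iso V unfolding sheaf_iso_on_def by blast
  then have "bij_betw (\<Phi> V) {\<lambda>_. undefined} (holomorphic_forms n n M (preimage M \<pi> V))"
    by (simp add: sections_free_sheaf sections_GR r)
  then have "holomorphic_forms n n M (preimage M \<pi> V) = {\<Phi> V (\<lambda>_. undefined)}"
    by (auto simp: bij_betw_def)
  then show False using forms neq by simp
qed

text \<open>
  The sections of \<open>K\<close> are multiplied by the quotient \<open>h\<close> of \<open>a\<close> by \<open>b\<close>, which exists on \<open>M\<close>, and the
  product is read off in a local basis of \<open>K\<close> over \<open>X\<close>.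
\<close>

lemma locally_free_GR_stalk_integrally_closed:
  fixes X :: "'a function_space" and M :: "'b function_space"
  assumes X: "locally_modelled X" and res: "resolution n X M \<pi>"
    and free: "locally_free X (GR_canonical_sheaf n M \<pi>)" and x: "x \<in> points X"
  shows "integrally_closed (stalk X x)"
proof (rule stalk_integrally_closedI[OF X x])
  fix O' a b and m :: nat and c
  assume O': "openin (topo X) O'" "x \<in> O'" and a: "a \<in> hol X O'" and b: "b \<in> hol X O'"
    and c: "\<And>i. i < m \<Longrightarrow> c i \<in> hol X O'"
    and eq: "\<And>y. y \<in> O' \<Longrightarrow> a y ^ m + (\<Sum>i<m. c i y * a y ^ i * b y ^ (m - i)) = 0"
  have M: "complex_manifold n M" and \<pi>: "holomorphic_map M X \<pi>"
    using res by (simp_all add: resolution_def)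
  have cont: "continuous_map (topo M) (topo X) \<pi>" using \<pi> by (simp add: holomorphic_map_def)
  have lm: "locally_modelled M" using M by (rule complex_manifold_locally_modelled)
  note sh = locally_modelled_sheaf[OF X]
  obtain U r \<Phi> where U: "openin (topo X) U" "x \<in> U"
    and iso: "sheaf_iso_on X U (free_sheaf X r) (GR_canonical_sheaf n M \<pi>) \<Phi>"
    using free x unfolding locally_free_def by blast
  have r: "0 < r" by (rule GR_locally_free_rank_pos[OF X res U(1) _ iso]) (use U(2) in blast)
  define W where "W = O' \<inter> U"
  have W: "openin (topo X) W" "x \<in> W" "W \<subseteq> O'" "W \<subseteq> U" using O' U by (auto simp: W_def)
  define P where "P = preimage M \<pi> W"
  have P: "openin (topo M) P" unfolding P_def by (rule preimage_open[OF cont W(1)])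
  have PW: "\<pi> p \<in> W" if "p \<in> P" for p using that by (simp add: P_def preimage_def)
  define pull where "pull f = (\<lambda>p\<in>P. restrict f W (\<pi> p))" for f :: "'a \<Rightarrow> complex"
  have res_hol: "restrict f W \<in> hol X W" if "f \<in> hol X O'" for f
    by (rule hol_restrict[OF sh O'(1) that W(1,3)])
  have pull: "pull f \<in> hol M P" if "f \<in> hol X O'" for f
    unfolding pull_def P_def by (rule holomorphic_map_pullback[OF \<pi> W(1) res_hol[OF that]])
  have pull_apply: "pull f p = f (\<pi> p)" if "p \<in> P" for f p
    using that PW[OF that] by (simp add: pull_def)
  have "pull a p ^ m + (\<Sum>i<m. pull (c i) p * pull a p ^ i * pull b p ^ (m - i)) = 0" if "p \<in> P" for p
    using eq[of "\<pi> p"] PW[OF that] W(3) that by (simp add: pull_apply subset_iff)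
  from manifold_integral_quotient[OF M P pull[OF a] pull[OF b] pull[OF c] this]
  obtain h where h: "h \<in> hol M P" "\<And>p. p \<in> P \<Longrightarrow> pull a p = pull b p * h p" by blast
  let ?F = "sections (free_sheaf X r) W" and ?K = "sections (GR_canonical_sheaf n M \<pi>) W"
  let ?S = "sections (form_sheaf n n M) P"
  have bij: "bij_betw (\<Phi> W) (carrier ?F) (carrier ?K)"
    and lin: "\<And>f s. f \<in> hol X W \<Longrightarrow> s \<in> carrier ?F \<Longrightarrow> \<Phi> W (f \<odot>\<^bsub>?F\<^esub> s) = f \<odot>\<^bsub>?K\<^esub> \<Phi> W s"
    using iso W(1,4) unfolding sheaf_iso_on_def by blast+
  have smultK: "restrict f W \<odot>\<^bsub>?K\<^esub> \<omega> = pull f \<odot>\<^bsub>?S\<^esub> \<omega>" for f \<omega>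
    by (simp only: sections_GR pull_def P_def)
  have smultF: "restrict f W \<odot>\<^bsub>?F\<^esub> s \<in> carrier ?F" if "f \<in> hol X O'" "s \<in> carrier ?F" for f s
    using hol_mult[OF X W(1) res_hol[OF that(1)]] that(2) by (auto simp: sections_free_sheaf PiE_iff)
  \<comment> \<open>Of this section only the entry with index 0, equal to 1, matters below.\<close>
  define e where "e = (\<lambda>i\<in>{..<r}. \<lambda>y\<in>W. 1 :: complex)"
  have e: "e \<in> carrier ?F"
    using hol_const[OF X W(1)] by (simp add: e_def sections_free_sheaf)
  have "\<Phi> W e \<in> holomorphic_forms n n M P"
    using bij e unfolding sections_GR P_def[symmetric] by (rule bij_betwE[THEN bspec])
  then have "h \<odot>\<^bsub>?S\<^esub> \<Phi> W e \<in> carrier ?K"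
    unfolding sections_GR P_def[symmetric] by (rule holomorphic_forms_smult[OF lm P h(1)])
  then have "h \<odot>\<^bsub>?S\<^esub> \<Phi> W e \<in> \<Phi> W ` carrier ?F"
    by (simp only: bij_betw_imp_surj_on[OF bij])
  then obtain q where q: "q \<in> carrier ?F" "\<Phi> W q = h \<odot>\<^bsub>?S\<^esub> \<Phi> W e"
    by (elim imageE) simp
  \<comment> \<open>The computation \<open>\<Phi>(b q) = b h \<Phi>(e) = a \<Phi>(e) = \<Phi>(a e)\<close>.\<close>
  have "\<Phi> W (restrict b W \<odot>\<^bsub>?F\<^esub> q) = pull b \<odot>\<^bsub>?S\<^esub> (h \<odot>\<^bsub>?S\<^esub> \<Phi> W e)"
    by (simp only: lin[OF res_hol[OF b] q(1)] smultK q(2))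
  also have "\<dots> = (\<lambda>p\<in>P. pull b p * h p) \<odot>\<^bsub>?S\<^esub> \<Phi> W e" by (rule form_smult_smult)
  also have "(\<lambda>p\<in>P. pull b p * h p) = (\<lambda>p\<in>P. pull a p)" by (rule restrict_ext) (simp add: h(2))
  also have "\<dots> = pull a" unfolding pull_def by (rule restrict_ext) simp
  also have "pull a \<odot>\<^bsub>?S\<^esub> \<Phi> W e = \<Phi> W (restrict a W \<odot>\<^bsub>?F\<^esub> e)"
    by (simp only: lin[OF res_hol[OF a] e] smultK)
  finally have "restrict b W \<odot>\<^bsub>?F\<^esub> q = restrict a W \<odot>\<^bsub>?F\<^esub> e"
    by (rule inj_onD[OF bij_betw_imp_inj_on[OF bij] _ smultF[OF b q(1)] smultF[OF a e]])
  then have "b y * q 0 y = a y" if "y \<in> W" for y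
    using r that by (auto simp: sections_free_sheaf e_def fun_eq_iff dest!: spec[of _ 0] spec[of _ y])
  moreover have "q 0 \<in> hol X W" using q(1) r by (auto simp: sections_free_sheaf)
  ultimately show "\<exists>W q. openin (topo X) W \<and> x \<in> W \<and> W \<subseteq> O' \<and> q \<in> hol X W \<and> (\<forall>y\<in>W. a y = q y * b y)"
    using W by (intro exI[of _ W] exI[of _ "q 0"]) (auto simp: mult.commute)
qed

theorem corollary4p8:
  fixes X :: "'a function_space" and M :: "'b function_space" and \<pi> :: "'b \<Rightarrow> 'a" and n :: nat
  assumes "complex_space X"
    and "pure_dimensional X n"
    and "locally_irreducible X"
    and "\<not> normal_complex_space X"
    and "resolution n X M \<pi>"
  shows "\<not> locally_free X (GR_canonical_sheaf n M \<pi>)"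
proof
  assume "locally_free X (GR_canonical_sheaf n M \<pi>)"
  then have "normal_complex_space X"
    using locally_free_GR_stalk_integrally_closed[OF complex_space_locally_modelled[OF assms(1)] assms(5)]
    by (simp add: normal_complex_space_def)
  then show False using assms(4) by simp
qed

end
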